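(* The asymptotic representation $$\mathcal{P}_{n}(t)=\frac{\mu^{n}}{\sqrt{n}}\cdot\frac{(1-\mu t)^2(1-\mu^3/t)^2}{(1-\mu^4)R}\left(\frac{\chi(nt)-\chi(n\mu^2/t)}{t-\mu^2/t}+O(1/n)\right)$$ holds true locally uniformly on $D$ as $n\to\infty$.
   Context: Fix $R>2$. Let $L_1=\{w-1+(w-1)^{-1}:|w|=R\}$; this is an analytic Jordan curve. Let $G_1$ be the bounded component of $\mathbb{C}\setminus L_1$, and let $\{p_n\}_{n\ge 0}$ be the unique sequence of polynomials such that $p_n$ has degree $n$ and positive leading coefficient and $$\frac1\pi\int_{G_1}p_n(z)\overline{p_m(z)}\,dx\,dy=\begin{cases}0,& n\ne m,\\ 1,& n=m.\end{cases}$$ Set $$\mu=\frac{R-\sqrt{R^2-4}}{2}\in(0,1),\qquad \psi(w)=Rw-1+\frac1{Rw-1},\qquad \lambda(z)=\frac{z-\mu}{\mu z-1},$$ $$\chi(t)=t\sum_{k=-\infty}^{\infty}\mu^{4k}e^{(\mu-\mu^{-1})\mu^{4k}t},\quad \Re(t)>0,$$ $$D=\{t\in\mathbb{C}:|t-1/R|<1/R,\ \Re(t)>R\mu^2/2\},\qquad \mathcal{P}_n(t)=p_n(\psi(\lambda(t))),\quad n\ge 0.$$ "Locally uniformly on $D$" means that for each compact subset of $D$ the constant in $O(1/n)$ can be chosen independently of $t$ in that subset. At $t=\mu$ the quotient $\frac{\chi(nt)-\chi(n\mu^2/t)}{t-\mu^2/t}$, which has a removable singularity there, is understood as its limit. 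*)

theory Defs
  imports "HOL-Analysis.Analysis" "HOL-Computational_Algebra.Polynomial"
begin

definition curve_L1 :: "real \<Rightarrow> complex set" where
  "curve_L1 R = (\<lambda>w. w - 1 + inverse (w - 1)) ` {w. cmod w = R}"

text \<open>For a Jordan curve, \<^const>\<open>inside\<close> is the unique bounded component of the complement.\<close>

definition region_G1 :: "real \<Rightarrow> complex set" where
  "region_G1 R = inside (curve_L1 R)"

definition area_orthonormal_polys :: "complex set \<Rightarrow> (nat \<Rightarrow> complex poly) \<Rightarrow> bool" where
  "area_orthonormal_polys G p \<longleftrightarrow>
     (\<forall>n. degree (p n) = n \<and> lead_coeff (p n) \<in> \<real> \<and> Re (lead_coeff (p n)) > 0) \<and>
     (\<forall>n m. complex_of_real (1 / pi) * (LINT z:G|lborel. poly (p n) z * cnj (poly (p m) z))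
              = (if n = m then 1 else 0))"

definition mu :: "real \<Rightarrow> real" where
  "mu R = (R - sqrt (R\<^sup>2 - 4)) / 2"

definition psi :: "real \<Rightarrow> complex \<Rightarrow> complex" where
  "psi R w = complex_of_real R * w - 1 + 1 / (complex_of_real R * w - 1)"

definition lam :: "real \<Rightarrow> complex \<Rightarrow> complex" where
  "lam R z = (z - complex_of_real (mu R)) / (complex_of_real (mu R) * z - 1)"

text \<open>Meaningful for positive real part of the argument, where the two-sided series
  converges absolutely.\<close>

definition chi :: "real \<Rightarrow> complex \<Rightarrow> complex" where
  "chi R t = t * (\<Sum>\<^sub>\<infinity>k::int. complex_of_real (mu R powi (4 * k)) *
     exp (complex_of_real ((mu R - inverse (mu R)) * mu R powi (4 * k)) * t))"

definition domain_D :: "real \<Rightarrow> complex set" where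
  "domain_D R = {t. cmod (t - complex_of_real (1 / R)) < 1 / R \<and> Re t > R * (mu R)\<^sup>2 / 2}"

definition calP :: "real \<Rightarrow> (nat \<Rightarrow> complex poly) \<Rightarrow> nat \<Rightarrow> complex \<Rightarrow> complex" where
  "calP R p n t = poly (p n) (psi R (lam R t))"

definition chi_quot :: "real \<Rightarrow> nat \<Rightarrow> complex \<Rightarrow> complex" where
  "chi_quot R n t =
     (let m = complex_of_real (mu R);
          q = (\<lambda>s. (chi R (of_nat n * s) - chi R (of_nat n * m\<^sup>2 / s)) / (s - m\<^sup>2 / s))
      in if t = m then Lim (at m) q else q t)"

text \<open>\<open>g\<close> is the comparison sequence inside the \<open>O\<close>; both the constant and the index from
  which the bound holds depend only on the compact set.\<close>

definition bigo_locally_uniformly ::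
    "complex set \<Rightarrow> (nat \<Rightarrow> complex \<Rightarrow> complex) \<Rightarrow> (nat \<Rightarrow> real) \<Rightarrow> bool" where
  "bigo_locally_uniformly D E g \<longleftrightarrow>
     (\<forall>K. compact K \<and> K \<subseteq> D \<longrightarrow>
        (\<exists>C. \<forall>\<^sub>F n in sequentially. \<forall>t\<in>K. cmod (E n t) \<le> C * g n))"

end

theory Submission
  imports Defs "HOL-Complex_Analysis.Complex_Analysis"
begin

text \<open>
Write \<open>m\<close> for the number called mu in the statement, so that \<open>R = m + 1 / m\<close>, and put
\<open>h = psi \<circ> lam\<close>. In the variable \<open>u = R * lam t - 1\<close> the map \<open>h\<close> is the Joukowski map
\<open>u + 1 / u\<close>, and the exchange of \<open>u\<close> and \<open>1 / u\<close> is the involution \<open>t \<mapsto> m\<^sup>2 / t\<close>. Hence \<open>h\<close> is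
invariant under this involution, maps the unit circle to the boundary curve, and maps the
annulus \<open>m < |t| < 1\<close> bijectively onto the region without a real segment.

\<^bold>\<open>Exact structure.\<close> Green's formula turns the area pairing into a mean over the unit circle; the
inner circle \<open>|t| = m\<close> contributes nothing, because the involution acts on it as complex
conjugation (\<open>area_integral_as_circle_mean\<close>). A polynomial in \<open>u + 1 / u\<close> has the form
\<open>q(u) + q(1 / u)\<close>, so an antiderivative of \<open>p\<^sub>n\<close> becomes \<open>V(t) + V(m\<^sup>2 / t)\<close>, where
\<open>V = U \<circ> lam\<close> and \<open>U\<close> is a polynomial of degree \<open>n + 1\<close>. In terms of Taylor coefficients \<open>v\<close> and
\<open>w\<close> the pairing is \<open>\<Sum>i. i (1 - m\<^bsup>4 i\<^esup>) v\<^sub>i cnj w\<^sub>i\<close>: it is the Dirichlet pairing on the unit disc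
of \<open>V(t) - V(m\<^sup>4 t)\<close> with \<open>W(t)\<close>. The Dirichlet pairing is invariant under the disc automorphism
\<open>lam\<close>, so with \<open>tau(w) = lam(m\<^sup>4 lam(w))\<close> orthogonality of \<open>p\<^sub>n\<close> to lower degrees says precisely
that the Taylor coefficients of orders \<open>1, ..., n\<close> of the defect \<open>U - U \<circ> tau\<close> vanish
(\<open>orthonormal_structure\<close>).

\<^bold>\<open>Asymptotics.\<close> The map \<open>tau\<close> sends a disc of radius larger than one well inside the unit disc,
and the normalisation \<open>\<Sum>i. i (1 - m\<^bsup>4 i\<^esup>) |v\<^sub>i|\<^sup>2 = 1\<close> bounds \<open>U\<close> on its image independently of \<open>n\<close>, up to an additive constant.
The Taylor coefficients of \<open>U \<circ> tau\<close> therefore decay geometrically, and the derivative of the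
defect is \<open>sqrt (n + 1) w\<^sup>n\<close> up to an error \<open>O(w\<^sup>n / n\<^sup>2)\<close> on the unit disc (\<open>defect_deriv_asymptotics\<close>).
The equation \<open>V(t) - V(m\<^sup>4 t) = defect (lam t)\<close> is solved by iteration, which writes \<open>V'(t)\<close> as a
series over \<open>k \<ge> 0\<close> whose terms live at the points \<open>m\<^bsup>4 k\<^esup> t\<close>. Near the origin \<open>lam s\<close> agrees with
\<open>m exp (- (1 / m - m) s)\<close> up to \<open>O(s\<^sup>2)\<close>, so the series is \<open>chi (n t) / (n t)\<close> times
\<open>- (1 - m\<^sup>2) sqrt n m\<^sup>n\<close>, with an error \<open>O(sqrt n m\<^sup>n / n\<^sup>2)\<close>; the terms with \<open>k < 0\<close> that
\<open>chi\<close> contains in addition are covered by that error (\<open>vlam_deriv_chi_estimate\<close>).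
All of this is uniform where \<open>2 Re t - R |t|\<^sup>2\<close> is bounded below by a positive constant, a condition
that describes the disc \<open>|t - 1 / R| < 1 / R\<close>.

Finally \<open>p\<^sub>n(h(t)) h'(t) = V'(t) - (m\<^sup>2 / t\<^sup>2) V'(m\<^sup>2 / t)\<close>, and the second condition defining the
domain says that \<open>m\<^sup>2 / t\<close> lies in the same disc. Division by \<open>h'(t)\<close> gives the formula
away from the zero \<open>t = m\<close> of \<open>h'\<close>, and the maximum principle carries the error bound across that
point.
\<close>

section \<open>Area integrals and conformal maps\<close>

text \<open>
Lebesgue measure is determined by the volumes of boxes, so a relabelling of coordinates preserves
it. The complex plane is read as \<open>real ^ 2\<close> for the change of variables formula and as
\<open>real \<times> real\<close> for iterated integrals.
\<close>

lemma lborel_distr_basis_bijection: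
  fixes T :: "'a::euclidean_space \<Rightarrow> 'b::euclidean_space"
  assumes bij: "bij_betw \<pi> (Basis :: 'b set) (Basis :: 'a set)"
    and T: "\<And>x b. b \<in> Basis \<Longrightarrow> T x \<bullet> b = x \<bullet> \<pi> b"
    and meas: "T \<in> borel_measurable borel"
  shows "distr lborel borel T = lborel"
proof (rule lborel_eqI[symmetric])
  fix l u :: 'b assume lu: "\<And>b. b \<in> Basis \<Longrightarrow> l \<bullet> b \<le> u \<bullet> b"
  define L where "L = (\<lambda>v::'b. \<Sum>a\<in>Basis. (v \<bullet> the_inv_into Basis \<pi> a) *\<^sub>R (a::'a))"
  have inv: "the_inv_into Basis \<pi> (\<pi> b) = b" if "b \<in> Basis" for b
    using bij that by (simp add: bij_betw_def the_inv_into_f_f)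
  have piB: "\<pi> b \<in> Basis" if "b \<in> Basis" for b
    using bij that by (auto simp: bij_betw_def)
  have inn: "L v \<bullet> \<pi> b = v \<bullet> b" if "b \<in> Basis" for v b
    unfolding L_def using piB[OF that] inv[OF that] by simp
  have img: "\<pi> ` Basis = Basis" using bij by (simp add: bij_betw_def)
  have "T -` box l u = box (L l) (L u)"
  proof -
    have "x \<in> box (L l) (L u) \<longleftrightarrow> (\<forall>b\<in>Basis. L l \<bullet> \<pi> b < x \<bullet> \<pi> b \<and> x \<bullet> \<pi> b < L u \<bullet> \<pi> b)" for x
      by (subst mem_box, subst img[symmetric]) auto
    then show ?thesis by (auto simp: mem_box inn T)
  qed
  then have "emeasure (distr lborel borel T) (box l u) = emeasure lborel (box (L l) (L u))"
    using meas by (simp add: emeasure_distr)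
  also have "\<dots> = (\<Prod>a\<in>Basis. (L u - L l) \<bullet> a)"
  proof (rule emeasure_lborel_box)
    fix a :: 'a assume "a \<in> Basis"
    then obtain b where "b \<in> Basis" "a = \<pi> b" using img by auto
    then show "L l \<bullet> a \<le> L u \<bullet> a" using lu inn by simp
  qed
  also have "(\<Prod>a\<in>Basis. (L u - L l) \<bullet> a) = (\<Prod>b\<in>Basis. (u - l) \<bullet> b)"
    by (subst img[symmetric], subst prod.reindex)
       (use bij inn in \<open>auto simp: bij_betw_def inner_diff_left intro!: prod.cong\<close>)
  finally show "emeasure (distr lborel borel T) (box l u) = (\<Prod>b\<in>Basis. (u - l) \<bullet> b)" .
qed simp

lemma bij_betw_pairs: "x \<noteq> y \<Longrightarrow> u \<noteq> v \<Longrightarrow> bij_betw (\<lambda>b. if b = x then u else v) {x,y} {u,v}"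
  by (auto simp: bij_betw_def inj_on_def)

lemma lborel_distr_Complex_vec:
  "distr lborel borel (\<lambda>v::real^2. Complex (v$1) (v$2)) = lborel"
proof (rule lborel_distr_basis_bijection)
  have B: "(Basis :: (real^2) set) = {axis 1 1, axis 2 1}"
    by (auto simp: Basis_vec_def UNIV_2)
  show "bij_betw (\<lambda>b::complex. if b = 1 then axis 1 1 else axis 2 1) Basis (Basis :: (real^2) set)"
    unfolding B Basis_complex_def by (rule bij_betw_pairs) (auto simp: axis_eq_axis)
  show "(\<lambda>v::real^2. Complex (v$1) (v$2)) \<in> borel_measurable borel"
    by (intro borel_measurable_continuous_onI continuous_intros)
qed (auto simp: Basis_complex_def inner_axis)

lemma lborel_distr_Complex_pair:
  "distr lborel borel (\<lambda>v. Complex (fst v) (snd v)) = lborel"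
proof (rule lborel_distr_basis_bijection)
  have B: "(Basis :: (real\<times>real) set) = {(1,0), (0,1)}"
    by (auto simp: Basis_prod_def)
  show "bij_betw (\<lambda>b::complex. if b = 1 then (1,0) else (0,1)) Basis (Basis :: (real\<times>real) set)"
    unfolding B Basis_complex_def by (rule bij_betw_pairs) auto
  show "(\<lambda>v. Complex (fst v) (snd v)) \<in> borel_measurable borel"
    by (intro borel_measurable_continuous_onI continuous_intros)
qed (auto simp: Basis_complex_def)

lemma set_integral_lborel_pullback:
  fixes T :: "'a::euclidean_space \<Rightarrow> complex" and f :: "complex \<Rightarrow> complex"
  assumes T: "distr lborel borel T = lborel" and [measurable]: "T \<in> borel_measurable borel"
    and int: "set_integrable lborel A f"
  shows "(\<lambda>x. f (T x)) absolutely_integrable_on (T -` A)"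
    and "(LINT z:A|lborel. f z) = integral (T -` A) (\<lambda>x. f (T x))"
proof -
  define F where "F = (\<lambda>z. indicat_real A z *\<^sub>R f z)"
  have F: "integrable (distr lborel borel T) F"
    using int unfolding T F_def set_integrable_def .
  then have [measurable]: "F \<in> borel_measurable borel" by auto
  have FT: "(\<lambda>x. F (T x)) = (\<lambda>x. indicat_real (T -` A) x *\<^sub>R f (T x))"
    by (auto simp: F_def indicator_def)
  have si: "set_integrable lborel (T -` A) (\<lambda>x. f (T x))"
    unfolding set_integrable_def FT[symmetric] by (rule integrable_distr[OF _ F]) simp
  then show "(\<lambda>x. f (T x)) absolutely_integrable_on (T -` A)"
    unfolding set_integrable_def by (simp add: integrable_completion)
  have "(LINT z:A|lborel. f z) = integral\<^sup>L (distr lborel borel T) F"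
    unfolding T F_def set_lebesgue_integral_def ..
  also have "\<dots> = (LINT x|lborel. F (T x))" by (rule integral_distr) auto
  also have "\<dots> = (LINT x:(T -` A)|lborel. f (T x))"
    unfolding FT set_lebesgue_integral_def ..
  also have "\<dots> = integral (T -` A) (\<lambda>x. f (T x))"
    by (rule set_borel_integral_eq_integral(2)[OF si])
  finally show "(LINT z:A|lborel. f z) = integral (T -` A) (\<lambda>x. f (T x))" .
qed

lemma set_integrable_lborel_bounded_continuous:
  fixes f :: "'a::euclidean_space \<Rightarrow> 'b::euclidean_space"
  assumes "A \<in> sets borel" "A \<subseteq> K" "compact K" "continuous_on K f"
  shows "set_integrable lborel A f"
  using set_integrable_subset[OF borel_integrable_compact[OF assms(3,4), folded set_integrable_def]]
    assms by auto

text \<open>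
By the Cauchy-Riemann equations the Jacobian determinant of a holomorphic map is the squared modulus
of its derivative.
\<close>

lemma set_integral_conformal_image:
  fixes g g' \<phi> :: "complex \<Rightarrow> complex"
  assumes S: "open S" "S \<subseteq> K" "compact K"
    and g: "\<And>s. s \<in> K \<Longrightarrow> (g has_field_derivative g' s) (at s)"
    and g': "continuous_on K g'" and inj: "inj_on g S" and \<phi>: "continuous_on UNIV \<phi>"
  shows "(LINT z:g ` S|lborel. \<phi> z) = (LINT s:S|lborel. of_real ((cmod (g' s))\<^sup>2) * \<phi> (g s))"
proof -
  define T where "T = (\<lambda>v::real^2. Complex (v$1) (v$2))"
  define T' where "T' = (\<lambda>z. vector [Re z, Im z] :: real^2)"
  have TT'[simp]: "T (T' z) = z" for z by (simp add: T_def T'_def complex_eq_iff)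
  have T'T[simp]: "T' (T v) = v" for v by (simp add: T_def T'_def vec_eq_iff forall_2)
  have blT: "bounded_linear T" unfolding T_def
    by (rule linear_conv_bounded_linear[THEN iffD1])
       (auto intro!: linearI simp: complex_eq_iff)
  have blT': "bounded_linear T'" unfolding T'_def
    by (rule linear_conv_bounded_linear[THEN iffD1])
       (auto intro!: linearI simp: vec_eq_iff forall_2)
  have dT: "distr lborel borel T = lborel" unfolding T_def by (rule lborel_distr_Complex_vec)
  have mT: "T \<in> borel_measurable borel"
    using blT by (intro borel_measurable_continuous_onI linear_continuous_on)
  have hol: "g holomorphic_on S"
    using g S by (meson subsetD holomorphic_on_open)
  have og: "open (g ` S)"
    by (rule open_mapping_thm3[OF hol S(1) inj])
  have contg: "continuous_on K g"
    using g by (meson DERIV_isCont continuous_at_imp_continuous_on)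
  have int1: "set_integrable lborel (g ` S) \<phi>"
    using og S contg \<phi>
    by (intro set_integrable_lborel_bounded_continuous[of _ "g ` K"])
       (auto intro: compact_continuous_image continuous_on_subset)
  have int2: "set_integrable lborel S (\<lambda>s. of_real ((cmod (g' s))\<^sup>2) * \<phi> (g s))"
    using S contg g' \<phi>
    by (intro set_integrable_lborel_bounded_continuous[of _ K])
       (auto intro!: continuous_intros intro: continuous_on_compose2)
  define G where "G = (\<lambda>v. T' (g (T v)))"
  define G' where "G' = (\<lambda>v w. T' (g' (T v) * T w))"
  define f where "f = (\<lambda>v. T' (\<phi> (T v)))"
  have im: "T -` (g ` S) = G ` (T -` S)"
  proof (intro equalityI subsetI)
    fix v assume "v \<in> T -` (g ` S)"
    then obtain s where s: "s \<in> S" "T v = g s" by auto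
    then have "v = G (T' s)" "T' s \<in> T -` S" by (simp_all add: G_def flip: s(2))
    then show "v \<in> G ` (T -` S)" by blast
  qed (auto simp: G_def)
  \<comment> \<open>The real matrix of multiplication by \<open>g' (T v)\<close>.\<close>
  have det: "\<bar>det (matrix (G' v))\<bar> = (cmod (g' (T v)))\<^sup>2" for v
    unfolding cmod_power2 unfolding power2_eq_square
    by (simp add: det_2 matrix_def G'_def T'_def T_def axis_def)
  have fabs: "f absolutely_integrable_on (G ` (T -` S))"
    unfolding f_def im[symmetric]
    using absolutely_integrable_linear[OF set_integral_lborel_pullback(1)[OF dT mT int1] blT']
    by (simp add: o_def)
  have openS': "open (T -` S)"
    using blT S(1) by (metis linear_continuous_on open_vimage)
  have cov: "(\<lambda>v. \<bar>det (matrix (G' v))\<bar> *\<^sub>R f (G v)) absolutely_integrable_on (T -` S) \<and>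
        integral (T -` S) (\<lambda>v. \<bar>det (matrix (G' v))\<bar> *\<^sub>R f (G v)) = integral (G ` (T -` S)) f"
  proof (rule iffD2[OF has_absolute_integral_change_of_variables[where g=G and g'=G' and f=f]])
    show "T -` S \<in> sets lebesgue" using openS' by (simp add: sets_completionI_sets)
    show "inj_on G (T -` S)"
      using inj unfolding inj_on_def G_def by (metis T'T TT' vimageE)
    fix v assume v: "v \<in> T -` S"
    have "(g has_derivative (\<lambda>h. g' (T v) * h)) (at (T v))"
      using g v S(2) by (auto simp: has_field_derivative_def)
    then have "((\<lambda>v. T' (g (T v))) has_derivative (\<lambda>w. T' (g' (T v) * T w))) (at v)"
      by (intro bounded_linear.has_derivative[OF blT'])
         (rule has_derivative_compose[OF bounded_linear_imp_has_derivative[OF blT]])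
    then show "(G has_derivative G' v) (at v within T -` S)"
      unfolding G_def G'_def by (rule has_derivative_at_withinI)
  next
    show "f absolutely_integrable_on G ` (T -` S) \<and>
        integral (G ` (T -` S)) f = integral (G ` (T -` S)) f" using fabs by simp
  qed
  have "(LINT z:g ` S|lborel. \<phi> z) = integral (G ` (T -` S)) (\<lambda>v. T (f v))"
    unfolding set_integral_lborel_pullback(2)[OF dT mT int1] im f_def by simp
  also have "\<dots> = T (integral (G ` (T -` S)) f)"
    using integral_linear[OF _ blT] fabs set_lebesgue_integral_eq_integral(1)
    by (fastforce simp: o_def)
  also have "\<dots> = T (integral (T -` S) (\<lambda>v. \<bar>det (matrix (G' v))\<bar> *\<^sub>R f (G v)))"
    using cov by simp
  also have "\<dots> = integral (T -` S) (\<lambda>v. T (\<bar>det (matrix (G' v))\<bar> *\<^sub>R f (G v)))"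
    using integral_linear[OF _ blT] cov set_lebesgue_integral_eq_integral(1)
    by (fastforce simp: o_def)
  also have "\<dots> = integral (T -` S) (\<lambda>v. of_real ((cmod (g' (T v)))\<^sup>2) * \<phi> (g (T v)))"
    unfolding det linear_cmul[OF bounded_linear.linear[OF blT]] 
    by (simp add: f_def G_def scaleR_conv_of_real)
  also have "\<dots> = (LINT s:S|lborel. of_real ((cmod (g' s))\<^sup>2) * \<phi> (g s))"
    unfolding set_integral_lborel_pullback(2)[OF dT mT int2] ..
  finally show ?thesis .
qed

lemma set_integral_complex_box:
  fixes \<Psi> :: "complex \<Rightarrow> complex"
  assumes "continuous_on (cbox (Complex a c) (Complex b d)) \<Psi>"
  shows "(LINT s:box (Complex a c) (Complex b d)|lborel. \<Psi> s) =
          integral {a..b} (\<lambda>x. integral {c..d} (\<lambda>y. \<Psi> (Complex x y)))"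
proof -
  define T where "T = (\<lambda>v. Complex (fst v) (snd v))"
  have dT: "distr lborel borel T = lborel" unfolding T_def by (rule lborel_distr_Complex_pair)
  have cT: "continuous_on A T" for A unfolding T_def by (intro continuous_intros)
  have mT: "T \<in> borel_measurable borel"
    using cT by (intro borel_measurable_continuous_onI)
  have int: "set_integrable lborel (box (Complex a c) (Complex b d)) \<Psi>"
    using assms box_subset_cbox
    by (intro set_integrable_lborel_bounded_continuous[of _ "cbox (Complex a c) (Complex b d)"]) auto
  have vim: "T -` box (Complex a c) (Complex b d) = box (a,c) (b,d)"
    by (auto simp: T_def box_def Basis_complex_def Basis_prod_def)
  have vimc: "T ` cbox (a,c) (b,d) \<subseteq> cbox (Complex a c) (Complex b d)"
    by (auto simp: T_def cbox_def Basis_complex_def Basis_prod_def)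
  have "(LINT s:box (Complex a c) (Complex b d)|lborel. \<Psi> s) = integral (box (a,c) (b,d)) (\<lambda>v. \<Psi> (T v))"
    unfolding set_integral_lborel_pullback(2)[OF dT mT int] vim ..
  also have "\<dots> = integral (cbox (a,c) (b,d)) (\<lambda>v. \<Psi> (T v))"
    by (rule integral_open_interval)
  also have "\<dots> = integral (cbox a b) (\<lambda>x. integral (cbox c d) (\<lambda>y. \<Psi> (T (x,y))))"
    by (rule integral_prod_continuous)
       (use vimc in \<open>auto intro!: continuous_on_compose2[OF assms cT]\<close>)
  finally show ?thesis by (simp add: T_def)
qed

section \<open>The Joukowski map and the region\<close>

definition joukowski :: "complex \<Rightarrow> complex" where
  "joukowski u = u + 1 / u"

lemma joukowski_inverse: "joukowski (1 / u) = joukowski u"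
  by (simp add: joukowski_def)

lemma joukowski_eq_iff:
  assumes "u \<noteq> 0" "v \<noteq> 0"
  shows "joukowski u = joukowski v \<longleftrightarrow> u = v \<or> u * v = 1"
proof -
  have "joukowski u = joukowski v \<longleftrightarrow> (u - v) * (u * v - 1) = 0"
    using assms by (simp add: joukowski_def field_simps)
  then show ?thesis by simp
qed

lemma joukowski_surj_outside_disc: "\<exists>u. cmod u \<ge> 1 \<and> joukowski u = z"
proof -
  define d where "d = csqrt (z\<^sup>2 - 4)"
  have d2: "d\<^sup>2 = z\<^sup>2 - 4" by (simp add: d_def)
  define u v where "u = (z + d) / 2" and "v = (z - d) / 2"
  have uv: "u * v = 1" using d2 by (simp add: u_def v_def power2_eq_square field_simps)
  then have nz: "u \<noteq> 0" "v \<noteq> 0" by auto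
  have vu: "1 / u = v" "1 / v = u" using uv nz by (simp_all add: field_simps)
  have J: "joukowski u = z" "joukowski v = z"
    unfolding joukowski_def vu by (simp_all add: u_def v_def field_simps)
  have "cmod u * cmod v = 1" by (metis norm_mult norm_one uv)
  then have "cmod u \<ge> 1 \<or> cmod v \<ge> 1"
    using mult_strict_mono[of "cmod u" 1 "cmod v" 1] by fastforce
  then show ?thesis using J by auto
qed

lemma joukowski_unimodular_real:
  assumes "cmod u = 1" shows "joukowski u \<in> \<real>"
proof -
  have "1 / u = cnj u"
    using assms by (simp add: complex_div_cnj[of 1 u])
  then show ?thesis by (simp add: joukowski_def complex_is_Real_iff)
qed

text \<open>
Two points outside the open unit disc with the same image are equal or conjugate on the unit circle.
Hence the distance to \<open>-1\<close> of a preimage outside the disc depends on the image only, and it decides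
whether a point lies inside, on or outside the curve.
\<close>

lemma joukowski_fibre_distance:
  assumes "joukowski u = joukowski v" "cmod u \<ge> 1" "cmod v \<ge> 1"
  shows "cmod (u + 1) = cmod (v + 1)"
proof -
  have nz: "u \<noteq> 0" "v \<noteq> 0" using assms by auto
  then consider "u = v" | "u * v = 1" using assms joukowski_eq_iff by blast
  then show ?thesis
  proof cases
    case 2
    then have p: "cmod u * cmod v = 1" by (metis norm_mult norm_one)
    have "cmod u * 1 \<le> cmod u * cmod v" by (rule mult_left_mono) (use assms in auto)
    then have u1: "cmod u = 1" using p assms by linarith
    then have "u * cnj u = 1" by (simp flip: complex_norm_square)
    then have "v = cnj u" using 2 nz by (metis mult_left_cancel)
    then have "v + 1 = cnj (u + 1)" by simp
    then show ?thesis by (metis complex_mod_cnj)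
  qed simp
qed

lemma open_joukowski_image:
  assumes "open W" "0 \<notin> W" shows "open (joukowski ` W)"
proof (rule open_mapping_thm2[where S = "- {0}"])
  show "joukowski holomorphic_on - {0}"
    unfolding joukowski_def by (intro holomorphic_intros) auto
  show "W \<subseteq> - {0}" using assms by auto
  fix X :: "complex set" assume X: "open X" "X \<subseteq> - {0}" "X \<noteq> {}"
  show "\<not> joukowski constant_on X"
  proof
    assume "joukowski constant_on X"
    then obtain c where c: "\<And>x. x \<in> X \<Longrightarrow> joukowski x = c" by (auto simp: constant_on_def)
    obtain u where u: "u \<in> X" using X by auto
    have "X \<subseteq> {u, 1 / u}"
    proof
      fix v assume v: "v \<in> X"
      have "u \<noteq> 0" "v \<noteq> 0" using X u v by auto
      moreover have "joukowski u = joukowski v" using c u v by simp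
      ultimately show "v \<in> {u, 1/u}" by (auto simp: joukowski_eq_iff field_simps)
    qed
    then have "finite X" by (rule finite_subset) simp
    then show False using X finite_imp_not_open by blast
  qed
qed (use assms in auto)

text \<open>
The plane is split by the curve into two open sets, according to the distance of the outer preimage
from \<open>-1\<close>. One is bounded, and the other is connected and unbounded; so no component of the
complement of the curve meets both, and the first set is the inside.
\<close>

lemma region_G1_eq:
  assumes "R > 2"
  shows "region_G1 R = joukowski ` {u. cmod u \<ge> 1 \<and> cmod (u + 1) < R}"
    and "open (region_G1 R)" and "bounded (region_G1 R)"
proof -
  define In where "In = joukowski ` {u. cmod u \<ge> 1 \<and> cmod (u + 1) < R}"
  define Out where "Out = joukowski ` {u. cmod (u + 1) > R}"
  define C where "C = curve_L1 R"
  have big: "cmod u \<ge> 1" if "cmod (u + 1) \<ge> R" for u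
    using that assms norm_triangle_ineq[of u 1] by simp
  have C: "C = joukowski ` {u. cmod (u + 1) = R}"
  proof -
    have "{u. cmod (u + 1) = R} = (\<lambda>w. w - 1) ` {w. cmod w = R}"
    proof (intro equalityI subsetI)
      fix u assume "u \<in> {u. cmod (u + 1) = R}"
      then show "u \<in> (\<lambda>w. w - 1) ` {w. cmod w = R}" by (intro image_eqI[of _ _ "u + 1"]) auto
    qed auto
    then show ?thesis
      by (simp add: C_def curve_L1_def image_image joukowski_def inverse_eq_divide)
  qed
  have cover: "- C \<subseteq> In \<union> Out"
  proof
    fix z assume z: "z \<in> - C"
    obtain u where u: "cmod u \<ge> 1" "joukowski u = z" using joukowski_surj_outside_disc by blast
    then have "cmod (u + 1) < R \<or> cmod (u + 1) > R" using z C by fastforce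
    then show "z \<in> In \<union> Out" unfolding In_def Out_def using u by blast
  qed
  have disj: "In \<inter> Out = {}" "In \<inter> C = {}" "Out \<inter> C = {}"
  proof -
    have sep: "joukowski ` {u. cmod u \<ge> 1 \<and> P (cmod (u + 1))} \<inter>
               joukowski ` {u. cmod u \<ge> 1 \<and> Q (cmod (u + 1))} = {}"
      if "\<And>x. P x \<Longrightarrow> \<not> Q x" for P Q
    proof (rule ccontr)
      assume "\<not> ?thesis"
      then obtain u v where "cmod u \<ge> 1" "P (cmod (u + 1))" "cmod v \<ge> 1" "Q (cmod (v + 1))"
        "joukowski u = joukowski v" by auto
      with joukowski_fibre_distance[of u v] that show False by metis
    qed
    have "Out = joukowski ` {u. cmod u \<ge> 1 \<and> cmod (u + 1) > R}"
      and "C = joukowski ` {u. cmod u \<ge> 1 \<and> cmod (u + 1) = R}"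
      unfolding Out_def C using big by (auto intro!: arg_cong[of _ _ "\<lambda>A. joukowski ` A"])
    then show "In \<inter> Out = {}" "In \<inter> C = {}" "Out \<inter> C = {}"
      unfolding In_def using sep[of "\<lambda>x. x < R" "\<lambda>x. x > R"] sep[of "\<lambda>x. x < R" "\<lambda>x. x = R"]
        sep[of "\<lambda>x. x > R" "\<lambda>x. x = R"] by simp_all
  qed
  \<comment> \<open>The condition on \<open>1 / u\<close> makes the preimage open without changing its image.\<close>
  have W: "In = joukowski ` {u. u \<noteq> 0 \<and> cmod (u + 1) < R \<and> cmod (1 / u + 1) < R}" (is "_ = _ ` ?W")
  proof (intro equalityI subsetI)
    fix z assume "z \<in> In"
    then obtain u where u: "cmod u \<ge> 1" "cmod (u + 1) < R" "z = joukowski u" by (auto simp: In_def)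
    have "cmod (1 / u + 1) \<le> cmod (1 / u) + 1" using norm_triangle_ineq[of "1/u" 1] by simp
    also have "cmod (1 / u) \<le> 1" using u(1) by (auto simp: norm_divide divide_simps)
    finally have "cmod (1 / u + 1) < R" using assms by simp
    then show "z \<in> joukowski ` ?W" using u by (intro image_eqI[of _ _ u]) auto
  next
    fix z assume "z \<in> joukowski ` ?W"
    then obtain u where u: "u \<noteq> 0" "cmod (u + 1) < R" "cmod (1 / u + 1) < R" "z = joukowski u" by auto
    show "z \<in> In"
    proof (cases "cmod u \<ge> 1")
      case True then show ?thesis using u by (auto simp: In_def)
    next
      case False
      then have "cmod (1/u) \<ge> 1" using u by (simp add: norm_divide)
      then have "joukowski (1/u) \<in> In" using u by (auto simp: In_def)
      then show ?thesis using u joukowski_inverse by simp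
    qed
  qed
  have "open ?W"
  proof -
    have "open (- {0} \<inter> (\<lambda>u. (cmod (u + 1), cmod (1 / u + 1))) -` ({..<R} \<times> {..<R}))"
      by (intro continuous_open_preimage open_Times continuous_intros) auto
    moreover have "- {0} \<inter> (\<lambda>u. (cmod (u + 1), cmod (1 / u + 1))) -` ({..<R} \<times> {..<R}) = ?W"
      by auto
    ultimately show ?thesis by simp
  qed
  then have oIn: "open In" unfolding W by (intro open_joukowski_image) auto
  have eqc: "{u. cmod (u + 1) > R} = - cball (-1) R"
  proof -
    have "dist (-1) u = cmod (u + 1)" for u :: complex by (metis dist_commute dist_norm diff_minus_eq_add)
    then show ?thesis by auto
  qed
  have oOut: "open Out" unfolding Out_def
  proof (rule open_joukowski_image)
    show "open {u. cmod (u + 1) > R}" unfolding eqc by (simp add: open_Compl)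
    show "0 \<notin> {u. cmod (u + 1) > R}" using assms by simp
  qed
  have cOut: "connected Out" unfolding Out_def
  proof (rule connected_continuous_image)
    show "connected {u. cmod (u + 1) > R}"
      unfolding eqc by (rule connected_complement_bounded_convex) auto
    show "continuous_on {u. R < cmod (u + 1)} joukowski"
      unfolding joukowski_def using assms by (intro continuous_intros) auto
  qed
  have bIn: "bounded In"
  proof (rule boundedI)
    fix z assume "z \<in> In"
    then obtain u where u: "cmod u \<ge> 1" "cmod (u + 1) < R" "z = joukowski u" by (auto simp: In_def)
    have "cmod z \<le> cmod u + cmod (1/u)" unfolding u joukowski_def by (rule norm_triangle_ineq)
    also have "cmod (1/u) \<le> 1" using u(1) by (auto simp: norm_divide divide_simps)
    also have "cmod u \<le> R + 1" using u norm_triangle_ineq4[of "u+1" 1] by simp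
    finally show "cmod z \<le> R + 2" by simp
  qed
  have ubOut: "\<not> bounded Out"
  proof
    assume "bounded Out"
    then obtain B where B: "\<And>z. z \<in> Out \<Longrightarrow> cmod z \<le> B" by (auto simp: bounded_iff)
    define x where "x = \<bar>B\<bar> + R + 2"
    have "complex_of_real x + 1 = of_real (x + 1)" by simp
    then have "cmod (complex_of_real x + 1) = \<bar>x + 1\<bar>" by (metis norm_of_real real_norm_def)
    then have "cmod (complex_of_real x + 1) > R" using assms unfolding x_def by linarith
    then have "joukowski (of_real x) \<in> Out" by (auto simp: Out_def)
    then have "cmod (joukowski (of_real x)) \<le> B" by (rule B)
    moreover have "joukowski (of_real x) = of_real (x + 1/x)" by (simp add: joukowski_def)
    ultimately have "\<bar>x + 1/x\<bar> \<le> B" by (metis norm_of_real real_norm_def)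
    moreover have "x > 0" "x > B" using assms by (auto simp: x_def)
    moreover have "1/x > 0" using \<open>x > 0\<close> by simp
    ultimately show False by linarith
  qed
  have "inside C = In"
  proof (intro equalityI subsetI)
    fix z assume z: "z \<in> inside C"
    then have zC: "z \<notin> C" and b: "bounded (connected_component_set (- C) z)"
      by (auto simp: inside_def)
    show "z \<in> In"
    proof (rule ccontr)
      assume "z \<notin> In"
      then have "z \<in> Out" using zC cover by auto
      then have "Out \<subseteq> connected_component_set (- C) z"
        using cOut disj by (intro connected_component_maximal) auto
      then show False using b ubOut bounded_subset by blast
    qed
  next
    fix z assume z: "z \<in> In"
    have "connected_component_set (- C) z \<subseteq> In"
    proof (rule ccontr)
      define X where "X = connected_component_set (- C) z"
      assume n: "\<not> connected_component_set (- C) z \<subseteq> In"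
      have X: "connected X" "X \<subseteq> In \<union> Out"
        using cover connected_component_subset[of "-C" z] by (auto simp: X_def)
      have "z \<in> X" unfolding X_def using z disj by (auto simp: connected_component_refl)
      then have "In \<inter> X \<noteq> {}" using z by auto
      moreover have "Out \<inter> X \<noteq> {}" using n X unfolding X_def by auto
      ultimately show False
        using connectedD[OF X(1) oIn oOut] X disj by auto
    qed
    then show "z \<in> inside C"
      using z disj bIn by (auto simp: inside_def intro: bounded_subset)
  qed
  then have "region_G1 R = In" by (simp add: region_G1_def C_def)
  then show "region_G1 R = joukowski ` {u. cmod u \<ge> 1 \<and> cmod (u + 1) < R}"
     "open (region_G1 R)" "bounded (region_G1 R)"
    using oIn bIn by (simp_all add: In_def)
qed

section \<open>Green's formula on a rectangle\<close>

text \<open>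
With \<open>\<Phi> = F cnj G\<close> one has \<open>2 F cnj G' = \<partial>\<^sub>x \<Phi> + \<i> \<partial>\<^sub>y \<Phi>\<close>. The \<open>y\<close>-derivative integrates to zero by
periodicity and the \<open>x\<close>-derivative leaves the two vertical sides.
\<close>

lemma green_rectangle:
  fixes F G :: "complex \<Rightarrow> complex"
  assumes S: "open S" "cbox (Complex a c) (Complex b d) \<subseteq> S" and "a \<le> b" "c \<le> d"
    and F: "F holomorphic_on S" and G: "G holomorphic_on S"
    and per: "\<And>x. x \<in> {a..b} \<Longrightarrow> F (Complex x d) = F (Complex x c)"
             "\<And>x. x \<in> {a..b} \<Longrightarrow> G (Complex x d) = G (Complex x c)"
  shows "integral {a..b} (\<lambda>x. integral {c..d} (\<lambda>y. F (Complex x y) * cnj (deriv G (Complex x y)))) =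
          (integral {c..d} (\<lambda>y. F (Complex b y) * cnj (G (Complex b y))) -
           integral {c..d} (\<lambda>y. F (Complex a y) * cnj (G (Complex a y)))) / 2"
proof -
  define F' G' where "F' = deriv F" and "G' = deriv G"
  define Px where "Px = (\<lambda>x y. F' (Complex x y) * cnj (G (Complex x y)) + F (Complex x y) * cnj (G' (Complex x y)))"
  define Py where "Py = (\<lambda>x y. \<i> * (F' (Complex x y) * cnj (G (Complex x y)) - F (Complex x y) * cnj (G' (Complex x y))))"
  have inS: "Complex x y \<in> S" if "x \<in> {a..b}" "y \<in> {c..d}" for x y
    using that S(2) by (auto simp: cbox_def Basis_complex_def subset_iff)
  have dF: "(F has_field_derivative F' z) (at z)" and dG: "(G has_field_derivative G' z) (at z)"
    if "z \<in> S" for z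
    using that F G S(1) unfolding F'_def G'_def by (simp_all add: holomorphic_derivI)
  have cont: "continuous_on S F" "continuous_on S G" "continuous_on S F'" "continuous_on S G'"
    using F G S(1) unfolding F'_def G'_def
    by (auto intro: holomorphic_on_imp_continuous_on holomorphic_deriv)
  have cont2: "continuous_on ({a..b} \<times> {c..d}) (\<lambda>v. f (Complex (fst v) (snd v)))"
    if "continuous_on S f" for f :: "complex \<Rightarrow> complex"
    by (rule continuous_on_compose2[OF that]) (auto intro!: continuous_intros inS)
  have box: "cbox (a,c) (b,d) = {a..b} \<times> {c..d}" by (auto simp: cbox_Pair_eq)
  have contP: "continuous_on (cbox (a,c) (b,d)) (\<lambda>(x,y). Px x y)"
    "continuous_on (cbox (a,c) (b,d)) (\<lambda>(x,y). Py x y)"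
    unfolding Px_def Py_def case_prod_unfold box by (intro continuous_intros cont2 cont)+
  have vx: "((\<lambda>x. f (Complex x y)) has_vector_derivative f') (at x within T)"
    if "(f has_field_derivative f') (at (Complex x y))" for f f' x y T
  proof -
    have "((\<lambda>x. Complex x y) has_vector_derivative 1) (at x)"
      unfolding Complex_eq by (auto intro!: derivative_eq_intros)
    from field_vector_diff_chain_at[OF this that] show ?thesis
      by (simp add: o_def has_vector_derivative_at_within)
  qed
  have vy: "((\<lambda>y. f (Complex x y)) has_vector_derivative \<i> * f') (at y within T)"
    if "(f has_field_derivative f') (at (Complex x y))" for f f' x y T
  proof -
    have "((\<lambda>y. Complex x y) has_vector_derivative \<i>) (at y)"
      unfolding Complex_eq by (auto intro!: derivative_eq_intros)
    from field_vector_diff_chain_at[OF this that] show ?thesis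
      by (simp add: o_def has_vector_derivative_at_within)
  qed
  have iPx: "integral {a..b} (\<lambda>x. Px x y) =
      F (Complex b y) * cnj (G (Complex b y)) - F (Complex a y) * cnj (G (Complex a y))"
    if y: "y \<in> {c..d}" for y
    by (intro integral_unique fundamental_theorem_of_calculus \<open>a \<le> b\<close>)
       (auto simp: Px_def intro!: derivative_eq_intros vx[OF dF] vx[OF dG] inS y)
  have iPy: "integral {c..d} (\<lambda>y. Py x y) = 0" if x: "x \<in> {a..b}" for x
  proof -
    have "((\<lambda>y. Py x y) has_integral F (Complex x d) * cnj (G (Complex x d)) -
        F (Complex x c) * cnj (G (Complex x c))) {c..d}"
      by (intro fundamental_theorem_of_calculus \<open>c \<le> d\<close>)
         (auto simp: Py_def algebra_simps intro!: derivative_eq_intros vy[OF dF] vy[OF dG] inS x)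
    then show ?thesis using per[OF x] by (simp add: integral_unique)
  qed
  have "F (Complex x y) * cnj (deriv G (Complex x y)) = (Px x y + \<i> * Py x y) / 2" for x y
    by (simp add: Px_def Py_def G'_def algebra_simps)
  then have "integral {a..b} (\<lambda>x. integral {c..d} (\<lambda>y. F (Complex x y) * cnj (deriv G (Complex x y))))
     = integral {a..b} (\<lambda>x. integral {c..d} (\<lambda>y. (Px x y + \<i> * Py x y) / 2))" by (simp only:)
  also have "\<dots> = integral {a..b} (\<lambda>x. integral {c..d} (\<lambda>y. Px x y) / 2)"
  proof (rule integral_cong)
    fix x assume x: "x \<in> {a..b}"
    have c1: "continuous_on {c..d} (\<lambda>y. Px x y)" "continuous_on {c..d} (\<lambda>y. Py x y)"
      using contP x unfolding box
      by (auto intro!: continuous_on_compose2[OF contP(1)[unfolded box], of _ "\<lambda>y. (x,y)", simplified]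
         continuous_on_compose2[OF contP(2)[unfolded box], of _ "\<lambda>y. (x,y)", simplified] continuous_intros)
    have i1: "(\<lambda>y. Px x y) integrable_on {c..d}" "(\<lambda>y. \<i> * Py x y) integrable_on {c..d}"
      using c1 by (auto intro!: integrable_continuous_interval continuous_intros)
    show "integral {c..d} (\<lambda>y. (Px x y + \<i> * Py x y) / 2) = integral {c..d} (\<lambda>y. Px x y) / 2"
      using i1 iPy[OF x] by (simp add: integral_add)
  qed
  also have "\<dots> = integral {a..b} (\<lambda>x. integral {c..d} (\<lambda>y. Px x y)) / 2" by simp
  also have "integral {a..b} (\<lambda>x. integral {c..d} (\<lambda>y. Px x y)) = integral {c..d} (\<lambda>y. integral {a..b} (\<lambda>x. Px x y))"
    using integral_swap_continuous[OF contP(1)] by simp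
  also have "\<dots> = integral {c..d} (\<lambda>y. F (Complex b y) * cnj (G (Complex b y)) - F (Complex a y) * cnj (G (Complex a y)))"
    using iPx by (intro integral_cong) auto
  also have "\<dots> = integral {c..d} (\<lambda>y. F (Complex b y) * cnj (G (Complex b y))) -
           integral {c..d} (\<lambda>y. F (Complex a y) * cnj (G (Complex a y)))"
    using \<open>a \<le> b\<close>
    by (intro integral_diff integrable_continuous_interval continuous_intros
        continuous_on_compose2[OF cont(1)] continuous_on_compose2[OF cont(2)])
       (auto intro!: inS continuous_intros)
  finally show ?thesis .
qed

locale bergman_region =
  fixes R :: real
  assumes R_gt: "2 < R"
begin

abbreviation \<mu> :: real where "\<mu> \<equiv> mu R"
abbreviation m :: complex where "m \<equiv> complex_of_real (mu R)"

lemma mu_props: "0 < \<mu>" "\<mu> < 1" "R * \<mu> = \<mu>\<^sup>2 + 1"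
proof -
  define s where "s = sqrt (R\<^sup>2 - 4)"
  have R2: "R\<^sup>2 > 4" using R_gt power_strict_mono[of 2 R 2] by simp
  then have s2: "s\<^sup>2 = R\<^sup>2 - 4" "s > 0" by (simp_all add: s_def)
  have "s < R" using s2 R_gt by (intro power2_less_imp_less[of s R]) auto
  moreover have mm: "\<mu> = (R - s) / 2" by (simp add: mu_def s_def)
  ultimately show "0 < \<mu>" by simp
  have "(R - 2)\<^sup>2 < s\<^sup>2" using R_gt unfolding s2 by (simp add: power2_eq_square algebra_simps)
  then have "R - 2 < s" using s2 by (intro power2_less_imp_less[of "R - 2" s]) auto
  then show "\<mu> < 1" using mm by simp
  show "R * \<mu> = \<mu>\<^sup>2 + 1" using s2 unfolding mm by (simp add: power2_eq_square field_simps)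
qed

lemma R_eq: "R = \<mu> + 1 / \<mu>"
  using mu_props by (simp add: field_simps power2_eq_square)

definition h :: "complex \<Rightarrow> complex" where "h t = psi R (lam R t)"

text \<open>
The variable \<open>R * lam R t - 1\<close> of the Joukowski map, as a single fractional linear map of \<open>t\<close>.
\<close>

definition u :: "complex \<Rightarrow> complex" where "u t = (t - m ^ 3) / (m * (m * t - 1))"

lemma mobius_u:
  assumes "m * t \<noteq> 1" shows "R * lam R t - 1 = u t"
proof -
  have "m \<noteq> (0::complex)" "m * t - 1 \<noteq> 0" using mu_props assms by auto
  moreover have Rc: "of_real R * m = (m)\<^sup>2 + (1::complex)"
    using mu_props(3) by (metis of_real_1 of_real_add of_real_mult of_real_power)
  ultimately have "m * (of_real R * (t - m) - (m * t - 1)) = t - m ^ 3"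
    by (simp add: algebra_simps power2_eq_square power3_eq_cube)
  then show ?thesis using \<open>m \<noteq> (0::complex)\<close> \<open>m * t - 1 \<noteq> 0\<close>
    unfolding lam_def u_def by (simp add: divide_simps) (simp add: algebra_simps)
qed

lemma h_eq_joukowski: "m * t \<noteq> 1 \<Longrightarrow> h t = joukowski (u t)"
  by (simp add: h_def psi_def joukowski_def flip: mobius_u)

lemma u_involution:
  assumes "t \<noteq> 0" "m * t \<noteq> 1" "t \<noteq> m ^ 3"
  shows "u (m\<^sup>2 / t) = 1 / u t"
proof -
  have "m \<noteq> (0::complex)" using mu_props by auto
  moreover have "m ^ 3 - t \<noteq> 0" "m * t - 1 \<noteq> 0" using assms by auto
  moreover have "m * (m\<^sup>2 / t) - 1 = (m ^ 3 - t) / t"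
    using assms by (simp add: field_simps power2_eq_square power3_eq_cube)
  moreover have "m\<^sup>2 / t - m ^ 3 = - m\<^sup>2 * (m * t - 1) / t"
    using assms by (simp add: field_simps power2_eq_square power3_eq_cube)
  ultimately show ?thesis
    unfolding u_def using assms by (simp add: divide_simps) (simp add: algebra_simps eval_nat_numeral)
qed

lemma h_involution:
  assumes "t \<noteq> 0" "m * t \<noteq> 1" "t \<noteq> m ^ 3"
  shows "h (m\<^sup>2 / t) = h t"
proof -
  have "m * (m\<^sup>2 / t) \<noteq> 1"
    using assms by (auto simp: field_simps power2_eq_square power3_eq_cube)
  then show ?thesis
    using assms by (simp add: h_eq_joukowski u_involution[OF assms, simplified] joukowski_inverse)
qed

text \<open>
Both circles \<open>|u| = 1\<close> and \<open>|t| = \<mu>\<close> are the same curve: the difference of the squared moduli of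
numerator and denominator of \<open>u\<close> is a positive multiple of \<open>|t|\<^sup>2 - \<mu>\<^sup>2\<close>.
\<close>

lemma norm_u_gt_1_iff:
  assumes "m * t \<noteq> 1" shows "cmod (u t) > 1 \<longleftrightarrow> cmod t > \<mu>"
proof -
  have d: "m * (m * t - 1) \<noteq> 0" using mu_props assms by auto
  have m4: "\<mu> ^ 4 < 1" using mu_props by (simp add: power_less_one_iff)
  have key: "(cmod (t - m ^ 3))\<^sup>2 - (cmod (m * (m * t - 1)))\<^sup>2 = (1 - \<mu> ^ 4) * ((cmod t)\<^sup>2 - \<mu>\<^sup>2)"
    unfolding norm_mult power_mult_distrib cmod_power2
    by (simp add: power2_eq_square power3_eq_cube power4_eq_xxxx algebra_simps)
  have "cmod (u t) > 1 \<longleftrightarrow> cmod (m * (m * t - 1)) < cmod (t - m ^ 3)"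
    using d unfolding u_def norm_divide by (subst less_divide_eq_1_pos) simp_all
  also have "\<dots> \<longleftrightarrow> (cmod (m * (m * t - 1)))\<^sup>2 < (cmod (t - m ^ 3))\<^sup>2"
    by (simp add: not_le[symmetric] abs_le_square_iff[symmetric])
  also have "\<dots> \<longleftrightarrow> 0 < (1 - \<mu> ^ 4) * ((cmod t)\<^sup>2 - \<mu>\<^sup>2)"
    using key by linarith
  also have "\<dots> \<longleftrightarrow> \<mu>\<^sup>2 < (cmod t)\<^sup>2" using m4 by (simp add: zero_less_mult_iff)
  also have "\<dots> \<longleftrightarrow> \<mu> < cmod t"
    using mu_props by (simp add: not_le[symmetric] abs_le_square_iff[symmetric])
  finally show ?thesis .
qed

lemma norm_lam_compare:
  assumes "m * t \<noteq> 1"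
  shows "cmod (lam R t) < 1 \<longleftrightarrow> cmod t < 1" and "cmod (lam R t) \<le> 1 \<longleftrightarrow> cmod t \<le> 1"
proof -
  have d: "m * t - 1 \<noteq> 0" using assms by auto
  have m2: "\<mu>\<^sup>2 < 1" using mu_props by (simp add: power_less_one_iff)
  have key: "(cmod (m * t - 1))\<^sup>2 - (cmod (t - m))\<^sup>2 = (1 - \<mu>\<^sup>2) * (1 - (cmod t)\<^sup>2)"
    unfolding cmod_power2 by (simp add: power2_eq_square algebra_simps)
  have "cmod (lam R t) < 1 \<longleftrightarrow> cmod (t - m) < cmod (m * t - 1)"
    using d unfolding lam_def norm_divide by (subst divide_less_eq_1_pos) simp_all
  also have "\<dots> \<longleftrightarrow> (cmod (t - m))\<^sup>2 < (cmod (m * t - 1))\<^sup>2"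
    by (simp add: not_le[symmetric] abs_le_square_iff[symmetric])
  also have "\<dots> \<longleftrightarrow> 0 < (1 - \<mu>\<^sup>2) * (1 - (cmod t)\<^sup>2)"
    using key by linarith
  also have "\<dots> \<longleftrightarrow> (cmod t)\<^sup>2 < 1\<^sup>2" using m2 by (simp add: zero_less_mult_iff)
  also have "\<dots> \<longleftrightarrow> cmod t < 1"
    by (simp add: abs_square_less_1)
  finally show "cmod (lam R t) < 1 \<longleftrightarrow> cmod t < 1" .
  have "cmod (lam R t) \<le> 1 \<longleftrightarrow> cmod (t - m) \<le> cmod (m * t - 1)"
    using d unfolding lam_def norm_divide by (subst divide_le_eq_1_pos) simp_all
  also have "\<dots> \<longleftrightarrow> (cmod (t - m))\<^sup>2 \<le> (cmod (m * t - 1))\<^sup>2"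
    by (simp add: abs_le_square_iff[symmetric])
  also have "\<dots> \<longleftrightarrow> 0 \<le> (1 - \<mu>\<^sup>2) * (1 - (cmod t)\<^sup>2)"
    using key by linarith
  also have "\<dots> \<longleftrightarrow> (cmod t)\<^sup>2 \<le> 1\<^sup>2" using m2 by (simp add: zero_le_mult_iff)
  also have "\<dots> \<longleftrightarrow> cmod t \<le> 1"
    by (subst abs_le_square_iff[symmetric]) simp
  finally show "cmod (lam R t) \<le> 1 \<longleftrightarrow> cmod t \<le> 1" .
qed

lemma lam_involution:
  assumes "m * t \<noteq> 1" shows "lam R (lam R t) = t" and "m * lam R t \<noteq> 1"
proof -
  have m2: "\<mu>\<^sup>2 < 1" using mu_props by (simp add: power_less_one_iff)
  then have m2': "1 - m\<^sup>2 \<noteq> 0"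
    by (metis eq_iff_diff_eq_0 less_irrefl of_real_1 of_real_eq_iff of_real_power)
  have d: "m * t - 1 \<noteq> 0" using assms by auto
  have e1: "m * lam R t - 1 = (1 - m\<^sup>2) / (m * t - 1)"
    using d unfolding lam_def by (simp add: divide_simps) (simp add: algebra_simps power2_eq_square)
  have e2: "lam R t - m = (1 - m\<^sup>2) * t / (m * t - 1)"
    using d unfolding lam_def by (simp add: divide_simps) (simp add: algebra_simps power2_eq_square)
  show "m * lam R t \<noteq> 1" using e1 d m2' by auto
  have "lam R (lam R t) = (lam R t - m) / (m * lam R t - 1)" by (subst lam_def) simp
  also have "\<dots> = t" unfolding e1 e2 using d m2' by simp
  finally show "lam R (lam R t) = t" .
qed

end

section \<open>An annulus as parameter domain\<close>

definition circle_mean :: "(complex \<Rightarrow> complex) \<Rightarrow> complex" where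
  "circle_mean f = integral {0..1} (\<lambda>y. f (exp (2 * pi * \<i> * of_real y)))"

lemma set_integral_diff_null:
  fixes f :: "'a::euclidean_space \<Rightarrow> 'b::euclidean_space"
  assumes "A \<in> sets borel" "B \<in> sets borel" "B \<subseteq> A" "negligible (A - B)" and f: "continuous_on UNIV f"
  shows "(LINT x:A|lborel. f x) = (LINT x:B|lborel. f x)"
  unfolding set_lebesgue_integral_def
proof (rule integral_cong_AE)
  have [measurable]: "f \<in> borel_measurable borel" using f by (rule borel_measurable_continuous_onI)
  note [measurable] = assms(1,2)
  show "(\<lambda>x. indicat_real A x *\<^sub>R f x) \<in> borel_measurable lborel"
    "(\<lambda>x. indicat_real B x *\<^sub>R f x) \<in> borel_measurable lborel" by measurable
  have "A - B \<in> null_sets lebesgue" using assms(4) by (simp add: negligible_iff_null_sets)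
  moreover have "A - B \<in> sets lborel" using assms by simp
  ultimately have "A - B \<in> null_sets lborel" by (simp add: null_sets_def)
  then have "AE x in lborel. x \<notin> A - B" by (rule AE_not_in)
  then show "AE x in lborel. indicat_real A x *\<^sub>R f x = indicat_real B x *\<^sub>R f x"
    by eventually_elim (use assms(3) in \<open>auto simp: indicator_def\<close>)
qed

context bergman_region
begin

lemma m_nz: "m \<noteq> 0" and norm_m: "cmod m = \<mu>"
  using mu_props by auto

lemma m_mult_ne_1: "cmod t < 1 / \<mu> \<Longrightarrow> m * t \<noteq> 1"
proof
  assume "cmod t < 1 / \<mu>" "m * t = 1"
  then have "cmod m * cmod t = 1" by (metis norm_mult norm_one)
  then show False using \<open>cmod t < 1 / \<mu>\<close> mu_props by (simp add: field_simps)
qed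

text \<open>
This annulus is mapped to itself by \<open>t \<mapsto> m\<^sup>2 / t\<close>, and the two poles \<open>1 / m\<close> and \<open>m\<^sup>3\<close> of \<open>h\<close> lie
on its boundary.
\<close>

definition ann :: "complex set" where "ann = {t. \<mu> ^ 3 < cmod t \<and> cmod t < 1 / \<mu>}"

lemma ann_D:
  assumes "t \<in> ann" shows "t \<noteq> 0" "m * t \<noteq> 1" "t \<noteq> m ^ 3"
  using assms mu_props m_mult_ne_1[of t] by (auto simp: ann_def norm_power)

lemma open_ann: "open ann"
  unfolding ann_def by (intro open_Collect_conj open_Collect_less continuous_intros)

lemma lam_holomorphic: "lam R holomorphic_on {t. m * t \<noteq> 1}"
  unfolding lam_def[abs_def] by (intro holomorphic_intros) auto

lemma u_nz: "t \<in> ann \<Longrightarrow> u t \<noteq> 0"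
  using ann_D[of t] m_nz by (auto simp: u_def)

lemma u_holomorphic: "u holomorphic_on ann"
  unfolding u_def[abs_def] using ann_D m_nz by (intro holomorphic_intros) auto

lemma h_holomorphic: "h holomorphic_on ann"
proof (rule holomorphic_transform)
  show "(\<lambda>t. u t + 1 / u t) holomorphic_on ann"
    using u_nz by (intro holomorphic_intros u_holomorphic) auto
qed (use ann_D in \<open>simp add: h_eq_joukowski joukowski_def\<close>)

lemma h_inj: "inj_on h {t. \<mu> < cmod t \<and> cmod t < 1}"
proof (rule inj_onI, clarify)
  fix s t assume st: "\<mu> < cmod s" "cmod s < 1" "\<mu> < cmod t" "cmod t < 1" "h s = h t"
  have "1 < 1 / \<mu>" using mu_props by simp
  then have ne: "m * s \<noteq> 1" "m * t \<noteq> 1" using st by (auto intro!: m_mult_ne_1)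
  then have big: "cmod (u s) > 1" "cmod (u t) > 1" using st norm_u_gt_1_iff by auto
  then have nz: "u s \<noteq> 0" "u t \<noteq> 0" by auto
  have "cmod (u s * u t) > 1" using big unfolding norm_mult by (simp add: less_1_mult)
  then have "u s * u t \<noteq> 1" by auto
  moreover have "joukowski (u s) = joukowski (u t)" using st ne h_eq_joukowski by simp
  ultimately have "u s = u t" using joukowski_eq_iff[OF nz] by simp
  then have "lam R s = lam R t" using ne R_gt by (simp flip: mobius_u)
  then show "s = t" using ne by (metis lam_involution(1))
qed

lemma negligible_Reals: "negligible (\<real> :: complex set)"
proof -
  have "(\<real> :: complex set) = {z. \<i> \<bullet> z = 0}"
    by (auto simp: complex_is_Real_iff inner_complex_def)
  moreover have "negligible {z. \<i> \<bullet> z = 0}" by (rule negligible_hyperplane) simp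
  ultimately show ?thesis by (simp only:)
qed

text \<open>
Logarithmic coordinates on the annulus \<open>\<mu> < |t| < 1\<close>. The period is normalised to \<open>\<i>\<close>, so that
the vertical sides of the box below have length one.
\<close>

definition strip_param :: "complex \<Rightarrow> complex" where "strip_param s = h (exp (complex_of_real (2 * pi) * s))"

definition strip_box :: "complex set" where
  "strip_box = box (Complex (ln \<mu> / (2 * pi)) 0) (Complex 0 1)"

definition strip_cbox :: "complex set" where
  "strip_cbox = cbox (Complex (ln \<mu> / (2 * pi)) 0) (Complex 0 1)"

lemma strip_box_iff:
  "s \<in> strip_box \<longleftrightarrow> \<mu> < cmod (exp (complex_of_real (2 * pi) * s)) \<and> cmod (exp (complex_of_real (2 * pi) * s)) < 1 \<and> 0 < Im s \<and> Im s < 1"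
proof -
  have "\<mu> < exp (2 * pi * Re s) \<longleftrightarrow> ln \<mu> < 2 * pi * Re s"
    using mu_props by (metis exp_less_cancel_iff exp_ln)
  moreover have "pi * Re s < 0 \<longleftrightarrow> Re s < 0" by (simp add: mult_less_0_iff)
  ultimately show ?thesis
    by (auto simp: strip_box_def box_def Basis_complex_def divide_less_eq mult.commute)
qed

lemma strip_cbox_D:
  assumes "s \<in> strip_cbox"
  shows "\<mu> \<le> cmod (exp (complex_of_real (2 * pi) * s))" "cmod (exp (complex_of_real (2 * pi) * s)) \<le> 1" "exp (complex_of_real (2 * pi) * s) \<in> ann"
proof -
  have "ln \<mu> \<le> 2 * pi * Re s" "Re s \<le> 0"
    using assms by (auto simp: strip_cbox_def cbox_def Basis_complex_def divide_le_eq mult.commute)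
  then show 1: "\<mu> \<le> cmod (exp (complex_of_real (2 * pi) * s))" "cmod (exp (complex_of_real (2 * pi) * s)) \<le> 1"
    using mu_props by (simp_all add: mult_le_0_iff flip: ln_ge_iff) (metis ln_le_cancel_iff exp_gt_zero ln_exp)
  have "\<mu> ^ 3 < \<mu>" using mu_props power_strict_decreasing[of 1 3 \<mu>] by simp
  moreover have "1 < 1 / \<mu>" using mu_props by simp
  ultimately show "exp (complex_of_real (2 * pi) * s) \<in> ann" using 1 unfolding ann_def mem_Collect_eq by linarith
qed

text \<open>
What the open box misses in the region are images of the slit along the positive reals and of the
circle \<open>|t| = \<mu>\<close>; there \<open>h\<close> is real, so they form a null set.
\<close>

lemma strip_param_image:
  "inj_on strip_param strip_box"
  "strip_param ` strip_box \<subseteq> region_G1 R"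
  "region_G1 R - strip_param ` strip_box \<subseteq> \<real>"
proof -
  show "inj_on strip_param strip_box"
  proof (rule inj_onI)
    fix s s' assume s: "s \<in> strip_box" "s' \<in> strip_box" "strip_param s = strip_param s'"
    then have "exp (complex_of_real (2 * pi) * s) = exp (complex_of_real (2 * pi) * s')"
      using h_inj by (auto simp: strip_param_def strip_box_iff inj_on_def)
    then obtain n :: int where "complex_of_real (2 * pi) * s = complex_of_real (2 * pi) * s' + (2 * real_of_int n * pi) * \<i>"
      unfolding exp_eq by (auto simp: exp_eq)
    then have n: "s = s' + n * \<i>"
    proof -
      have "2 * pi * Im s = 2 * pi * (Im s' + n)" and "2 * pi * Re s = 2 * pi * Re s'"
        using \<open>complex_of_real (2 * pi) * s = _\<close> by (auto simp: complex_eq_iff algebra_simps)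
      then have "Im s = Im s' + n" "Re s = Re s'" using pi_gt_zero by (metis mult_left_cancel mult_pos_pos less_irrefl zero_less_numeral)+
      then show ?thesis by (simp add: complex_eq_iff)
    qed
    then have "Im s = Im s' + n" by simp
    then have "\<bar>real_of_int n\<bar> < 1" using s by (auto simp: strip_box_iff)
    then have "n = 0" by linarith
    then show "s = s'" using n by simp
  qed
  have inv: "1 < 1 / \<mu>" using mu_props by simp
  show "strip_param ` strip_box \<subseteq> region_G1 R"
  proof clarify
    fix s assume s: "s \<in> strip_box"
    define t where "t = exp (complex_of_real (2 * pi) * s)"
    have t: "\<mu> < cmod t" "cmod t < 1" using s by (auto simp: t_def strip_box_iff)
    then have ne: "m * t \<noteq> 1" using inv by (auto intro!: m_mult_ne_1)
    have "u t + 1 = R * lam R t" using mobius_u[OF ne] by (metis diff_add_cancel)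
    then have "cmod (u t + 1) = R * cmod (lam R t)" using R_gt by (simp add: norm_mult)
    also have "\<dots> < R" using norm_lam_compare(1)[OF ne] t R_gt by simp
    finally have "cmod (u t + 1) < R" .
    moreover have "cmod (u t) \<ge> 1" using norm_u_gt_1_iff[OF ne] t by simp
    ultimately show "strip_param s \<in> region_G1 R"
      using h_eq_joukowski[OF ne] by (auto simp: region_G1_eq(1)[OF R_gt] strip_param_def t_def)
  qed
  show "region_G1 R - strip_param ` strip_box \<subseteq> \<real>"
  proof (rule subsetI, rule ccontr)
    fix z assume z: "z \<in> region_G1 R - strip_param ` strip_box" "z \<notin> \<real>"
    then obtain v where v: "cmod v \<ge> 1" "cmod (v + 1) < R" "z = joukowski v"
      by (auto simp: region_G1_eq(1)[OF R_gt])
    define w where "w = (v + 1) / R"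
    have "cmod w < 1" using v R_gt by (simp add: w_def norm_divide)
    then have mw: "m * w \<noteq> 1" using inv by (intro m_mult_ne_1) auto
    define t where "t = lam R w"
    have lt: "lam R t = w" and mt: "m * t \<noteq> 1" using lam_involution[OF mw] by (auto simp: t_def)
    have ut: "u t = v" using mobius_u[OF mt] R_gt by (simp add: lt w_def)
    have ht: "h t = z" using h_eq_joukowski[OF mt] ut v by simp
    have t1: "cmod t < 1" using norm_lam_compare(1)[OF mt] \<open>cmod w < 1\<close> lt by simp
    have "cmod v \<noteq> 1" using joukowski_unimodular_real z v by auto
    then have tm: "\<mu> < cmod t" using norm_u_gt_1_iff[OF mt] ut v by simp
    have nr: "t \<notin> \<real>"
    proof
      assume "t \<in> \<real>"
      then have "h t \<in> \<real>" unfolding h_def psi_def lam_def by auto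
      then show False using ht z by simp
    qed
    have t0: "t \<noteq> 0" using tm mu_props by auto
    define s where "s = Complex (ln (cmod t) / (2 * pi)) (Arg2pi t / (2 * pi))"
    have "complex_of_real (2 * pi) * s = Complex (ln (cmod t)) (Arg2pi t)" by (simp add: s_def complex_eq_iff)
    then have es: "exp (complex_of_real (2 * pi) * s) = t"
      using t0 Arg2pi_eq[of t] by (simp add: Complex_eq exp_add exp_of_real)
    have "Arg2pi t \<noteq> 0" using nr Arg2pi_eq_0 by (auto)
    then have "0 < Arg2pi t" "Arg2pi t < 2 * pi" using Arg2pi_ge_0[of t] Arg2pi_lt_2pi[of t] by auto
    then have "s \<in> strip_box" unfolding strip_box_iff es using tm t1 by (simp add: s_def)
    then have "z \<in> strip_param ` strip_box" using es ht by (force simp: strip_param_def)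
    then show False using z by simp
  qed
qed

end

section \<open>The area pairing as a mean over the unit circle\<close>

lemma integral_reverse_unit_interval:
  fixes k :: "real \<Rightarrow> complex"
  shows "integral {0..1} (\<lambda>y. k (1 - y)) = integral {0..1} k"
proof -
  have "integral {0..1} k = integral {-1..0} (\<lambda>y. k (- y))"
    using Henstock_Kurzweil_Integration.integral_reflect_real[of 1 0 k] by simp
  also have "\<dots> = integral {0..1} (\<lambda>y. k (1 - y))"
    using integral_shift_real_ivl[of "-1" "-1" 0 "\<lambda>y. k (- y)"] by simp
  finally show ?thesis ..
qed

context bergman_region
begin

lemma involution_ann: "t \<in> ann \<Longrightarrow> m\<^sup>2 / t \<in> ann"
proof -
  assume t: "t \<in> ann"
  have n: "cmod (m\<^sup>2 / t) = \<mu>\<^sup>2 / cmod t" using mu_props by (simp add: norm_divide norm_power)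
  have "cmod t > 0" using ann_D[OF t] by simp
  then show ?thesis using t mu_props unfolding ann_def mem_Collect_eq n
    by (auto simp: field_simps power2_eq_square power3_eq_cube)
qed

lemma involution_has_derivative:
  "t \<noteq> 0 \<Longrightarrow> ((\<lambda>t. m\<^sup>2 / t) has_field_derivative - m\<^sup>2 / t\<^sup>2) (at t)"
  by (auto intro!: derivative_eq_intros simp: power2_eq_square)

text \<open>
Obtained by differentiating the invariance \<open>f (m\<^sup>2 / t) = f t\<close>: the form \<open>f' dt\<close> is invariant, whereas
\<open>dt / t\<close> changes sign.
\<close>

lemma pullback_deriv_antisymmetric:
  assumes t: "t \<in> ann" and f: "f holomorphic_on ann" "\<And>t. t \<in> ann \<Longrightarrow> f (m\<^sup>2 / t) = f t"
  shows "m\<^sup>2 / t * deriv f (m\<^sup>2 / t) = - (t * deriv f t)"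
proof -
  have t0: "t \<noteq> 0" using ann_D t by auto
  have "(f has_field_derivative deriv f (m\<^sup>2 / t)) (at (m\<^sup>2 / t))"
    using f(1) open_ann involution_ann[OF t] by (rule holomorphic_derivI)
  from DERIV_chain2[OF this involution_has_derivative[OF t0]]
  have "(f has_field_derivative deriv f (m\<^sup>2 / t) * (- m\<^sup>2 / t\<^sup>2)) (at t)"
    by (rule has_field_derivative_transform_within_open[OF _ open_ann t]) (use f(2) in auto)
  then have "deriv f t = deriv f (m\<^sup>2 / t) * (- m\<^sup>2 / t\<^sup>2)" by (rule DERIV_imp_deriv)
  then show ?thesis using t0 by (simp add: field_simps power2_eq_square)
qed

text \<open>
Green's formula in logarithmic coordinates. The side over the circle \<open>|t| = \<mu>\<close> drops out: there
conjugation of \<open>t\<close> is the involution, under which \<open>cnj (Q (h t))\<close> is invariant and the factor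
\<open>t (P \<circ> h)'\<close> changes sign.
\<close>

lemma area_integral_as_circle_mean:
  "complex_of_real (1 / pi) *
     (LINT z:region_G1 R|lborel. poly (pderiv P) z * cnj (poly (pderiv Q) z)) =
   circle_mean (\<lambda>t. t * deriv (\<lambda>t. poly P (h t)) t * cnj (poly Q (h t)))"
proof -
  define S where "S = {s. exp (complex_of_real (2 * pi) * s) \<in> ann}"
  define e where "e = (\<lambda>s. exp (complex_of_real (2 * pi) * s))"
  define a where "a = ln \<mu> / (2 * pi)"
  define \<phi> where "\<phi> = (\<lambda>z. poly (pderiv P) z * cnj (poly (pderiv Q) z))"
  define Ph where "Ph = (\<lambda>t. poly P (h t))"
  define Qh where "Qh = (\<lambda>t. poly Q (h t))"
  define F where "F = (\<lambda>s. 2 * pi * (e s * deriv Ph (e s)))"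
  define G where "G = (\<lambda>s. Qh (e s))"
  have a0: "a \<le> 0" using mu_props by (simp add: a_def divide_nonpos_pos)
  have Scont: "continuous_on UNIV (\<lambda>s. exp (complex_of_real (2 * pi) * s))"
    by (intro continuous_intros)
  have oS: "open S"
    using continuous_open_preimage[OF Scont open_UNIV open_ann] by (simp add: S_def vimage_def)
  have KS: "strip_cbox \<subseteq> S" using strip_cbox_D by (auto simp: S_def)
  have bK: "strip_box \<subseteq> strip_cbox" unfolding strip_box_def strip_cbox_def by (rule box_subset_cbox)
  have hol_poly: "(\<lambda>t. poly p (h t)) holomorphic_on ann" for p
    by (rule holomorphic_on_compose_gen[OF h_holomorphic, of "poly p" UNIV, unfolded o_def])
       (auto intro!: holomorphic_intros)
  have hPh: "Ph holomorphic_on ann" and hQh: "Qh holomorphic_on ann"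
    unfolding Ph_def Qh_def by (rule hol_poly)+
  have eS: "e \<in> S \<rightarrow> ann" "e holomorphic_on S"
    by (auto simp: S_def e_def intro!: holomorphic_intros)
  have hF: "F holomorphic_on S" unfolding F_def
    by (intro holomorphic_intros eS holomorphic_on_compose_gen[OF eS(2) holomorphic_deriv[OF hPh open_ann], unfolded o_def])
       (use eS in auto)
  have hG: "G holomorphic_on S" unfolding G_def
    by (rule holomorphic_on_compose_gen[OF eS(2) hQh, unfolded o_def]) (use eS in auto)
  have de: "(e has_field_derivative 2 * pi * e s) (at s)" for s
    unfolding e_def by (auto intro!: derivative_eq_intros)
  have dh: "(h has_field_derivative deriv h t) (at t)" if "t \<in> ann" for t
    using h_holomorphic open_ann that by (rule holomorphic_derivI)
  define g' where "g' = (\<lambda>s. deriv h (e s) * (2 * pi * e s))"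
  have dg: "(strip_param has_field_derivative g' s) (at s)" if "s \<in> S" for s
    unfolding strip_param_def[abs_def] g'_def
    using DERIV_chain2[OF dh de[unfolded e_def], of s] that by (simp add: S_def e_def)
  have dPoly: "((\<lambda>t. poly p (h t)) has_field_derivative poly (pderiv p) (h t) * deriv h t) (at t)"
    if "t \<in> ann" for p t
    using DERIV_chain2[OF poly_DERIV dh[OF that]] .
  have F: "F s = poly (pderiv P) (strip_param s) * g' s" if "s \<in> S" for s
    using DERIV_imp_deriv[OF dPoly[of "e s" P]] that
    by (simp add: F_def Ph_def g'_def strip_param_def S_def e_def mult_ac)
  have dG: "deriv G s = poly (pderiv Q) (strip_param s) * g' s" if "s \<in> S" for s
  proof (rule DERIV_imp_deriv)
    show "(G has_field_derivative poly (pderiv Q) (strip_param s) * g' s) (at s)"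
      unfolding G_def Qh_def using DERIV_chain2[OF poly_DERIV dg[OF that], of Q]
      by (simp add: strip_param_def e_def)
  qed
  have cg': "continuous_on S g'"
    unfolding g'_def
    by (intro holomorphic_on_imp_continuous_on holomorphic_intros eS
       holomorphic_on_compose_gen[OF eS(2) holomorphic_deriv[OF h_holomorphic open_ann], unfolded o_def])
       (use eS in auto)
  have c\<phi>: "continuous_on UNIV \<phi>" unfolding \<phi>_def by (intro continuous_intros)
  have oimg: "open (strip_param ` strip_box)"
  proof (rule open_mapping_thm3)
    have "strip_param holomorphic_on S"
      using dg oS by (subst holomorphic_on_open) auto
    then show "strip_param holomorphic_on strip_box"
      by (rule holomorphic_on_subset) (use KS bK in auto)
    show "open strip_box" unfolding strip_box_def by (rule open_box)
  qed (rule strip_param_image)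
  have "(LINT z:region_G1 R|lborel. \<phi> z) = (LINT z:strip_param ` strip_box|lborel. \<phi> z)"
    using oimg strip_param_image region_G1_eq(2)[OF R_gt]
    by (intro set_integral_diff_null c\<phi> negligible_subset[OF negligible_Reals]) auto
  also have "\<dots> = (LINT s:strip_box|lborel. of_real ((cmod (g' s))\<^sup>2) * \<phi> (strip_param s))"
    by (rule set_integral_conformal_image[of _ strip_cbox])
       (use KS bK strip_param_image c\<phi> dg cg' in \<open>auto simp: strip_box_def strip_cbox_def open_box intro: continuous_on_subset\<close>)
  also have "\<dots> = (LINT s:strip_box|lborel. F s * cnj (deriv G s))"
  proof (rule set_lebesgue_integral_cong)
    show "\<forall>s. s \<in> strip_box \<longrightarrow> of_real ((cmod (g' s))\<^sup>2) * \<phi> (strip_param s) = F s * cnj (deriv G s)"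
      using bK KS by (auto simp: F dG \<phi>_def subset_iff complex_norm_square simp del: of_real_power)
  qed (auto simp: strip_box_def)
  also have "\<dots> = integral {a..0} (\<lambda>x. integral {0..1} (\<lambda>y. F (Complex x y) * cnj (deriv G (Complex x y))))"
    unfolding strip_box_def a_def[symmetric]
  proof (rule set_integral_complex_box)
    have "continuous_on S (\<lambda>s. F s * cnj (deriv G s))"
      using hF hG oS by (intro continuous_intros holomorphic_on_imp_continuous_on holomorphic_deriv)
    then show "continuous_on (cbox (Complex a 0) (Complex 0 1)) (\<lambda>s. F s * cnj (deriv G s))"
      using KS unfolding strip_cbox_def a_def[symmetric] by (rule continuous_on_subset)
  qed
  also have "\<dots> = (integral {0..1} (\<lambda>y. F (Complex 0 y) * cnj (G (Complex 0 y))) -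
           integral {0..1} (\<lambda>y. F (Complex a y) * cnj (G (Complex a y)))) / 2"
  proof (rule green_rectangle[OF oS _ a0 _ hF hG])
    have "e (Complex x 1) = e (Complex x 0)" for x
      unfolding e_def exp_eq by (intro exI[of _ 1]) (simp add: complex_eq_iff)
    then show "F (Complex x 1) = F (Complex x 0)" "G (Complex x 1) = G (Complex x 0)" for x
      by (simp_all add: F_def G_def)
  qed (use KS in \<open>auto simp: strip_cbox_def a_def\<close>)
  also have "integral {0..1} (\<lambda>y. F (Complex a y) * cnj (G (Complex a y))) = 0" (is "?I = 0")
  proof -
    define k where "k = (\<lambda>y. F (Complex a y) * cnj (G (Complex a y)))"
    have "k (1 - y) = - k y" if "y \<in> {0..1}" for y
    proof -
      define t where "t = e (Complex a y)"
      have "Complex a y \<in> strip_cbox" using that a0 by (simp add: strip_cbox_def cbox_def Basis_complex_def a_def)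
      then have t: "t \<in> ann" using KS by (auto simp: S_def t_def e_def)
      \<comment> \<open>The reflection \<open>y \<mapsto> 1 - y\<close> is complex conjugation of \<open>t\<close>, and \<open>|t|\<^sup>2 = \<mu>\<^sup>2\<close> on this side.\<close>
      have "e (Complex a (1 - y)) * t = exp (complex_of_real (2 * ln \<mu>) + complex_of_real (2 * pi) * \<i>)"
        unfolding t_def e_def exp_add[symmetric]
        by (intro arg_cong[of _ _ exp]) (simp add: complex_eq_iff a_def field_simps)
      also have "\<dots> = complex_of_real (exp (2 * ln \<mu>))"
        unfolding exp_add exp_of_real by simp
      also have "exp (2 * ln \<mu>) = \<mu>\<^sup>2"
        using mu_props by (simp add: exp_double)
      finally have "e (Complex a (1 - y)) = m\<^sup>2 / t"
        using ann_D[OF t] by (simp add: field_simps)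
      then show ?thesis
        using pullback_deriv_antisymmetric[OF t hPh] h_involution ann_D t
        by (simp add: k_def F_def G_def Ph_def Qh_def t_def[symmetric])
    qed
    then have "integral {0..1} (\<lambda>y. k (1 - y)) = integral {0..1} (\<lambda>y. - k y)"
      by (intro integral_cong) auto
    then have "integral {0..1} k = - integral {0..1} k"
      by (simp add: integral_reverse_unit_interval)
    then show ?thesis by (simp add: k_def)
  qed
  also have "integral {0..1} (\<lambda>y. F (Complex 0 y) * cnj (G (Complex 0 y))) =
       integral {0..1} (\<lambda>y. 2 * pi * (exp (2 * pi * \<i> * of_real y) * deriv Ph (exp (2 * pi * \<i> * of_real y)) *
          cnj (Qh (exp (2 * pi * \<i> * of_real y)))))"
  proof (rule integral_cong)
    fix y :: real
    have "e (Complex 0 y) = exp (2 * pi * \<i> * of_real y)"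
      unfolding e_def by (intro arg_cong[of _ _ exp]) (simp add: complex_eq_iff)
    then show "F (Complex 0 y) * cnj (G (Complex 0 y)) = 2 * pi * (exp (2 * pi * \<i> * of_real y) * deriv Ph (exp (2 * pi * \<i> * of_real y)) *
          cnj (Qh (exp (2 * pi * \<i> * of_real y))))"
      by (simp add: F_def G_def)
  qed
  also have "\<dots> = 2 * pi * circle_mean (\<lambda>t. t * deriv Ph t * cnj (Qh t))"
    unfolding circle_mean_def by (rule integral_mult_right)
  finally show ?thesis by (simp add: \<phi>_def Ph_def Qh_def)
qed

end

section \<open>Means of power series over the unit circle\<close>

lemma integral_sums_Weierstrass:
  fixes g :: "nat \<Rightarrow> real \<Rightarrow> complex"
  assumes cont: "\<And>i. continuous_on {0..1} (g i)"
    and bound: "\<And>i y. y \<in> {0..1} \<Longrightarrow> norm (g i y) \<le> M i" and M: "summable M"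
  shows "(\<lambda>i. integral {0..1} (g i)) sums integral {0..1} (\<lambda>y. \<Sum>i. g i y)"
    and "continuous_on {0..1} (\<lambda>y. \<Sum>i. g i y)"
proof -
  have ul: "uniform_limit {0..1} (\<lambda>n y. \<Sum>i<n. g i y) (\<lambda>y. \<Sum>i. g i y) sequentially"
    using bound M by (intro Weierstrass_m_test) auto
  have cn: "continuous_on {0..1} (\<lambda>y. \<Sum>i<n. g i y)" for n
    by (intro continuous_intros cont)
  show "continuous_on {0..1} (\<lambda>y. \<Sum>i. g i y)"
    by (rule uniform_limit_theorem[OF _ ul]) (use cn in auto)
  obtain I J where IJ: "\<And>n. ((\<lambda>y. \<Sum>i<n. g i y) has_integral I n) {0..1}"
    "((\<lambda>y. \<Sum>i. g i y) has_integral J) {0..1}" "I \<longlonglongrightarrow> J"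
    using uniform_limit_integral[OF ul] cn by auto
  have "((\<lambda>y. \<Sum>i<n. g i y) has_integral (\<Sum>i<n. integral {0..1} (g i))) {0..1}" for n
    by (intro has_integral_sum integrable_integral integrable_continuous_interval cont) auto
  then have "I = (\<lambda>n. \<Sum>i<n. integral {0..1} (g i))"
    using IJ(1) has_integral_unique by blast
  moreover have "J = integral {0..1} (\<lambda>y. \<Sum>i. g i y)" using IJ(2) by (rule integral_unique[symmetric])
  ultimately show "(\<lambda>i. integral {0..1} (g i)) sums integral {0..1} (\<lambda>y. \<Sum>i. g i y)"
    using IJ(3) by (simp add: sums_def)
qed

lemma circle_mean_cong:
  assumes "\<And>t. cmod t = 1 \<Longrightarrow> f t = g t" shows "circle_mean f = circle_mean g"
  unfolding circle_mean_def by (intro integral_cong assms) simp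

text \<open>
Absolute summability of the coefficients allows both sums to be taken out of the integral. The
functions \<open>p i\<close> and \<open>q j\<close> are powers of \<open>t\<close> or \<open>cnj t\<close> in one application, and powers of a disc
automorphism times a density in another.
\<close>

lemma circle_mean_product_series:
  assumes p: "\<And>i. continuous_on {t. cmod t = 1} (p i)" "\<And>i t. cmod t = 1 \<Longrightarrow> cmod (p i t) \<le> B"
    and q: "\<And>j. continuous_on {t. cmod t = 1} (q j)" "\<And>j t. cmod t = 1 \<Longrightarrow> cmod (q j t) \<le> B'"
    and c: "summable (\<lambda>i. norm (c i))" and d: "summable (\<lambda>j. norm (d j))"
    and f: "\<And>t. cmod t = 1 \<Longrightarrow> f t = (\<Sum>i. c i * p i t)"
    and g: "\<And>t. cmod t = 1 \<Longrightarrow> g t = (\<Sum>j. d j * q j t)"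
  shows "(\<lambda>i. c i * (\<Sum>j. d j * circle_mean (\<lambda>t. p i t * q j t))) sums circle_mean (\<lambda>t. f t * g t)"
proof -
  define E where "E y = exp (2 * pi * \<i> * complex_of_real y)" for y
  have E: "cmod (E y) = 1" for y by (simp add: E_def)
  have cE: "continuous_on {0..1} (\<lambda>y. k (E y))" if "continuous_on {t. cmod t = 1} k" for k :: "complex \<Rightarrow> complex"
    by (rule continuous_on_compose2[OF that]) (auto simp: E_def intro!: continuous_intros)
  have B: "B \<ge> 0" "B' \<ge> 0"
    using order_trans[OF norm_ge_zero p(2)[where t = 1]] order_trans[OF norm_ge_zero q(2)[where t = 1]]
    by simp_all
  have sq: "summable (\<lambda>j. norm (d j) * B')" using d by (rule summable_mult2)
  have bq: "cmod (d j * q j (E y)) \<le> norm (d j) * B'" for j y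
    unfolding norm_mult by (intro mult_left_mono q E) auto
  define gs where "gs = (\<Sum>j. norm (d j) * B')"
  have sd: "summable (\<lambda>j. d j * q j (E y))" for y
    by (rule summable_comparison_test'[OF sq]) (use bq in auto)
  have gb: "cmod (g (E y)) \<le> gs" for y
    unfolding g[OF E] gs_def by (rule norm_suminf_le[OF _ sq]) (use bq in auto)
  have gc: "continuous_on {0..1} (\<lambda>y. g (E y))"
    unfolding g[OF E] by (rule integral_sums_Weierstrass(2)[OF _ bq sq]) (intro continuous_intros cE q)
  have inner: "(\<lambda>j. d j * circle_mean (\<lambda>t. p i t * q j t)) sums integral {0..1} (\<lambda>y. p i (E y) * g (E y))" for i
  proof -
    have "(\<lambda>j. integral {0..1} (\<lambda>y. p i (E y) * (d j * q j (E y)))) sums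
            integral {0..1} (\<lambda>y. \<Sum>j. p i (E y) * (d j * q j (E y)))"
    proof (rule integral_sums_Weierstrass(1))
      show "cmod (p i (E y) * (d j * q j (E y))) \<le> B * (norm (d j) * B')" for y j
        unfolding norm_mult[of "p i (E y)"] using bq p(2)[OF E] B by (intro mult_mono) auto
      show "summable (\<lambda>j. B * (norm (d j) * B'))" using sq by (rule summable_mult)
    qed (intro continuous_intros cE p q)
    moreover have "(\<Sum>j. p i (E y) * (d j * q j (E y))) = p i (E y) * g (E y)" for y
      unfolding g[OF E] by (rule suminf_mult[OF sd])
    moreover have "integral {0..1} (\<lambda>y. p i (E y) * (d j * q j (E y))) = d j * circle_mean (\<lambda>t. p i t * q j t)" for j
    proof -
      have eq: "(\<lambda>y. p i (E y) * (d j * q j (E y))) = (\<lambda>y. d j * (p i (E y) * q j (E y)))"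
        by (simp add: mult.left_commute)
      show ?thesis unfolding eq circle_mean_def E_def[symmetric] by (rule integral_mult_right)
    qed
    ultimately show ?thesis by simp
  qed
  have "(\<lambda>i. integral {0..1} (\<lambda>y. c i * (p i (E y) * g (E y)))) sums
          integral {0..1} (\<lambda>y. \<Sum>i. c i * (p i (E y) * g (E y)))"
  proof (rule integral_sums_Weierstrass(1))
    show "cmod (c i * (p i (E y) * g (E y))) \<le> norm (c i) * (B * gs)" for i y
      unfolding norm_mult using gb p(2)[OF E] B by (intro mult_mono) auto
    show "summable (\<lambda>i. norm (c i) * (B * gs))" using c by (rule summable_mult2)
  qed (intro continuous_intros cE p gc)
  moreover have "(\<Sum>i. c i * (p i (E y) * g (E y))) = f (E y) * g (E y)" for y
  proof -
    have "summable (\<lambda>i. c i * p i (E y))"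
    proof (rule summable_comparison_test'[OF summable_mult2[OF c, of B]])
      show "norm (c i * p i (E y)) \<le> norm (c i) * B" for i
        unfolding norm_mult by (intro mult_left_mono p E) auto
    qed
    from suminf_mult2[OF this, of "g (E y)"] show ?thesis
      unfolding f[OF E] by (simp add: mult.assoc)
  qed
  moreover have "integral {0..1} (\<lambda>y. c i * (p i (E y) * g (E y))) =
      c i * (\<Sum>j. d j * circle_mean (\<lambda>t. p i t * q j t))" for i
    using sums_unique[OF inner[of i]] by simp
  ultimately show ?thesis
    unfolding circle_mean_def[of "\<lambda>t. f t * g t"] E_def[symmetric] by (simp only:)
qed

lemma integral_character:
  fixes k :: int
  shows "integral {0..1} (\<lambda>y. exp (2 * pi * \<i> * of_int k * of_real y)) = (if k = 0 then 1 else 0)"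
proof (cases "k = 0")
  case False
  define c where "c = 2 * pi * \<i> * of_int k"
  have c0: "c \<noteq> 0" using False by (simp add: c_def)
  have "((\<lambda>y. exp (c * of_real y)) has_integral exp (c * of_real 1) / c - exp (c * of_real 0) / c) {0..1}"
  proof (rule fundamental_theorem_of_calculus)
    fix y :: real
    have "((\<lambda>z. exp (c * z) / c) has_field_derivative exp (c * of_real y)) (at (of_real y))"
      using c0 by (auto intro!: derivative_eq_intros)
    then show "((\<lambda>y. exp (c * of_real y) / c) has_vector_derivative exp (c * of_real y)) (at y within {0..1})"
      by (rule has_vector_derivative_real_field)
  qed simp
  moreover have "exp (c * of_real 1) = 1" unfolding exp_eq_1 by (auto simp: c_def intro!: exI[of _ k])
  ultimately have "((\<lambda>y. exp (c * of_real y)) has_integral 0) {0..1}" by simp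
  then show ?thesis using False by (simp add: integral_unique c_def)
qed simp

lemma circle_mean_monomials:
  "circle_mean (\<lambda>t. t ^ i * cnj t ^ j) = (if i = j then 1 else 0)"
  "circle_mean (\<lambda>t. t ^ i * t ^ j) = (if i = 0 \<and> j = 0 then 1 else 0)"
  "circle_mean (\<lambda>t. cnj t ^ i * cnj t ^ j) = (if i = 0 \<and> j = 0 then 1 else 0)"
proof -
  have a: "exp (2 * pi * \<i> * complex_of_real y) ^ i = exp (2 * pi * \<i> * of_int (int i) * of_real y)" for y i
    by (simp add: exp_of_nat_mult[symmetric] mult_ac)
  have b: "cnj (exp (2 * pi * \<i> * complex_of_real y)) ^ i = exp (2 * pi * \<i> * of_int (- int i) * of_real y)" for y i
    by (simp add: exp_of_nat_mult[symmetric] exp_cnj mult_ac)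
  have "circle_mean (\<lambda>t. t ^ i * cnj t ^ j) = integral {0..1} (\<lambda>y. exp (2 * pi * \<i> * of_int (int i - int j) * of_real y))"
    unfolding circle_mean_def a b exp_add[symmetric] by (simp add: algebra_simps)
  then show "circle_mean (\<lambda>t. t ^ i * cnj t ^ j) = (if i = j then 1 else 0)"
    unfolding integral_character by simp
  have "circle_mean (\<lambda>t. t ^ i * t ^ j) = integral {0..1} (\<lambda>y. exp (2 * pi * \<i> * of_int (int i + int j) * of_real y))"
    unfolding circle_mean_def a b exp_add[symmetric] by (simp add: algebra_simps)
  then show "circle_mean (\<lambda>t. t ^ i * t ^ j) = (if i = 0 \<and> j = 0 then 1 else 0)"
    unfolding integral_character by simp
  have "circle_mean (\<lambda>t. cnj t ^ i * cnj t ^ j) = integral {0..1} (\<lambda>y. exp (2 * pi * \<i> * of_int (- int i - int j) * of_real y))"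
    unfolding circle_mean_def a b exp_add[symmetric] by (simp add: algebra_simps)
  then show "circle_mean (\<lambda>t. cnj t ^ i * cnj t ^ j) = (if i = 0 \<and> j = 0 then 1 else 0)"
    unfolding integral_character by auto
qed

lemma suminf_mult_delta: "(\<Sum>j. d j * (if i = j then 1 else 0)) = (d i :: complex)"
proof -
  have "(\<lambda>j. d j * (if i = j then 1 else 0)) = (\<lambda>j. if j = i then d j else 0)" by auto
  then show ?thesis using sums_single[of i d] by (simp add: sums_iff)
qed

lemma circle_mean_Parseval:
  assumes "summable (\<lambda>i. norm (c i))" "summable (\<lambda>i. norm (d i))"
    and "\<And>t. cmod t = 1 \<Longrightarrow> f t = (\<Sum>i. c i * t ^ i)"
    and "\<And>t. cmod t = 1 \<Longrightarrow> g t = (\<Sum>i. d i * cnj t ^ i)"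
  shows "(\<lambda>i. c i * d i) sums circle_mean (\<lambda>t. f t * g t)"
proof -
  have "(\<lambda>i. c i * (\<Sum>j. d j * circle_mean (\<lambda>t. t ^ i * cnj t ^ j))) sums circle_mean (\<lambda>t. f t * g t)"
    by (rule circle_mean_product_series[of "\<lambda>i t. t ^ i" 1 "\<lambda>j t. cnj t ^ j" 1, OF _ _ _ _ assms])
       (auto simp: norm_power intro!: continuous_intros)
  then show ?thesis unfolding circle_mean_monomials suminf_mult_delta .
qed

lemma circle_mean_one_sided:
  assumes "summable (\<lambda>i. norm (c i))" "summable (\<lambda>i. norm (d i))"
    and "e = (\<lambda>t. t) \<or> e = cnj"
    and "\<And>t. cmod t = 1 \<Longrightarrow> f t = (\<Sum>i. c i * e t ^ i)"
    and "\<And>t. cmod t = 1 \<Longrightarrow> g t = (\<Sum>i. d i * e t ^ i)"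
  shows "circle_mean (\<lambda>t. f t * g t) = c 0 * d 0"
proof -
  have K: "circle_mean (\<lambda>t. e t ^ i * e t ^ j) = (if i = 0 \<and> j = 0 then 1 else 0)" for i j
    by (rule disjE[OF assms(3)]; erule ssubst) (rule circle_mean_monomials)+
  have e: "continuous_on {t. cmod t = 1} e"
    by (rule disjE[OF assms(3)]; erule ssubst) (intro continuous_intros)+
  have ne: "cmod (e t) = cmod t" for t
    by (rule disjE[OF assms(3)]; erule ssubst) simp_all
  have "(\<lambda>i. c i * (\<Sum>j. d j * circle_mean (\<lambda>t. e t ^ i * e t ^ j))) sums circle_mean (\<lambda>t. f t * g t)"
    by (rule circle_mean_product_series[of "\<lambda>i t. e t ^ i" 1 "\<lambda>j t. e t ^ j" 1, OF _ _ _ _ assms(1,2,4,5)])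
       (simp_all add: norm_power e ne continuous_on_power)
  moreover have "c i * (\<Sum>j. d j * circle_mean (\<lambda>t. e t ^ i * e t ^ j)) = (if i = 0 then c i * d 0 else 0)" for i
  proof (cases "i = 0")
    case True
    have "(\<lambda>j. d j * circle_mean (\<lambda>t. e t ^ i * e t ^ j)) = (\<lambda>j. d j * (if 0 = j then 1 else 0))"
      unfolding K using True by auto
    then show ?thesis using True by (simp only: suminf_mult_delta) simp
  next
    case False
    then show ?thesis unfolding K by simp
  qed
  ultimately have "(\<lambda>i. if i = 0 then c i * d 0 else 0) sums circle_mean (\<lambda>t. f t * g t)"
    by (simp only:)
  then show ?thesis using sums_single[of 0 "\<lambda>i. c i * d 0"] by (rule sums_unique2)
qed

definition taylor :: "(complex \<Rightarrow> complex) \<Rightarrow> nat \<Rightarrow> complex" where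
  "taylor f i = (deriv ^^ i) f 0 / fact i"

lemma taylor_series:
  assumes f: "f holomorphic_on ball 0 r" and z: "cmod z < r"
  shows "(\<lambda>i. taylor f i * z ^ i) sums f z"
    and "summable (\<lambda>i. norm (taylor f i * z ^ i))"
    and "(\<lambda>i. of_nat i * taylor f i * z ^ i) sums (z * deriv f z)"
    and "summable (\<lambda>i. norm (of_nat i * taylor f i * z ^ i))"
proof -
  have sums: "(\<lambda>i. taylor f i * z ^ i) sums f z" if "cmod z < r" for z
    using holomorphic_power_series[OF f, of z] that by (simp add: taylor_def)
  show "(\<lambda>i. taylor f i * z ^ i) sums f z" using z by (rule sums)
  obtain r' where r': "cmod z < r'" "r' < r" using z dense by blast
  then have r'n: "cmod z < cmod (of_real r')" "cmod (of_real r') < r"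
    using le_less_trans[OF norm_ge_zero r'(1)] by simp_all
  show "summable (\<lambda>i. norm (taylor f i * z ^ i))"
    by (rule powser_insidea[OF _ r'n(1)]) (use sums[OF r'n(2)] sums_summable in blast)
  have sd: "summable (\<lambda>n. diffs (taylor f) n * z ^ n)" if "cmod z < r" for z
    by (rule termdiff_converges[OF that]) (use sums sums_summable in blast)
  have sh: "(\<lambda>n. of_nat (Suc n) * taylor f (Suc n) * z ^ Suc n) = (\<lambda>n. z * (diffs (taylor f) n * z ^ n))" for z
    by (simp add: diffs_def mult_ac)
  have s2: "summable (\<lambda>i. of_nat i * taylor f i * z ^ i)" if "cmod z < r" for z
    using summable_mult[OF sd[OF that], of z] unfolding sh[symmetric]
    by (subst (asm) summable_Suc_iff)
  show "summable (\<lambda>i. norm (of_nat i * taylor f i * z ^ i))"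
    by (rule powser_insidea[OF s2[OF r'n(2)] r'n(1)])
  have "DERIV (\<lambda>z. \<Sum>n. taylor f n * z ^ n) z :> (\<Sum>n. diffs (taylor f) n * z ^ n)"
    by (rule termdiffs_strong[OF _ r'n(1)]) (use sums[OF r'n(2)] sums_summable in blast)
  then have "(f has_field_derivative (\<Sum>n. diffs (taylor f) n * z ^ n)) (at z)"
    by (rule has_field_derivative_transform_within_open[where S = "ball 0 r"])
       (use z sums in \<open>auto simp: sums_iff\<close>)
  then have "deriv f z = (\<Sum>n. diffs (taylor f) n * z ^ n)" by (rule DERIV_imp_deriv)
  then have "(\<lambda>n. z * (diffs (taylor f) n * z ^ n)) sums (z * deriv f z)"
    using sd[OF z] by (intro sums_mult) (simp add: sums_iff)
  then show "(\<lambda>i. of_nat i * taylor f i * z ^ i) sums (z * deriv f z)"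
    unfolding sh[symmetric] by (subst (asm) sums_Suc_iff) simp
qed

lemma circle_mean_holomorphic:
  assumes f: "f holomorphic_on ball 0 r" and r: "r > 1"
  shows "circle_mean f = f 0" "circle_mean (\<lambda>t. f (cnj t)) = f 0"
proof -
  have s: "summable (\<lambda>i. norm (taylor f i))" using taylor_series(2)[OF f, of 1] r by simp
  define d :: "nat \<Rightarrow> complex" where "d = (\<lambda>i. if i = 0 then 1 else 0)"
  have s': "summable (\<lambda>i. norm (d i))"
    by (rule summable_finite[of "{0}"]) (auto simp: d_def)
  have one: "1 = (\<Sum>i. d i * z ^ i)" for z :: complex
  proof -
    have "(\<lambda>i. d i * z ^ i) = (\<lambda>i. if i = 0 then z ^ i else 0)" by (auto simp: d_def)
    then show ?thesis using sums_single[of 0 "\<lambda>i. z ^ i"] by (simp add: sums_iff)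
  qed
  have "circle_mean (\<lambda>t. f (e t) * 1) = taylor f 0 * d 0" if e: "e = (\<lambda>t. t) \<or> e = cnj" for e
  proof (rule circle_mean_one_sided[OF s s' e _ one])
    fix t :: complex assume "cmod t = 1"
    then have "cmod (e t) < r" using e r by auto
    then show "f (e t) = (\<Sum>i. taylor f i * e t ^ i)" using taylor_series(1)[OF f] by (simp add: sums_iff)
  qed
  from this[of "\<lambda>t. t"] this[of cnj] show "circle_mean f = f 0" "circle_mean (\<lambda>t. f (cnj t)) = f 0"
    by (simp_all add: taylor_def d_def)
qed

text \<open>
By Horner's scheme it suffices to multiply \<open>q(u) + q(1 / u)\<close> by \<open>u + 1 / u\<close>. If
\<open>q = q0 + u q1\<close>, the mixed products are \<open>q(u) / u = q0 / u + q1(u)\<close> and its mirror image, so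
\<open>u q(u) + q1(u) + q0 u\<close> serves for the product. For constant \<open>Q\<close> the leading coefficient of \<open>q\<close> is
halved, which is why degree zero is excluded there.
\<close>

lemma joukowski_poly_split:
  "\<exists>q. degree q \<le> degree Q \<and> (degree Q > 0 \<longrightarrow> coeff q (degree Q) = lead_coeff Q) \<and>
       (\<forall>u. u \<noteq> 0 \<longrightarrow> poly Q (joukowski u) = poly q u + poly q (1 / u))"
proof (induction Q)
  case 0
  show ?case by (intro exI[of _ 0]) simp
next
  case (pCons a Q)
  show ?case
  proof (cases "Q = 0")
    case True
    then show ?thesis by (intro exI[of _ "[:a / 2:]"]) simp
  next
    case False
    obtain q where q: "degree q \<le> degree Q" "degree Q > 0 \<Longrightarrow> coeff q (degree Q) = lead_coeff Q"
      "\<And>u. u \<noteq> 0 \<Longrightarrow> poly Q (joukowski u) = poly q u + poly q (1 / u)"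
      using pCons.IH by (elim exE conjE) simp
    obtain q0 q1 where q01: "q = pCons q0 q1" by (cases q) auto
    define q' where "q' = [:a / 2:] + pCons 0 q + q1 + [:0, q0:]"
    have dq1: "degree q1 \<le> degree Q" using q(1) unfolding q01
      by (simp add: degree_pCons_eq_if split: if_splits)
    have "degree q' \<le> degree (pCons a Q)"
      unfolding q'_def using False q(1) dq1
      by (intro degree_add_le) (auto intro: degree_pCons_le[THEN order_trans])
    moreover have "coeff q' (degree (pCons a Q)) = lead_coeff (pCons a Q)"
    proof (cases "degree Q > 0")
      case True
      then have "coeff q1 (Suc (degree Q)) = 0" using dq1 by (intro coeff_eq_0) auto
      moreover have "coeff [:0, q0:] (Suc (degree Q)) = 0" using True by (intro coeff_eq_0) auto
      ultimately show ?thesis using False q(2) True by (simp add: q'_def)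
    next
      case F: False
      then obtain c where c: "Q = [:c:]" using degree_eq_zeroE by auto
      have "q1 = 0" using q(1) F unfolding q01 by (cases "q1 = 0") auto
      then have "c = q0 + q0" using q(3)[of 1] by (simp add: c q01)
      then show ?thesis using False \<open>q1 = 0\<close> by (simp add: q'_def c q01)
    qed
    moreover have "poly (pCons a Q) (joukowski u) = poly q' u + poly q' (1 / u)" if "u \<noteq> 0" for u
    proof -
      have "poly (pCons a Q) (joukowski u) = a + (u + 1 / u) * (poly q u + poly q (1 / u))"
        unfolding poly_pCons q(3)[OF that] unfolding joukowski_def ..
      also have "\<dots> = poly q' u + poly q' (1 / u)" using that by (simp add: q'_def q01 field_simps)
      finally show ?thesis .
    qed
    ultimately show ?thesis by blast
  qed
qed

section \<open>The pairing in Taylor coefficients\<close>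

lemma circle_mean_integrable:
  fixes f :: "complex \<Rightarrow> complex"
  assumes "continuous_on {t. cmod t = 1} f"
  shows "(\<lambda>y. f (exp (2 * pi * \<i> * complex_of_real y))) integrable_on {0..1}"
  by (intro integrable_continuous_interval continuous_on_compose2[OF assms])
     (auto intro!: continuous_intros)

lemma circle_mean_add:
  assumes "continuous_on {t. cmod t = 1} f" "continuous_on {t. cmod t = 1} g"
  shows "circle_mean (\<lambda>t. f t + g t) = circle_mean f + circle_mean g"
  unfolding circle_mean_def by (intro integral_add circle_mean_integrable assms)

lemma circle_mean_diff:
  assumes "continuous_on {t. cmod t = 1} f" "continuous_on {t. cmod t = 1} g"
  shows "circle_mean (\<lambda>t. f t - g t) = circle_mean f - circle_mean g"
  unfolding circle_mean_def by (intro integral_diff circle_mean_integrable assms)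

lemma cnj_suminf:
  assumes "f sums x" shows "cnj x = (\<Sum>i. cnj (f i))"
  using assms by (simp add: sums_cnj sums_unique)

lemma unit_circle_cnj: "cmod t = 1 \<Longrightarrow> cnj t = 1 / t"
  by (simp add: complex_div_cnj[of 1 t])

context bergman_region
begin

lemma inv_mu_gt_1: "1 < 1 / \<mu>" using mu_props by simp

lemma unit_circle_ann: "cmod t = 1 \<Longrightarrow> t \<in> ann"
  using inv_mu_gt_1 mu_props power_strict_decreasing[of 0 3 \<mu>] by (simp add: ann_def)

lemma joukowski_region_poly_split:
  "\<exists>U. degree U \<le> degree Q \<and> (degree Q > 0 \<longrightarrow> coeff U (degree Q) = of_real R ^ degree Q * lead_coeff Q) \<and>
       (\<forall>t\<in>ann. poly Q (h t) = poly U (lam R t) + poly U (lam R (m\<^sup>2 / t)))"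
proof -
  obtain q where q: "degree q \<le> degree Q" "degree Q > 0 \<Longrightarrow> coeff q (degree Q) = lead_coeff Q"
      "\<And>u. u \<noteq> 0 \<Longrightarrow> poly Q (joukowski u) = poly q u + poly q (1 / u)"
    using joukowski_poly_split[of Q] by (elim exE conjE) simp
  define U where "U = pcompose q [:-1, of_real R:]"
  have R0: "complex_of_real R \<noteq> 0" using R_gt by simp
  have dU: "degree U = degree q" using R0 by (simp add: U_def degree_pcompose)
  have "coeff U (degree Q) = of_real R ^ degree Q * lead_coeff Q" if "degree Q > 0"
  proof -
    have dq: "degree q = degree Q"
    proof (rule antisym[OF q(1) le_degree])
      show "coeff q (degree Q) \<noteq> 0" using q(2)[OF that] that by auto
    qed
    have "lead_coeff U = lead_coeff q * of_real R ^ degree q"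
      unfolding U_def using R0 by (subst lead_coeff_comp) auto
    then show ?thesis using dU dq q(2)[OF that] by (simp add: mult.commute)
  qed
  moreover have "poly Q (h t) = poly U (lam R t) + poly U (lam R (m\<^sup>2 / t))" if "t \<in> ann" for t
  proof -
    have e: "poly U (lam R s) = poly q (u s)" if "s \<in> ann" for s
      using mobius_u[of s] ann_D[OF that] by (simp add: U_def poly_pcompose algebra_simps)
    show ?thesis
      unfolding e[OF that] e[OF involution_ann[OF that]] u_involution[OF ann_D[OF that]]
      using q(3)[OF u_nz[OF that]] ann_D[OF that] by (simp add: h_eq_joukowski)
  qed
  ultimately show ?thesis using dU q(1) by (intro exI[of _ U]) simp
qed

text \<open>
The potential \<open>U\<close>, a polynomial in the variable \<open>w = lam R t\<close> of the disc, as a function of \<open>t\<close>.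
\<close>

definition vlam :: "complex poly \<Rightarrow> complex \<Rightarrow> complex" where "vlam U t = poly U (lam R t)"

lemma holomorphic_poly_compose:
  "f holomorphic_on A \<Longrightarrow> (\<lambda>t. poly U (f t)) holomorphic_on A"
  by (rule holomorphic_on_compose_gen[of f A "poly U" UNIV, unfolded o_def]) (auto intro: holomorphic_intros)

lemma ball_inv_mu_D: "t \<in> ball 0 (1 / \<mu>) \<Longrightarrow> m * t \<noteq> 1"
  using m_mult_ne_1 by simp

lemma vlam_holomorphic: "vlam U holomorphic_on ball 0 (1 / \<mu>)"
  unfolding vlam_def[abs_def]
  by (intro holomorphic_poly_compose holomorphic_on_subset[OF lam_holomorphic]) (use ball_inv_mu_D in auto)

lemma vlam_has_derivative:
  "cmod z < 1 / \<mu> \<Longrightarrow> (vlam U has_field_derivative deriv (vlam U) z) (at z)"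
  using vlam_holomorphic by (intro holomorphic_derivI[of _ "ball 0 (1 / \<mu>)"]) auto

lemma vlam_symmetrised_derivative:
  assumes t: "t \<in> ann"
  shows "((\<lambda>t. vlam U t + vlam U (m\<^sup>2 / t)) has_field_derivative
           deriv (vlam U) t + deriv (vlam U) (m\<^sup>2 / t) * (- m\<^sup>2 / t\<^sup>2)) (at t)"
proof -
  have s: "cmod t < 1 / \<mu>" "cmod (m\<^sup>2 / t) < 1 / \<mu>" using t involution_ann[OF t] by (auto simp: ann_def)
  show ?thesis
    by (intro DERIV_add vlam_has_derivative s involution_has_derivative ann_D(1)[OF t]
        DERIV_chain2[where g = "\<lambda>t. m\<^sup>2 / t", OF vlam_has_derivative])
qed

abbreviation v :: "complex poly \<Rightarrow> nat \<Rightarrow> complex" where "v U \<equiv> taylor (vlam U)"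

lemma v_summable: "summable (\<lambda>i. norm (v U i))" "summable (\<lambda>i. norm (of_nat i * v U i))"
  using taylor_series(2,4)[OF vlam_holomorphic, of 1] inv_mu_gt_1 by simp_all

lemma norm_m_power_le: "norm (m ^ k) \<le> 1"
  using mu_props by (simp add: norm_power power_le_one)

text \<open>
On the unit circle \<open>m\<^sup>2 / t = m\<^sup>2 cnj t\<close>. Of the four products of one-sided series, two contain only
powers of one sign without a constant term and have mean zero; the other two are evaluated by
Parseval's formula and give the summands \<open>1\<close> and \<open>- m\<^bsup>4 i\<^esup>\<close>.
\<close>

lemma circle_mean_pairing:
  assumes U: "\<And>t. t \<in> ann \<Longrightarrow> poly P (h t) = poly U (lam R t) + poly U (lam R (m\<^sup>2 / t))"
    and W: "\<And>t. t \<in> ann \<Longrightarrow> poly Q (h t) = poly W (lam R t) + poly W (lam R (m\<^sup>2 / t))"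
  shows "(\<lambda>i. of_nat i * (1 - m ^ (4 * i)) * v U i * cnj (v W i)) sums
           circle_mean (\<lambda>t. t * deriv (\<lambda>t. poly P (h t)) t * cnj (poly Q (h t)))"
proof -
  define A where "A = (\<lambda>z. z * deriv (vlam U) z)"
  define a where "a = (\<lambda>i. of_nat i * v U i)"
  have hA: "A holomorphic_on ball 0 (1 / \<mu>)"
    unfolding A_def by (intro holomorphic_intros holomorphic_deriv vlam_holomorphic) auto
  have Pt: "t * deriv (\<lambda>t. poly P (h t)) t = A t - A (m\<^sup>2 / t)" if t: "t \<in> ann" for t
  proof -
    have t0: "t \<noteq> 0" using ann_D t by auto
    from vlam_symmetrised_derivative[OF t]
    have "((\<lambda>t. poly P (h t)) has_field_derivative
             deriv (vlam U) t + deriv (vlam U) (m\<^sup>2 / t) * (- m\<^sup>2 / t\<^sup>2)) (at t)"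
      by (rule has_field_derivative_transform_within_open[OF _ open_ann t]) (simp add: U vlam_def)
    then show ?thesis using t0
      by (simp add: DERIV_imp_deriv A_def field_simps power2_eq_square)
  qed
  have inv: "m\<^sup>2 / t = m\<^sup>2 * cnj t" if "cmod t = 1" for t
    using unit_circle_cnj[OF that] by simp
  have small: "cmod t < 1 / \<mu>" "cmod (m\<^sup>2 * cnj t) < 1 / \<mu>" if "cmod t = 1" for t
  proof -
    show "cmod t < 1 / \<mu>" using that inv_mu_gt_1 by simp
    have "cmod (m\<^sup>2 * cnj t) \<le> 1" using norm_m_power_le[of 2] that by (simp add: norm_mult)
    then show "cmod (m\<^sup>2 * cnj t) < 1 / \<mu>" using inv_mu_gt_1 by linarith
  qed
  define b where "b = (\<lambda>i. a i * m ^ (2 * i))"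
  define w where "w = (\<lambda>i. cnj (v W i))"
  define w' where "w' = (\<lambda>i. w i * m ^ (2 * i))"
  have sa: "summable (\<lambda>i. norm (a i))" unfolding a_def by (rule v_summable)
  have sw: "summable (\<lambda>i. norm (w i))" unfolding w_def using v_summable(1) by simp
  have dec: "summable (\<lambda>i. norm (f i * m ^ (2 * i)))" if "summable (\<lambda>i. norm (f i))" for f :: "nat \<Rightarrow> complex"
    by (rule summable_comparison_test'[OF that])
       (use mult_left_le[OF norm_m_power_le norm_ge_zero] in \<open>simp add: norm_mult\<close>)
  have sb: "summable (\<lambda>i. norm (b i))" "summable (\<lambda>i. norm (w' i))"
    unfolding b_def w'_def by (rule dec[OF sa] dec[OF sw])+
  define X2 where "X2 = (\<lambda>t. A (m\<^sup>2 * cnj t))"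
  define Y1 where "Y1 = (\<lambda>t. cnj (vlam W t))"
  define Y2 where "Y2 = (\<lambda>t. cnj (vlam W (m\<^sup>2 * cnj t)))"
  have SA: "A z = (\<Sum>i. a i * z ^ i)" if "cmod z < 1 / \<mu>" for z
    using taylor_series(3)[OF vlam_holomorphic that] by (simp add: A_def a_def sums_iff)
  have SW: "cnj (vlam W z) = (\<Sum>i. w i * cnj z ^ i)" if "cmod z < 1 / \<mu>" for z
    using cnj_suminf[OF taylor_series(1)[OF vlam_holomorphic that]] by (simp add: w_def)
  have e1: "A t = (\<Sum>i. a i * t ^ i)" if "cmod t = 1" for t by (rule SA[OF small(1)[OF that]])
  have e2: "X2 t = (\<Sum>i. b i * cnj t ^ i)" if "cmod t = 1" for t
    unfolding X2_def SA[OF small(2)[OF that]] by (simp add: b_def power_mult_distrib power_mult mult.assoc)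
  have e3: "Y1 t = (\<Sum>i. w i * cnj t ^ i)" if "cmod t = 1" for t
    unfolding Y1_def by (rule SW[OF small(1)[OF that]])
  have e4: "Y2 t = (\<Sum>i. w' i * t ^ i)" if "cmod t = 1" for t
    unfolding Y2_def SW[OF small(2)[OF that]] by (simp add: w'_def power_mult_distrib power_mult mult.assoc)
  have c0: "continuous_on {t. cmod t = 1} (\<lambda>t. f (m\<^sup>2 * cnj t))" "continuous_on {t. cmod t = 1} f"
    if f: "f holomorphic_on ball 0 (1 / \<mu>)" for f
    using small by (auto intro!: continuous_on_compose2[OF holomorphic_on_imp_continuous_on[OF f]] continuous_intros
       continuous_on_subset[OF holomorphic_on_imp_continuous_on[OF f]])
  have cX: "continuous_on {t. cmod t = 1} A" "continuous_on {t. cmod t = 1} X2"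
    "continuous_on {t. cmod t = 1} Y1" "continuous_on {t. cmod t = 1} Y2"
    unfolding X2_def Y1_def Y2_def by (intro continuous_intros c0 hA vlam_holomorphic)+
  have "circle_mean (\<lambda>t. t * deriv (\<lambda>t. poly P (h t)) t * cnj (poly Q (h t))) =
        circle_mean (\<lambda>t. (A t * Y1 t + A t * Y2 t) - (X2 t * Y1 t + X2 t * Y2 t))"
  proof (rule circle_mean_cong)
    fix t :: complex assume t: "cmod t = 1"
    show "t * deriv (\<lambda>t. poly P (h t)) t * cnj (poly Q (h t)) = A t * Y1 t + A t * Y2 t - (X2 t * Y1 t + X2 t * Y2 t)"
      unfolding Pt[OF unit_circle_ann[OF t]] W[OF unit_circle_ann[OF t]] inv[OF t]
      by (simp add: X2_def Y1_def Y2_def vlam_def algebra_simps)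
  qed
  also have "\<dots> = circle_mean (\<lambda>t. A t * Y1 t) + circle_mean (\<lambda>t. A t * Y2 t)
     - (circle_mean (\<lambda>t. X2 t * Y1 t) + circle_mean (\<lambda>t. X2 t * Y2 t))"
    by (simp add: circle_mean_diff circle_mean_add continuous_intros cX)
  also have "circle_mean (\<lambda>t. A t * Y2 t) = a 0 * w' 0"
    by (rule circle_mean_one_sided[of _ _ "\<lambda>t. t", OF sa sb(2) _ e1 e4]) auto
  also have "circle_mean (\<lambda>t. X2 t * Y1 t) = b 0 * w 0"
    by (rule circle_mean_one_sided[of _ _ cnj, OF sb(1) sw _ e2 e3]) auto
  also have "circle_mean (\<lambda>t. X2 t * Y2 t) = circle_mean (\<lambda>t. Y2 t * X2 t)"
    by (simp add: mult.commute)
  finally have main: "circle_mean (\<lambda>t. t * deriv (\<lambda>t. poly P (h t)) t * cnj (poly Q (h t))) =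
     circle_mean (\<lambda>t. A t * Y1 t) - circle_mean (\<lambda>t. Y2 t * X2 t)"
    by (simp add: a_def b_def)
  have "(\<lambda>i. a i * w i - w' i * b i) sums (circle_mean (\<lambda>t. A t * Y1 t) - circle_mean (\<lambda>t. Y2 t * X2 t))"
    by (intro sums_diff circle_mean_Parseval[OF sa sw e1 e3] circle_mean_Parseval[OF sb(2,1) e4 e2])
  moreover have "a i * w i - w' i * b i = of_nat i * (1 - m ^ (4 * i)) * v U i * cnj (v W i)" for i
    by (simp add: a_def b_def w_def w'_def algebra_simps power_mult_distrib flip: power_mult power_add)
  ultimately show ?thesis unfolding main by simp
qed

text \<open>
The contraction \<open>t \<mapsto> m\<^sup>4 t\<close>, expressed in the variable \<open>w = lam R t\<close>.
\<close>

definition tau :: "complex \<Rightarrow> complex" where "tau w = lam R (m ^ 4 * lam R w)"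

text \<open>
In the variable \<open>t\<close> this is \<open>V(t) - V(m\<^sup>4 t)\<close>, whose Dirichlet pairing with \<open>W\<close> is the area pairing.
\<close>

definition defect :: "complex poly \<Rightarrow> complex \<Rightarrow> complex" where
  "defect U w = poly U w - poly U (tau w)"

text \<open>
The disc automorphism \<open>lam R\<close> expands a disc of radius larger than one, most strongly in the direction
of its pole \<open>1 / m\<close>; the radius \<open>R - 1\<close> is the one at which its modulus reaches \<open>\<mu>\<close> to the
power \<open>-2\<close>.
\<close>

lemma lam_bound:
  assumes "cmod w \<le> R - 1"
  shows "m * w \<noteq> 1" and "cmod (m ^ 4 * lam R w) \<le> \<mu>\<^sup>2"
proof -
  have mu: "\<mu> > 0" "\<mu> < 1" using mu_props by auto
  have Rm: "\<mu> * (R - 1) = 1 + \<mu>\<^sup>2 - \<mu>" using mu_props(3) by (simp add: algebra_simps)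
  have "R - 1 < 1 / \<mu>" using R_eq mu by linarith
  then show ne: "m * w \<noteq> 1" using assms by (intro m_mult_ne_1) simp
  define r where "r = \<mu> * cmod w"
  have r: "r \<le> 1 + \<mu>\<^sup>2 - \<mu>" unfolding r_def using mult_left_mono[OF assms, of \<mu>] mu Rm by simp
  have x: "\<mu> * Re w \<le> r" unfolding r_def using mu complex_Re_le_cmod by simp
  \<comment> \<open>The quadratic polynomial in \<open>r\<close> that decides the estimate, with its zeros.\<close>
  have "0 \<le> (1 + \<mu>\<^sup>2 - \<mu> - r) * (1 + \<mu>\<^sup>2 + \<mu> - r)"
    using r mu by (intro mult_nonneg_nonneg) auto
  also have "\<dots> = 1 + \<mu>\<^sup>2 + \<mu> ^ 4 - 2 * (1 + \<mu>\<^sup>2) * r + r\<^sup>2"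
    by (simp add: algebra_simps eval_nat_numeral)
  also have "\<dots> \<le> 1 + \<mu>\<^sup>2 + \<mu> ^ 4 - 2 * (1 + \<mu>\<^sup>2) * (\<mu> * Re w) + r\<^sup>2"
    using x by (simp add: mult_left_mono)
  finally have "0 \<le> (1 - \<mu>\<^sup>2) * (1 + \<mu>\<^sup>2 + \<mu> ^ 4 - 2 * (1 + \<mu>\<^sup>2) * (\<mu> * Re w) + r\<^sup>2)"
    using mu by (intro mult_nonneg_nonneg) (auto simp: power_le_one)
  also have "\<dots> = (cmod (m * w - 1))\<^sup>2 - (\<mu>\<^sup>2 * cmod (w - m))\<^sup>2"
    unfolding r_def power_mult_distrib cmod_power2 by (simp add: algebra_simps eval_nat_numeral)
  finally have "(\<mu>\<^sup>2 * cmod (w - m))\<^sup>2 \<le> (cmod (m * w - 1))\<^sup>2" by simp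
  then have le: "\<mu>\<^sup>2 * cmod (w - m) \<le> cmod (m * w - 1)" by (rule power2_le_imp_le) simp
  have d: "cmod (m * w - 1) > 0" using ne by simp
  have "cmod (m ^ 4 * lam R w) = \<mu>\<^sup>2 * (\<mu>\<^sup>2 * cmod (w - m)) / cmod (m * w - 1)"
    using mu by (simp add: lam_def norm_mult norm_divide norm_power flip: power_add)
  also have "\<dots> \<le> \<mu>\<^sup>2 * cmod (m * w - 1) / cmod (m * w - 1)"
    using le mu by (intro divide_right_mono mult_left_mono) auto
  also have "\<dots> = \<mu>\<^sup>2" using d by simp
  finally show "cmod (m ^ 4 * lam R w) \<le> \<mu>\<^sup>2" .
qed

lemma mu_power_lt_inv: "\<mu> ^ k < 1 / \<mu>"
  using mu_props inv_mu_gt_1 power_le_one[of \<mu> k] by linarith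

lemma tau_holomorphic: "tau holomorphic_on ball 0 (R - 1)"
  unfolding tau_def[abs_def]
proof (rule holomorphic_on_compose_gen[of "\<lambda>w. m ^ 4 * lam R w" _ "lam R" "{t. m * t \<noteq> 1}", unfolded o_def])
  show "(\<lambda>w. m ^ 4 * lam R w) holomorphic_on ball 0 (R - 1)"
    by (intro holomorphic_intros holomorphic_on_subset[OF lam_holomorphic]) (use lam_bound in auto)
  show "(\<lambda>w. m ^ 4 * lam R w) ` ball 0 (R - 1) \<subseteq> {t. m * t \<noteq> 1}"
  proof clarify
    fix w assume "w \<in> ball 0 (R - 1)" "m * (m ^ 4 * lam R w) = 1"
    then show False
      using lam_bound(2)[of w] m_mult_ne_1[of "m ^ 4 * lam R w"] mu_power_lt_inv[of 2] by simp
  qed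
qed (rule lam_holomorphic)

lemma defect_holomorphic: "defect U holomorphic_on ball 0 (R - 1)"
  unfolding defect_def[abs_def]
  by (intro holomorphic_intros holomorphic_poly_compose tau_holomorphic)

lemma defect_lam: "m * t \<noteq> 1 \<Longrightarrow> defect U (lam R t) = vlam U t - vlam U (m ^ 4 * t)"
  by (simp add: defect_def tau_def vlam_def lam_involution)

end

section \<open>Orthogonality in the variable of the disc\<close>

lemma circle_mean_cnj: "circle_mean (\<lambda>t. cnj (f t)) = cnj (circle_mean f)"
  unfolding circle_mean_def by (simp add: integral_cnj)

lemma exists_antiderivative_poly:
  fixes p :: "complex poly"
  assumes "degree p = n" "p \<noteq> 0"
  shows "\<exists>P. pderiv P = p \<and> degree P = Suc n \<and> lead_coeff P = lead_coeff p / of_nat (Suc n)"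
proof -
  define P where "P = (\<Sum>i\<le>n. monom (coeff p i / of_nat (Suc i)) (Suc i))"
  have P: "pderiv P = p"
  proof (rule poly_eqI)
    fix k
    have "coeff P (Suc k) = (\<Sum>i\<le>n. if i = k then coeff p i / of_nat (Suc i) else 0)"
      unfolding P_def coeff_sum coeff_monom by (intro sum.cong) auto
    also have "\<dots> = coeff p k / of_nat (Suc k)" using assms(1) by (auto simp: coeff_eq_0)
    finally show "coeff (pderiv P) k = coeff p k"
      unfolding coeff_pderiv by (simp del: of_nat_Suc)
  qed
  have dP: "degree P = Suc n"
  proof -
    have "degree P \<noteq> 0" using P assms(2) pderiv_eq_0_iff[of P] by auto
    then show ?thesis using degree_pderiv[of P] assms P by simp
  qed
  have "coeff p n = of_nat (Suc n) * coeff P (Suc n)" unfolding P[symmetric] by (rule coeff_pderiv)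
  then have "lead_coeff P = lead_coeff p / of_nat (Suc n)"
    unfolding dP assms(1) by (simp add: field_simps del: of_nat_Suc)
  then show ?thesis using P dP by blast
qed

context bergman_region
begin

text \<open>
On the unit circle this is \<open>t lam'(t) / lam(t)\<close>, the density that \<open>lam\<close> induces on the circle; it is
the Poisson kernel at the point \<open>m\<close>.
\<close>

definition poisson :: "complex \<Rightarrow> complex" where
  "poisson t = (1 - m\<^sup>2) / ((1 - m * t) * (1 - m * cnj t))"

lemma lam_deriv: "m * t \<noteq> 1 \<Longrightarrow> (lam R has_field_derivative (m\<^sup>2 - 1) / (m * t - 1)\<^sup>2) (at t)"
  unfolding lam_def[abs_def]
  by (auto intro!: derivative_eq_intros simp: power2_eq_square) (simp add: algebra_simps)

lemma unit_circle_m: 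
  assumes "cmod t = 1" shows "m * t \<noteq> 1" "m * cnj t \<noteq> 1" "t \<noteq> m" "t \<noteq> 0"
  using assms inv_mu_gt_1 m_mult_ne_1[of t] m_mult_ne_1[of "cnj t"] mu_props by auto

lemma lam_unit_circle:
  assumes t: "cmod t = 1"
  shows "lam R t * cnj (lam R t) = 1" "cmod (lam R t) = 1"
    and "t * ((m\<^sup>2 - 1) / (m * t - 1)\<^sup>2) = lam R t * poisson t"
    and "poisson t = 1 / (1 - m * t) + m * cnj t / (1 - m * cnj t)"
    and "cnj (poisson t) = poisson t"
proof -
  note ne = unit_circle_m[OF t]
  have tt: "t * cnj t = 1" using unit_circle_cnj[OF t] ne by simp
  have ne': "m * t - 1 \<noteq> 0" "m * cnj t - 1 \<noteq> 0" using ne by auto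
  have num: "(t - m) * (cnj t - m) = (m * t - 1) * (m * cnj t - 1)"
    using tt by (simp add: algebra_simps)
  have "lam R t * cnj (lam R t) = ((t - m) * (cnj t - m)) / ((m * t - 1) * (m * cnj t - 1))"
    by (simp add: lam_def)
  also have "\<dots> = 1" unfolding num using ne' by simp
  finally show 1: "lam R t * cnj (lam R t) = 1" .
  then have "(cmod (lam R t))\<^sup>2 = 1"
    by (metis complex_norm_square of_real_1 of_real_eq_iff of_real_power)
  then show "cmod (lam R t) = 1" by (simp add: power2_eq_1_iff) (smt (verit) norm_ge_zero)
  have tm: "t - m = t * (1 - m * cnj t)" using tt by (simp add: algebra_simps)
  have "lam R t * poisson t = t * (1 - m * cnj t) / (m * t - 1) * ((1 - m\<^sup>2) / ((1 - m * t) * (1 - m * cnj t)))"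
    unfolding poisson_def lam_def tm ..
  also have "\<dots> = t * ((m\<^sup>2 - 1) / (m * t - 1)\<^sup>2)"
    using ne ne' by (simp add: divide_simps power2_eq_square) (simp add: algebra_simps)
  finally show "t * ((m\<^sup>2 - 1) / (m * t - 1)\<^sup>2) = lam R t * poisson t" ..
  have "1 / (1 - m * t) + m * cnj t / (1 - m * cnj t) = (1 - m\<^sup>2 * (t * cnj t)) / ((1 - m * t) * (1 - m * cnj t))"
    using ne by (simp add: divide_simps power2_eq_square) (simp add: algebra_simps)
  then show "poisson t = 1 / (1 - m * t) + m * cnj t / (1 - m * cnj t)"
    unfolding tt poisson_def by simp
  show "cnj (poisson t) = poisson t" by (simp add: poisson_def mult.commute)
qed

text \<open>
This is the invariance of circle means under the disc automorphism. On the circle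
\<open>cnj (lam R t)\<close> is the inverse of \<open>lam R t\<close>, so a positive total power leaves the boundary values of a
holomorphic function vanishing at the origin, a negative one its conjugate, and total power zero
leaves the mean of the Poisson kernel.
\<close>

lemma circle_mean_lam_monomials:
  "circle_mean (\<lambda>t. lam R t ^ i * poisson t * cnj (lam R t) ^ j) = (if i = j then 1 else 0)"
proof -
  have pos: "circle_mean (\<lambda>t. lam R t ^ Suc k * poisson t) = 0" for k
  proof -
    define g where "g = (\<lambda>t. t * (lam R t ^ k * ((m\<^sup>2 - 1) / (m * t - 1)\<^sup>2)))"
    have "g holomorphic_on ball 0 (1 / \<mu>)"
      unfolding g_def using ball_inv_mu_D
      by (intro holomorphic_intros holomorphic_on_subset[OF lam_holomorphic]) auto
    then have "circle_mean g = g 0" using inv_mu_gt_1 by (rule circle_mean_holomorphic)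
    also have "\<dots> = 0" by (simp add: g_def)
    also have "circle_mean g = circle_mean (\<lambda>t. lam R t ^ Suc k * poisson t)"
    proof (rule circle_mean_cong)
      fix t :: complex assume t: "cmod t = 1"
      have "g t = lam R t ^ k * (t * ((m\<^sup>2 - 1) / (m * t - 1)\<^sup>2))" by (simp add: g_def)
      then show "g t = lam R t ^ Suc k * poisson t"
        unfolding lam_unit_circle(3)[OF t] by (simp add: mult_ac)
    qed
    finally show ?thesis .
  qed
  have one: "lam R t ^ n * cnj (lam R t) ^ n = 1" if "cmod t = 1" for t n
    using lam_unit_circle(1)[OF that] by (simp flip: power_mult_distrib)
  consider (eq) "i = j" | (gt) k where "i = j + Suc k" | (lt) k where "j = i + Suc k"
    by (metis less_imp_Suc_add linorder_neqE_nat add_Suc_right)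
  then show ?thesis
  proof cases
    case eq
    have "circle_mean (\<lambda>t. lam R t ^ i * poisson t * cnj (lam R t) ^ j) =
          circle_mean (\<lambda>t. 1 / (1 - m * t) + m * cnj t / (1 - m * cnj t))"
    proof (rule circle_mean_cong)
      fix t :: complex assume t: "cmod t = 1"
      have "lam R t ^ i * poisson t * cnj (lam R t) ^ j = (lam R t ^ j * cnj (lam R t) ^ j) * poisson t"
        using eq by (simp add: mult_ac)
      then show "lam R t ^ i * poisson t * cnj (lam R t) ^ j = 1 / (1 - m * t) + m * cnj t / (1 - m * cnj t)"
        unfolding one[OF t] lam_unit_circle(4)[OF t] by simp
    qed
    also have "\<dots> = circle_mean (\<lambda>t. 1 / (1 - m * t)) + circle_mean (\<lambda>t. m * cnj t / (1 - m * cnj t))"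
      using unit_circle_m by (intro circle_mean_add continuous_intros) auto
    also have "circle_mean (\<lambda>t. 1 / (1 - m * t)) = 1"
      using circle_mean_holomorphic(1)[of "\<lambda>t. 1 / (1 - m * t)" "1 / \<mu>"] ball_inv_mu_D inv_mu_gt_1
      by (force intro!: holomorphic_intros)
    also have "circle_mean (\<lambda>t. m * cnj t / (1 - m * cnj t)) = 0"
      using circle_mean_holomorphic(2)[of "\<lambda>t. m * t / (1 - m * t)" "1 / \<mu>"] ball_inv_mu_D inv_mu_gt_1
      by (force intro!: holomorphic_intros)
    finally show ?thesis using eq by simp
  next
    case gt
    have "circle_mean (\<lambda>t. lam R t ^ i * poisson t * cnj (lam R t) ^ j) = circle_mean (\<lambda>t. lam R t ^ Suc k * poisson t)"
    proof (rule circle_mean_cong)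
      fix t :: complex assume t: "cmod t = 1"
      have "lam R t ^ i * poisson t * cnj (lam R t) ^ j = (lam R t ^ j * cnj (lam R t) ^ j) * (lam R t ^ Suc k * poisson t)"
        unfolding gt power_add by (simp add: mult_ac)
      then show "lam R t ^ i * poisson t * cnj (lam R t) ^ j = lam R t ^ Suc k * poisson t"
        unfolding one[OF t] by simp
    qed
    then show ?thesis unfolding pos using gt by simp
  next
    case lt
    have "circle_mean (\<lambda>t. lam R t ^ i * poisson t * cnj (lam R t) ^ j) = circle_mean (\<lambda>t. cnj (lam R t ^ Suc k * poisson t))"
    proof (rule circle_mean_cong)
      fix t :: complex assume t: "cmod t = 1"
      have "lam R t ^ i * poisson t * cnj (lam R t) ^ j = (lam R t ^ i * cnj (lam R t) ^ i) * (cnj (lam R t) ^ Suc k * poisson t)"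
        unfolding lt power_add by (simp add: mult_ac)
      then show "lam R t ^ i * poisson t * cnj (lam R t) ^ j = cnj (lam R t ^ Suc k * poisson t)"
        unfolding one[OF t] by (simp add: lam_unit_circle(5)[OF t])
    qed
    then show ?thesis unfolding circle_mean_cnj pos using lt by simp
  qed
qed

text \<open>
The Dirichlet pairing of the defect with \<open>W\<close>, computed in the variable \<open>w = lam R t\<close>: there \<open>W\<close> is a
polynomial, so only finitely many Taylor coefficients of the defect occur.
\<close>

lemma circle_mean_defect_taylor:
  "circle_mean (\<lambda>t. t * deriv (\<lambda>t. vlam U t - vlam U (m ^ 4 * t)) t * cnj (vlam W t)) =
     (\<Sum>i\<le>degree W. of_nat i * taylor (defect U) i * cnj (coeff W i))"
proof -
  define c where "c = (\<lambda>i. of_nat i * taylor (defect U) i)"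
  define d where "d = (\<lambda>j. cnj (coeff W j))"
  have R1: "1 < R - 1" using R_gt by simp
  have hd: "(defect U has_field_derivative deriv (defect U) (lam R t)) (at (lam R t))" if "cmod t = 1" for t
    using lam_unit_circle(2)[OF that] R1
    by (intro holomorphic_derivI[OF defect_holomorphic]) auto
  have open_dom: "open {t. m * t \<noteq> 1}" by (intro open_Collect_neq continuous_intros)
  have lamcont: "continuous_on {t. cmod t = 1} (lam R)"
    using unit_circle_m by (intro holomorphic_on_imp_continuous_on holomorphic_on_subset[OF lam_holomorphic]) auto
  have pc: "continuous_on {t. cmod t = 1} poisson"
    unfolding poisson_def[abs_def] using unit_circle_m by (intro continuous_intros) auto
  have "compact {t::complex. cmod t = 1}" using compact_sphere[of "0::complex" 1] by (simp add: sphere_def dist_norm)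
  then have "bounded (poisson ` {t. cmod t = 1})"
    using pc by (intro compact_imp_bounded compact_continuous_image)
  then obtain B where B: "\<And>t. cmod t = 1 \<Longrightarrow> cmod (poisson t) \<le> B"
    by (auto simp: bounded_iff)
  have f: "t * deriv (\<lambda>t. vlam U t - vlam U (m ^ 4 * t)) t = (\<Sum>i. c i * (lam R t ^ i * poisson t))"
    if t: "cmod t = 1" for t
  proof -
    have "((\<lambda>t. defect U (lam R t)) has_field_derivative deriv (defect U) (lam R t) * ((m\<^sup>2 - 1) / (m * t - 1)\<^sup>2)) (at t)"
      by (rule DERIV_chain2[OF hd[OF t] lam_deriv[OF unit_circle_m(1)[OF t]]])
    then have "((\<lambda>t. vlam U t - vlam U (m ^ 4 * t)) has_field_derivative deriv (defect U) (lam R t) * ((m\<^sup>2 - 1) / (m * t - 1)\<^sup>2)) (at t)"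
      by (rule has_field_derivative_transform_within_open[OF _ open_dom]) (use unit_circle_m[OF t] defect_lam in auto)
    then have "t * deriv (\<lambda>t. vlam U t - vlam U (m ^ 4 * t)) t =
        deriv (defect U) (lam R t) * (t * ((m\<^sup>2 - 1) / (m * t - 1)\<^sup>2))"
      by (simp add: DERIV_imp_deriv)
    also have "\<dots> = (lam R t * deriv (defect U) (lam R t)) * poisson t"
      unfolding lam_unit_circle(3)[OF t] by (simp add: mult_ac)
    finally have e: "t * deriv (\<lambda>t. vlam U t - vlam U (m ^ 4 * t)) t = (lam R t * deriv (defect U) (lam R t)) * poisson t" .
    have "(\<lambda>i. c i * lam R t ^ i) sums (lam R t * deriv (defect U) (lam R t))"
      unfolding c_def using lam_unit_circle(2)[OF t] R1 by (intro taylor_series(3)[OF defect_holomorphic]) simp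
    from sums_mult2[OF this, of "poisson t"] show ?thesis
      unfolding e by (simp add: sums_iff mult.assoc)
  qed
  have g: "cnj (vlam W t) = (\<Sum>j. d j * cnj (lam R t) ^ j)" for t
  proof -
    have "cnj (vlam W t) = (\<Sum>j\<le>degree W. d j * cnj (lam R t) ^ j)"
      by (simp add: vlam_def poly_altdef d_def)
    also have "\<dots> = (\<Sum>j. d j * cnj (lam R t) ^ j)"
      by (rule suminf_finite[symmetric]) (auto simp: d_def coeff_eq_0)
    finally show ?thesis .
  qed
  have "(\<lambda>i. c i * (\<Sum>j. d j * circle_mean (\<lambda>t. lam R t ^ i * poisson t * cnj (lam R t) ^ j))) sums
     circle_mean (\<lambda>t. t * deriv (\<lambda>t. vlam U t - vlam U (m ^ 4 * t)) t * cnj (vlam W t))"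
  proof (rule circle_mean_product_series[of "\<lambda>i t. lam R t ^ i * poisson t" B "\<lambda>j t. cnj (lam R t) ^ j" 1, OF _ _ _ _ _ _ f g])
    show "summable (\<lambda>i. norm (c i))"
      using taylor_series(4)[OF defect_holomorphic, of 1 U] R1 by (simp add: c_def)
    show "summable (\<lambda>i. norm (d i))"
      by (rule summable_finite[of "{..degree W}"]) (auto simp: d_def coeff_eq_0)
  qed (use B lam_unit_circle(2) in \<open>auto simp: norm_mult norm_power intro!: continuous_intros lamcont pc\<close>)
  then have "(\<lambda>i. c i * d i) sums
     circle_mean (\<lambda>t. t * deriv (\<lambda>t. vlam U t - vlam U (m ^ 4 * t)) t * cnj (vlam W t))"
    unfolding circle_mean_lam_monomials suminf_mult_delta .
  moreover have "(\<lambda>i. c i * d i) sums (\<Sum>i\<le>degree W. c i * d i)"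
    by (rule sums_finite) (auto simp: d_def coeff_eq_0)
  ultimately show ?thesis unfolding c_def d_def by (rule sums_unique2)
qed

lemma circle_mean_defect_Parseval:
  "(\<lambda>i. of_nat i * (1 - m ^ (4 * i)) * v U i * cnj (v W i)) sums
     circle_mean (\<lambda>t. t * deriv (\<lambda>t. vlam U t - vlam U (m ^ 4 * t)) t * cnj (vlam W t))"
proof -
  define a where "a = (\<lambda>i. of_nat i * v U i)"
  define c where "c = (\<lambda>i. of_nat i * (1 - m ^ (4 * i)) * v U i)"
  have sa: "summable (\<lambda>i. norm (a i))" unfolding a_def by (rule v_summable)
  have sc: "summable (\<lambda>i. norm (c i))"
  proof (rule summable_comparison_test'[OF summable_mult[OF sa, of 2]])
    fix i
    have "norm (1 - m ^ (4 * i)) \<le> 2"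
      using norm_triangle_ineq4[of 1 "m ^ (4 * i)"] norm_m_power_le[of "4 * i"] by simp
    then have "norm (a i) * norm (1 - m ^ (4 * i)) \<le> norm (a i) * 2" by (rule mult_left_mono) simp
    then show "norm (norm (c i)) \<le> 2 * norm (a i)" by (simp add: c_def a_def norm_mult mult_ac)
  qed
  have "(\<lambda>i. c i * cnj (v W i)) sums
     circle_mean (\<lambda>t. t * deriv (\<lambda>t. vlam U t - vlam U (m ^ 4 * t)) t * cnj (vlam W t))"
  proof (rule circle_mean_Parseval[OF sc])
    show "summable (\<lambda>i. norm (cnj (v W i)))" using v_summable(1) by simp
    fix t :: complex assume t: "cmod t = 1"
    have s: "cmod t < 1 / \<mu>" "cmod (m ^ 4 * t) < 1 / \<mu>"
      using t inv_mu_gt_1 mu_power_lt_inv[of 4] mu_props by (simp_all add: norm_mult norm_power)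
    have "((\<lambda>t. m ^ 4 * t) has_field_derivative m ^ 4) (at t)" by (auto intro!: derivative_eq_intros)
    from DERIV_chain2[OF vlam_has_derivative[OF s(2)] this]
    have "((\<lambda>t. vlam U t - vlam U (m ^ 4 * t)) has_field_derivative deriv (vlam U) t - deriv (vlam U) (m ^ 4 * t) * m ^ 4) (at t)"
      by (intro DERIV_diff vlam_has_derivative s)
    then have "t * deriv (\<lambda>t. vlam U t - vlam U (m ^ 4 * t)) t = t * deriv (vlam U) t - (m ^ 4 * t) * deriv (vlam U) (m ^ 4 * t)"
      by (simp add: DERIV_imp_deriv algebra_simps)
    moreover have "(\<lambda>i. a i * t ^ i - a i * (m ^ 4 * t) ^ i) sums (t * deriv (vlam U) t - (m ^ 4 * t) * deriv (vlam U) (m ^ 4 * t))"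
      unfolding a_def by (intro sums_diff taylor_series(3)[OF vlam_holomorphic] s)
    moreover have "a i * t ^ i - a i * (m ^ 4 * t) ^ i = c i * t ^ i" for i
      by (simp add: a_def c_def power_mult_distrib algebra_simps flip: power_mult)
    ultimately show "t * deriv (\<lambda>t. vlam U t - vlam U (m ^ 4 * t)) t = (\<Sum>i. c i * t ^ i)"
      by (simp add: sums_iff)
    show "cnj (vlam W t) = (\<Sum>i. cnj (v W i) * cnj t ^ i)"
      using cnj_suminf[OF taylor_series(1)[OF vlam_holomorphic s(1)]] by simp
  qed
  then show ?thesis by (simp add: c_def)
qed

text \<open>
The same number in two variables. The first form gives an a priori bound on \<open>V\<close>, the second the
orthogonality relations.
\<close>

lemma area_pairing:
  assumes "\<And>t. t \<in> ann \<Longrightarrow> poly P (h t) = poly U (lam R t) + poly U (lam R (m\<^sup>2 / t))"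
    and "\<And>t. t \<in> ann \<Longrightarrow> poly Q (h t) = poly W (lam R t) + poly W (lam R (m\<^sup>2 / t))"
  defines "I \<equiv> complex_of_real (1 / pi) *
     (LINT z:region_G1 R|lborel. poly (pderiv P) z * cnj (poly (pderiv Q) z))"
  shows "(\<lambda>i. of_nat i * (1 - m ^ (4 * i)) * v U i * cnj (v W i)) sums I"
    and "I = (\<Sum>i\<le>degree W. of_nat i * taylor (defect U) i * cnj (coeff W i))"
proof -
  show s: "(\<lambda>i. of_nat i * (1 - m ^ (4 * i)) * v U i * cnj (v W i)) sums I"
    unfolding I_def area_integral_as_circle_mean by (rule circle_mean_pairing[OF assms(1,2)])
  show "I = (\<Sum>i\<le>degree W. of_nat i * taylor (defect U) i * cnj (coeff W i))"
    using sums_unique2[OF s circle_mean_defect_Parseval] circle_mean_defect_taylor by simp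
qed

text \<open>
The function \<open>U \<circ> lam\<close>, symmetrised by the involution, is an antiderivative of \<open>q(h) h'\<close>, and \<open>q\<close> has the
properties of the \<open>n\<close>-th orthonormal polynomial. The last three are
orthogonality to lower degrees, and the normalisation in the variables \<open>w\<close> and \<open>t\<close>.
\<close>

definition bergman_potential :: "nat \<Rightarrow> complex poly \<Rightarrow> complex poly \<Rightarrow> bool" where
  "bergman_potential n q U \<longleftrightarrow>
     degree U = Suc n \<and> coeff U (Suc n) \<in> \<real> \<and> Re (coeff U (Suc n)) > 0 \<and>
     (\<forall>t\<in>ann. poly q (h t) * deriv h t = deriv (\<lambda>t. vlam U t + vlam U (m\<^sup>2 / t)) t) \<and>
     (\<forall>j. 1 \<le> j \<longrightarrow> j \<le> n \<longrightarrow> taylor (defect U) j = 0) \<and>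
     of_nat (Suc n) * taylor (defect U) (Suc n) * cnj (coeff U (Suc n)) = 1 \<and>
     (\<lambda>i. of_nat i * (1 - m ^ (4 * i)) * v U i * cnj (v U i)) sums 1"

text \<open>
The potentials of \<open>p 0, ..., p (n - 1)\<close> have the exact degrees \<open>1, ..., n\<close>. The relations with them
form a triangular system for the Taylor coefficients of the defect, so these vanish one after the
other.
\<close>

lemma orthonormal_structure:
  assumes p: "area_orthonormal_polys (region_G1 R) p"
  shows "\<exists>U. \<forall>n. bergman_potential n (p n) (U n)"
proof -
  have deg: "degree (p n) = n" and lc: "lead_coeff (p n) \<in> \<real>" "Re (lead_coeff (p n)) > 0" for n
    using p unfolding area_orthonormal_polys_def by blast+
  have orth: "complex_of_real (1 / pi) * (LINT z:region_G1 R|lborel. poly (p n) z * cnj (poly (p k) z)) =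
      (if n = k then 1 else 0)" for n k
    using p unfolding area_orthonormal_polys_def by blast
  have "p n \<noteq> 0" for n using lc(2)[of n] by auto
  then have "\<exists>P. pderiv P = p n \<and> degree P = Suc n \<and> lead_coeff P = lead_coeff (p n) / of_nat (Suc n)" for n
    using exists_antiderivative_poly deg by blast
  then obtain P where P: "\<And>n. pderiv (P n) = p n" "\<And>n. degree (P n) = Suc n"
      "\<And>n. lead_coeff (P n) = lead_coeff (p n) / of_nat (Suc n)" by metis
  have "\<exists>U. degree U \<le> degree (P n) \<and> coeff U (degree (P n)) = of_real R ^ degree (P n) * lead_coeff (P n) \<and>
       (\<forall>t\<in>ann. poly (P n) (h t) = poly U (lam R t) + poly U (lam R (m\<^sup>2 / t)))" for n
    using joukowski_region_poly_split[of "P n"] P(2)[of n] by simp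
  then obtain U where U: "\<And>n. degree (U n) \<le> Suc n"
      "\<And>n. coeff (U n) (Suc n) = of_real R ^ Suc n * lead_coeff (P n)"
      "\<And>n t. t \<in> ann \<Longrightarrow> poly (P n) (h t) = poly (U n) (lam R t) + poly (U n) (lam R (m\<^sup>2 / t))"
    unfolding P(2) by metis
  have cU: "coeff (U n) (Suc n) = of_real (R ^ Suc n / real (Suc n) * Re (lead_coeff (p n)))" for n
    unfolding U(2) P(3) using lc(1)[of n] by (simp add: complex_is_Real_iff complex_eq_iff)
  have cR: "coeff (U n) (Suc n) \<in> \<real>" for n unfolding cU by simp
  have cpos: "Re (coeff (U n) (Suc n)) > 0" for n unfolding cU using lc(2)[of n] R_gt by simp
  have cnz: "coeff (U n) (Suc n) \<noteq> 0" for n using cpos[of n] by auto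
  have dU: "degree (U n) = Suc n" for n by (rule antisym[OF U(1) le_degree[OF cnz]])
  have pair: "(\<Sum>i\<le>Suc k. of_nat i * taylor (defect (U n)) i * cnj (coeff (U k) i)) = (if n = k then 1 else 0)" for n k
    using area_pairing(2)[OF U(3)[of _ n] U(3)[of _ k]] orth[of n k] by (simp add: P(1) dU)
  have zero: "taylor (defect (U n)) j = 0" if "1 \<le> j" "j \<le> n" for n j
    using that
  proof (induction j rule: less_induct)
    case (less j)
    then obtain k where k: "j = Suc k" by (cases j) auto
    have "(\<Sum>i\<le>Suc k. of_nat i * taylor (defect (U n)) i * cnj (coeff (U k) i)) =
          of_nat (Suc k) * taylor (defect (U n)) (Suc k) * cnj (coeff (U k) (Suc k))"
      using less k by (subst sum.atMost_Suc) (auto intro!: sum.neutral)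
    then have "of_nat (Suc k) * taylor (defect (U n)) (Suc k) * cnj (coeff (U k) (Suc k)) = 0"
      using pair[of n k] less k by simp
    then show ?case using cnz[of k] k by (simp del: of_nat_Suc)
  qed
  have "bergman_potential n (p n) (U n)" for n
    unfolding bergman_potential_def
  proof (intro conjI ballI allI impI)
    show "of_nat (Suc n) * taylor (defect (U n)) (Suc n) * cnj (coeff (U n) (Suc n)) = 1"
    proof -
      have "(\<Sum>i\<le>Suc n. of_nat i * taylor (defect (U n)) i * cnj (coeff (U n) i)) =
          of_nat (Suc n) * taylor (defect (U n)) (Suc n) * cnj (coeff (U n) (Suc n))"
        using zero by (subst sum.atMost_Suc) (auto intro!: sum.neutral)
      then show ?thesis using pair[of n n] by simp
    qed
    show "(\<lambda>i. of_nat i * (1 - m ^ (4 * i)) * v (U n) i * cnj (v (U n) i)) sums 1"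
      using area_pairing(1)[OF U(3)[of _ n] U(3)[of _ n]] orth[of n n] by (simp add: P(1))
    show "poly (p n) (h t) * deriv h t = deriv (\<lambda>t. vlam (U n) t + vlam (U n) (m\<^sup>2 / t)) t" if "t \<in> ann" for t
    proof -
      have "(h has_field_derivative deriv h t) (at t)"
        using h_holomorphic open_ann that by (rule holomorphic_derivI)
      from DERIV_chain2[OF poly_DERIV this, of "P n"]
      have "((\<lambda>t. poly (P n) (h t)) has_field_derivative poly (p n) (h t) * deriv h t) (at t)"
        unfolding P(1) .
      then have "((\<lambda>t. vlam (U n) t + vlam (U n) (m\<^sup>2 / t)) has_field_derivative poly (p n) (h t) * deriv h t) (at t)"
        by (rule has_field_derivative_transform_within_open[OF _ open_ann that]) (simp add: U(3) vlam_def)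
      then show ?thesis by (rule DERIV_imp_deriv[symmetric])
    qed
  qed (use dU cR cpos zero in auto)
  then show ?thesis by blast
qed

end

section \<open>Sums over a geometric scale\<close>

text \<open>
Comparison with the integral of \<open>exp (- a x)\<close> over the intervals between consecutive powers of \<open>\<beta>\<close>,
in telescoped form. For large \<open>a\<close> only the boundedly many terms with \<open>\<beta> ^ k\<close> of order \<open>1 / a\<close>
matter.
\<close>

lemma suminf_geometric_exp:
  fixes a \<beta> :: real
  assumes "0 < \<beta>" "\<beta> < 1" "0 < a"
  shows "summable (\<lambda>k. \<beta> ^ k * exp (- a * \<beta> ^ k))"
    and "(\<Sum>k. \<beta> ^ k * exp (- a * \<beta> ^ k)) \<le> 1 / ((1 - \<beta>) * a)"
proof -
  define E where "E = (\<lambda>k. exp (- a * \<beta> ^ k))"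
  have "(\<lambda>k. \<beta> ^ k) \<longlonglongrightarrow> 0" using assms by (intro LIMSEQ_realpow_zero) auto
  then have "(\<lambda>k. - a * \<beta> ^ k) \<longlonglongrightarrow> - a * 0" by (rule tendsto_mult_left)
  then have "E \<longlonglongrightarrow> 1" unfolding E_def using tendsto_exp[of "\<lambda>k. - a * \<beta> ^ k" 0] by simp
  then have tel: "(\<lambda>k. (E (Suc k) - E k) * (1 / ((1 - \<beta>) * a))) sums ((1 - E 0) * (1 / ((1 - \<beta>) * a)))"
    by (intro sums_mult2 telescope_sums)
  have le: "\<beta> ^ k * exp (- a * \<beta> ^ k) \<le> (E (Suc k) - E k) * (1 / ((1 - \<beta>) * a))" for k
  proof -
    define x where "x = a * \<beta> ^ k * (1 - \<beta>)"
    have "E (Suc k) = E k * exp x" by (simp add: E_def x_def algebra_simps flip: exp_add)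
    moreover have "E k * (1 + x) \<le> E k * exp x" by (intro mult_left_mono) (auto simp: E_def)
    ultimately have "E k * x \<le> E (Suc k) - E k" by (simp add: algebra_simps)
    then have "E k * x * (1 / ((1 - \<beta>) * a)) \<le> (E (Suc k) - E k) * (1 / ((1 - \<beta>) * a))"
      using assms by (intro mult_right_mono) auto
    moreover have "E k * x * (1 / ((1 - \<beta>) * a)) = \<beta> ^ k * exp (- a * \<beta> ^ k)"
      using assms by (simp add: x_def E_def)
    ultimately show ?thesis by simp
  qed
  show s: "summable (\<lambda>k. \<beta> ^ k * exp (- a * \<beta> ^ k))"
    by (rule summable_comparison_test'[OF sums_summable[OF tel]]) (use le assms in auto)
  have "(\<Sum>k. \<beta> ^ k * exp (- a * \<beta> ^ k)) \<le> (1 - E 0) * (1 / ((1 - \<beta>) * a))"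
    using suminf_le[OF le s sums_summable[OF tel]] tel by (simp add: sums_iff)
  also have "\<dots> \<le> 1 * (1 / ((1 - \<beta>) * a))"
    using assms by (intro mult_right_mono) (auto simp: E_def)
  finally show "(\<Sum>k. \<beta> ^ k * exp (- a * \<beta> ^ k)) \<le> 1 / ((1 - \<beta>) * a)" by simp
qed

text \<open>
Each extra factor \<open>\<beta> ^ k\<close> is absorbed, at the cost of \<open>1 / b\<close>, by one of \<open>Suc p\<close> equal parts of the
exponential, since \<open>y exp (- y) \<le> 1\<close>.
\<close>

lemma suminf_geometric_power_exp:
  fixes a \<beta> :: real
  assumes "0 < \<beta>" "\<beta> < 1" "0 < a"
  shows "summable (\<lambda>k. \<beta> ^ k * ((\<beta> ^ k) ^ p * exp (- a * \<beta> ^ k)))"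
    and "(\<Sum>k. \<beta> ^ k * ((\<beta> ^ k) ^ p * exp (- a * \<beta> ^ k))) \<le> real (Suc p) ^ Suc p / ((1 - \<beta>) * a ^ Suc p)"
proof -
  define b where "b = a / real (Suc p)"
  have b: "b > 0" "a = real (Suc p) * b" using assms by (simp_all add: b_def)
  define K where "K = (1 / b) ^ p"
  note S = suminf_geometric_exp[OF assms(1,2) b(1)]
  have le: "\<beta> ^ k * ((\<beta> ^ k) ^ p * exp (- a * \<beta> ^ k)) \<le> K * (\<beta> ^ k * exp (- b * \<beta> ^ k))" for k
  proof -
    define y where "y = b * \<beta> ^ k"
    have y: "y \<ge> 0" using b assms by (simp add: y_def)
    have "y * exp (- y) \<le> 1"
    proof -
      have "y \<le> exp y" using exp_ge_add_one_self[of y] by linarith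
      then show ?thesis by (simp add: exp_minus field_simps)
    qed
    then have "(y * exp (- y)) ^ p \<le> 1" using y by (intro power_le_one) auto
    then have "y ^ p * exp (- (real p * y)) \<le> 1"
      by (simp add: power_mult_distrib exp_of_nat_mult[symmetric])
    then have "(1 / b) ^ p * (y ^ p * exp (- (real p * y))) \<le> (1 / b) ^ p * 1"
      using b by (intro mult_left_mono) auto
    moreover have "(1 / b) ^ p * y ^ p = (\<beta> ^ k) ^ p"
      using b by (simp add: y_def flip: power_mult_distrib)
    ultimately have "(\<beta> ^ k) ^ p * exp (- (real p * y)) \<le> K"
      by (simp add: K_def mult.assoc[symmetric])
    then have "(\<beta> ^ k) ^ p * exp (- (real p * y)) * (\<beta> ^ k * exp (- y)) \<le> K * (\<beta> ^ k * exp (- y))"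
      using assms by (intro mult_right_mono) auto
    moreover have "exp (- a * \<beta> ^ k) = exp (- (real p * y)) * exp (- y)"
      unfolding b(2) by (simp add: y_def algebra_simps flip: exp_add)
    ultimately show ?thesis by (simp add: y_def mult_ac)
  qed
  show s: "summable (\<lambda>k. \<beta> ^ k * ((\<beta> ^ k) ^ p * exp (- a * \<beta> ^ k)))"
    by (rule summable_comparison_test'[OF summable_mult[OF S(1), of K]]) (use le assms in auto)
  have "(\<Sum>k. \<beta> ^ k * ((\<beta> ^ k) ^ p * exp (- a * \<beta> ^ k))) \<le> K * (\<Sum>k. \<beta> ^ k * exp (- b * \<beta> ^ k))"
    unfolding suminf_mult[OF S(1), symmetric] by (rule suminf_le[OF le s summable_mult[OF S(1)]])
  also have "\<dots> \<le> K * (1 / ((1 - \<beta>) * b))"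
    using S(2) b by (intro mult_left_mono) (auto simp: K_def)
  also have "\<dots> = real (Suc p) ^ Suc p / ((1 - \<beta>) * a ^ Suc p)"
    using assms by (simp add: K_def b_def power_divide field_simps)
  finally show "(\<Sum>k. \<beta> ^ k * ((\<beta> ^ k) ^ p * exp (- a * \<beta> ^ k))) \<le> real (Suc p) ^ Suc p / ((1 - \<beta>) * a ^ Suc p)" .
qed

lemma summable_nat_power_geometric:
  fixes x :: real
  assumes "\<bar>x\<bar> < 1" shows "summable (\<lambda>i. real i ^ p * x ^ i)"
  using assms
proof (induction p arbitrary: x)
  case (Suc p)
  have "summable (\<lambda>n. diffs (\<lambda>i. real i ^ p) n * x ^ n)"
    using Suc by (intro termdiff_converges[of x 1]) auto
  then have "summable (\<lambda>n. x * (diffs (\<lambda>i. real i ^ p) n * x ^ n))" by (rule summable_mult)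
  moreover have "(\<lambda>n. x * (diffs (\<lambda>i. real i ^ p) n * x ^ n)) = (\<lambda>n. real (Suc n) ^ Suc p * x ^ Suc n)"
    by (simp add: diffs_def mult_ac)
  ultimately show ?case by (simp only: summable_Suc_iff[of "\<lambda>n. real n ^ Suc p * x ^ n"])
qed (simp add: summable_geometric)

section \<open>Taylor coefficients of the defect\<close>

lemma holomorphic_vanishing_order_bound:
  assumes f: "f holomorphic_on ball 0 r" and r: "1 < r" and z: "\<And>i. i < k \<Longrightarrow> taylor f i = 0"
  shows "\<exists>C\<ge>0. \<forall>s. cmod s \<le> 1 \<longrightarrow> cmod (f s) \<le> C * cmod s ^ k"
proof -
  have s1: "summable (\<lambda>i. norm (taylor f i))" using taylor_series(2)[OF f, of 1] r by simp
  define C where "C = (\<Sum>i. norm (taylor f i))"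
  have "cmod (f s) \<le> C * cmod s ^ k" if s: "cmod s \<le> 1" for s
  proof -
    have le: "norm (taylor f i * s ^ i) \<le> norm (taylor f i) * cmod s ^ k" for i
    proof (cases "i < k")
      case True then show ?thesis using z by simp
    next
      case False
      then have "cmod s ^ i \<le> cmod s ^ k" using s by (intro power_decreasing) auto
      then show ?thesis by (simp add: norm_mult norm_power mult_left_mono)
    qed
    have "f s = (\<Sum>i. taylor f i * s ^ i)" using taylor_series(1)[OF f, of s] s r by (simp add: sums_iff)
    also have "cmod \<dots> \<le> (\<Sum>i. norm (taylor f i) * cmod s ^ k)"
      by (rule norm_suminf_le[OF le summable_mult2[OF s1]])
    also have "\<dots> = C * cmod s ^ k" unfolding C_def by (rule suminf_mult2[OF s1, symmetric])
    finally show ?thesis .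
  qed
  moreover have "C \<ge> 0" unfolding C_def by (rule suminf_nonneg[OF s1]) simp
  ultimately show ?thesis by blast
qed

lemma norm_power_diff_le:
  fixes x y :: complex
  assumes "cmod x \<le> M" "cmod y \<le> M" "M > 0"
  shows "cmod (x ^ n - y ^ n) \<le> real n * cmod (x - y) * M ^ (n - 1)"
proof (cases n)
  case (Suc k)
  have n: "cmod (x / M) \<le> 1" "cmod (y / M) \<le> 1" using assms by (simp_all add: norm_divide)
  have "cmod (x ^ n - y ^ n) = M ^ n * cmod ((x / M) ^ n - (y / M) ^ n)"
    using assms by (simp add: power_divide norm_divide norm_power flip: diff_divide_distrib)
  also have "\<dots> \<le> M ^ n * (real n * cmod (x / M - y / M))"
    using norm_power_diff[OF n, of n] assms by (intro mult_left_mono) auto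
  also have "cmod (x / M - y / M) = cmod (x - y) / M"
    using assms by (simp add: norm_divide flip: diff_divide_distrib)
  finally show ?thesis using assms Suc by (simp add: mult_ac)
qed simp

lemma taylor_poly: "taylor (poly p) j = coeff p j"
proof -
  have "(deriv ^^ n) (poly p) = poly ((pderiv ^^ n) p)" for n
    by (induction n) (auto intro!: ext DERIV_imp_deriv poly_DERIV)
  then show ?thesis
    by (simp add: taylor_def poly_0_coeff_0 coeff_higher_pderiv pochhammer_fact[symmetric])
qed

lemma taylor_diff:
  assumes "f holomorphic_on ball 0 r" "g holomorphic_on ball 0 r" "r > 0"
  shows "taylor (\<lambda>w. f w - g w) j = taylor f j - taylor g j"
  unfolding taylor_def using higher_deriv_diff[OF assms(1,2)] assms(3) by (simp add: diff_divide_distrib)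

lemma taylor_const: "taylor (\<lambda>w. c) j = (if j = 0 then c else 0)"
proof -
  have e: "(\<lambda>w. c) = poly [:c:]" by (rule ext) simp
  show ?thesis unfolding e taylor_poly by (cases j) auto
qed

context bergman_region
begin

lemma vlam_coeff_bound:
  assumes "(\<lambda>i. of_nat i * (1 - m ^ (4 * i)) * v U i * cnj (v U i)) sums 1" and "i \<ge> 1"
  shows "cmod (v U i) \<le> 1 / (1 - \<mu> ^ 4)"
proof -
  have mu4: "\<mu> ^ 4 < 1" "\<mu> ^ 4 > 0" using mu_props by (auto simp: power_less_one_iff)
  define a where "a = (\<lambda>i. real i * (1 - \<mu> ^ (4 * i)) * (cmod (v U i))\<^sup>2)"
  have mui: "\<mu> ^ (4 * i) \<le> 1" for i using mu_props by (simp add: power_le_one)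
  have "of_nat i * (1 - m ^ (4 * i)) * v U i * cnj (v U i) = complex_of_real (a i)" for i
    unfolding a_def of_real_mult complex_norm_square[of "v U i", symmetric] by (simp add: mult.assoc flip: complex_norm_square)
  then have "(\<lambda>i. complex_of_real (a i)) sums 1" using assms(1) by simp
  then have "a sums 1" by (auto dest: sums_Re)
  then have "a i \<le> 1"
    using sum_le_suminf[of a "{i}"] mui by (auto simp: sums_iff a_def)
  have "\<mu> ^ (4 * i) \<le> \<mu> ^ 4" using mu_props assms(2) by (intro power_decreasing) auto
  then have "1 * (1 - \<mu> ^ 4) * (cmod (v U i))\<^sup>2 \<le> a i"
    unfolding a_def using assms(2) mu4 by (intro mult_right_mono mult_mono) auto
  then have "(cmod (v U i))\<^sup>2 \<le> 1 / (1 - \<mu> ^ 4)" using \<open>a i \<le> 1\<close> mu4 by (simp add: field_simps)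
  also have "\<dots> \<le> (1 / (1 - \<mu> ^ 4))\<^sup>2"
  proof -
    have "1 \<le> 1 / (1 - \<mu> ^ 4)" using mu4 by simp
    then show ?thesis using self_le_power[of "1 / (1 - \<mu> ^ 4)" 2] by simp
  qed
  finally show ?thesis using mu4 by (intro power2_le_imp_le[of "cmod (v U i)"]) auto
qed

lemma vlam_bound:
  assumes "(\<lambda>i. of_nat i * (1 - m ^ (4 * i)) * v U i * cnj (v U i)) sums 1" and s: "cmod s \<le> \<mu>\<^sup>2"
  shows "cmod (vlam U s - vlam U 0) \<le> 1 / (1 - \<mu> ^ 4) * (1 / (1 - \<mu>\<^sup>2))"
proof -
  have mu2: "\<mu>\<^sup>2 < 1" "0 \<le> \<mu>\<^sup>2" using mu_props by (auto simp: power_less_one_iff)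
  have s': "cmod s < 1 / \<mu>" using s mu_power_lt_inv[of 2] by simp
  define b where "b = (\<lambda>i. if i = 0 then 0 else v U i * s ^ i)"
  have "(\<lambda>i. v U i * s ^ i - (if i = 0 then v U i * s ^ i else 0)) sums (vlam U s - v U 0 * s ^ 0)"
    using sums_single[of 0 "\<lambda>i. v U i * s ^ i"] by (intro sums_diff taylor_series(1)[OF vlam_holomorphic s'])
  moreover have "(\<lambda>i. v U i * s ^ i - (if i = 0 then v U i * s ^ i else 0)) = b" by (auto simp: b_def)
  ultimately have sb: "b sums (vlam U s - vlam U 0)" by (simp add: taylor_def)
  have "norm (b i) \<le> 1 / (1 - \<mu> ^ 4) * (\<mu>\<^sup>2) ^ i" for i
  proof (cases "i = 0")
    case True
    have "\<mu> ^ 4 < 1" using mu_props by (simp add: power_less_one_iff)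
    then show ?thesis using True by (simp add: b_def)
  next
    case False
    then have "norm (b i) = cmod (v U i) * cmod s ^ i" by (simp add: b_def norm_mult norm_power)
    also have "\<dots> \<le> 1 / (1 - \<mu> ^ 4) * (\<mu>\<^sup>2) ^ i"
      using vlam_coeff_bound[OF assms(1), of i] False s mu_props
      by (intro mult_mono power_mono) (auto simp: power_le_one)
    finally show ?thesis .
  qed
  then have "norm (\<Sum>i. b i) \<le> (\<Sum>i. 1 / (1 - \<mu> ^ 4) * (\<mu>\<^sup>2) ^ i)"
    using mu2 by (intro norm_suminf_le summable_mult summable_geometric) auto
  also have "\<dots> = 1 / (1 - \<mu> ^ 4) * (1 / (1 - \<mu>\<^sup>2))"
    using mu2 by (subst suminf_mult) (auto simp: suminf_geometric)
  finally show ?thesis using sb by (simp add: sums_iff)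
qed

text \<open>
Cauchy's inequality on the circle of radius \<open>R / 2\<close>, which lies strictly between \<open>1\<close> and \<open>R - 1\<close>. The
bound does not depend on the degree of \<open>U\<close>.
\<close>

lemma tau_taylor_bound:
  assumes "(\<lambda>i. of_nat i * (1 - m ^ (4 * i)) * v U i * cnj (v U i)) sums 1" and "j \<ge> 1"
  shows "cmod (taylor (\<lambda>w. poly U (tau w)) j) \<le> 1 / (1 - \<mu> ^ 4) * (1 / (1 - \<mu>\<^sup>2)) / (R / 2) ^ j"
proof -
  define g where "g = (\<lambda>w. poly U (tau w) - vlam U 0)"
  have hp: "(\<lambda>w. poly U (tau w)) holomorphic_on ball 0 (R - 1)"
    by (intro holomorphic_poly_compose tau_holomorphic)
  then have hg: "g holomorphic_on ball 0 (R - 1)"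
    unfolding g_def by (intro holomorphic_on_diff holomorphic_on_const)
  have sub: "ball 0 (R/2) \<subseteq> ball (0::complex) (R - 1)" "cball 0 (R/2) \<subseteq> ball (0::complex) (R - 1)"
    using R_gt by auto
  have "norm ((deriv ^^ j) g 0) \<le> fact j * (1 / (1 - \<mu> ^ 4) * (1 / (1 - \<mu>\<^sup>2))) / (R/2) ^ j"
  proof (rule Cauchy_inequality)
    show "g holomorphic_on ball 0 (R/2)" using hg sub holomorphic_on_subset by blast
    show "continuous_on (cball 0 (R/2)) g"
      using hg sub holomorphic_on_imp_continuous_on holomorphic_on_subset by blast
    fix w :: complex assume "cmod (0 - w) = R / 2"
    then have "cmod w \<le> R - 1" using R_gt by simp
    then have "cmod (m ^ 4 * lam R w) \<le> \<mu>\<^sup>2" by (rule lam_bound)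
    then show "cmod (g w) \<le> 1 / (1 - \<mu> ^ 4) * (1 / (1 - \<mu>\<^sup>2))"
      using vlam_bound[OF assms(1)] by (simp add: g_def tau_def vlam_def)
  qed (use R_gt in simp)
  then have "cmod (taylor g j) \<le> 1 / (1 - \<mu> ^ 4) * (1 / (1 - \<mu>\<^sup>2)) / (R/2) ^ j"
    by (simp add: taylor_def norm_divide field_simps)
  moreover have "taylor g j = taylor (\<lambda>w. poly U (tau w)) j"
    using assms(2) R_gt unfolding g_def by (subst taylor_diff[OF hp, of "\<lambda>_. vlam U 0"]) (auto simp: taylor_const)
  ultimately show ?thesis by simp
qed

lemma defect_taylor: "taylor (defect U) j = coeff U j - taylor (\<lambda>w. poly U (tau w)) j"
  unfolding defect_def[abs_def] using R_gt
  by (subst taylor_diff[of _ "R - 1"])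
     (auto simp: taylor_poly intro!: holomorphic_poly_compose tau_holomorphic holomorphic_intros)

definition defect_asymptotics :: "real \<Rightarrow> nat \<Rightarrow> complex poly \<Rightarrow> bool" where
  "defect_asymptotics C n U \<longleftrightarrow> (\<forall>w. cmod w \<le> 1 \<longrightarrow>
     cmod (deriv (defect U) w - of_real (sqrt (real (Suc n))) * w ^ n) \<le> C / (real (Suc n))\<^sup>2 * cmod w ^ n)"

text \<open>
With \<open>N = n + 1\<close>, let \<open>x\<close> be the leading coefficient of \<open>U\<close> and \<open>y\<close> the Taylor coefficient of order \<open>N\<close>
of the defect. Then \<open>x y = 1 / N\<close>, and \<open>x - y\<close> is geometrically small; since \<open>1 / sqrt N\<close> is the
geometric mean of \<open>x\<close> and \<open>y\<close>, it is as close to \<open>y\<close>. All later coefficients are geometrically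
small by themselves.
\<close>

lemma defect_deriv_asymptotics:
  "\<exists>C\<ge>0. \<forall>n q U. n \<ge> 1 \<longrightarrow> bergman_potential n q U \<longrightarrow> defect_asymptotics C n U"
proof -
  define K where "K = 1 / (1 - \<mu> ^ 4) * (1 / (1 - \<mu>\<^sup>2))"
  have K0: "K \<ge> 0" unfolding K_def using mu_props by (intro mult_nonneg_nonneg) (auto simp: power_le_one)
  define \<rho> where "\<rho> = R / 2"
  have rho: "\<rho> > 1" using R_gt by (simp add: \<rho>_def)
  \<comment> \<open>The factor \<open>i\<^sup>3\<close> consists of the \<open>i\<close> from differentiation and an \<open>i\<^sup>2\<close> that pays for \<open>N\<^sup>2\<close>.\<close>
  define D where "D = (\<lambda>i. (real i) ^ 3 * (K / \<rho> ^ i))"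
  have sD: "summable D"
  proof -
    have "summable (\<lambda>i. real i ^ 3 * (1 / \<rho>) ^ i)"
      using rho by (intro summable_nat_power_geometric) auto
    then have "summable (\<lambda>i. K * (real i ^ 3 * (1 / \<rho>) ^ i))" by (rule summable_mult)
    then show ?thesis by (simp add: D_def power_divide mult_ac)
  qed
  define C where "C = (\<Sum>i. D i)"
  have C0: "C \<ge> 0" unfolding C_def using K0 rho by (intro suminf_nonneg sD) (auto simp: D_def)
  show ?thesis
  proof (intro exI[of _ C] conjI C0 allI impI)
    fix n q U
    assume n: "n \<ge> 1" and pot: "bergman_potential n q U"
    have dU: "degree U = Suc n" and cR: "coeff U (Suc n) \<in> \<real>" and cpos: "Re (coeff U (Suc n)) > 0"
      and zero: "\<forall>j. 1 \<le> j \<longrightarrow> j \<le> n \<longrightarrow> taylor (defect U) j = 0"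
      and norm1: "of_nat (Suc n) * taylor (defect U) (Suc n) * cnj (coeff U (Suc n)) = 1"
      and s1: "(\<lambda>i. of_nat i * (1 - m ^ (4 * i)) * v U i * cnj (v U i)) sums 1"
      using pot by (simp_all add: bergman_potential_def)
    define N where "N = Suc n"
    define x where "x = Re (coeff U N)"
    have x: "x > 0" "coeff U N = of_real x" using cpos cR by (auto simp: x_def N_def complex_is_Real_iff complex_eq_iff)
    define y where "y = 1 / (real N * x)"
    have Npos: "real N > 0" by (simp add: N_def)
    have hN: "taylor (defect U) N = of_real y"
      using norm1 x Npos unfolding N_def[symmetric] y_def by (simp add: field_simps)
    have e: "taylor (\<lambda>w. poly U (tau w)) N = of_real (x - y)"
      using defect_taylor[of U N] hN x by (simp add: algebra_simps)
    have tb: "cmod (taylor (\<lambda>w. poly U (tau w)) j) \<le> K / \<rho> ^ j" if "j \<ge> 1" for j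
      unfolding K_def \<rho>_def by (rule tau_taylor_bound[OF s1 that])
    have y0: "y > 0" using x Npos by (simp add: y_def)
    \<comment> \<open>A geometric mean lies between its two factors.\<close>
    have "\<bar>y - 1 / sqrt (real N)\<bar> \<le> \<bar>x - y\<bar>"
    proof -
      define g where "g = 1 / sqrt (real N)"
      have g: "g > 0" "g\<^sup>2 = x * y" using Npos x by (auto simp: g_def y_def power_divide)
      have "g \<le> max x y" 
      proof (rule power2_le_imp_le)
        have "x * y \<le> max x y * max x y" using x y0 by (intro mult_mono) auto
        then show "g\<^sup>2 \<le> (max x y)\<^sup>2" unfolding g by (simp add: power2_eq_square)
      qed (use x in auto)
      moreover have "min x y \<le> g"
      proof (rule power2_le_imp_le)
        have "min x y * min x y \<le> x * y" using x y0 by (intro mult_mono) auto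
        then show "(min x y)\<^sup>2 \<le> g\<^sup>2" unfolding g by (simp add: power2_eq_square)
      qed (use g in auto)
      ultimately show ?thesis unfolding g_def[symmetric] by linarith
    qed
    also have "\<dots> \<le> K / \<rho> ^ N" using tb[of N] unfolding e norm_of_real by (simp add: N_def)
    finally have ye: "\<bar>y - 1 / sqrt (real N)\<bar> \<le> K / \<rho> ^ N" .
    define d where "d = (\<lambda>i. of_nat i * taylor (defect U) i - (if i = N then of_real (sqrt (real N)) else 0))"
    have dle: "norm (d i) * real N ^ 2 \<le> D i" "i < N \<Longrightarrow> d i = 0" for i
    proof -
      show z: "d i = 0" if "i < N" using that zero by (cases "i = 0") (auto simp: d_def N_def)
      show "norm (d i) * real N ^ 2 \<le> D i"
      proof (cases "i < N")
        case True
        then show ?thesis using z K0 rho by (simp add: D_def)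
      next
        case False
        have "norm (d i) \<le> real i * (K / \<rho> ^ i)"
        proof (cases "i = N")
          case True
          have "sqrt (real N) = real N * (1 / sqrt (real N))" using Npos by (simp add: real_div_sqrt)
          then have "d i = of_real (real N * (y - 1 / sqrt (real N)))"
            using True by (simp add: d_def hN algebra_simps)
          then have "norm (d i) = real N * \<bar>y - 1 / sqrt (real N)\<bar>" by (metis norm_of_real abs_mult abs_of_nat)
          then show ?thesis using mult_left_mono[OF ye, of "real N"] True by simp
        next
          case F: False
          then have "coeff U i = 0" using False dU by (intro coeff_eq_0) (auto simp: N_def)
          then have "norm (d i) = real i * cmod (taylor (\<lambda>w. poly U (tau w)) i)"
            using F by (simp add: d_def defect_taylor norm_mult)
          then show ?thesis using mult_left_mono[OF tb[of i], of "real i"] False by (simp add: N_def)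
        qed
        moreover have "real N ^ 2 \<le> real i ^ 2" using False by (intro power_mono) auto
        ultimately have "norm (d i) * real N ^ 2 \<le> real i * (K / \<rho> ^ i) * real i ^ 2"
          using K0 rho by (intro mult_mono) auto
        then show ?thesis by (simp add: D_def eval_nat_numeral mult_ac)
      qed
    qed
    show "defect_asymptotics C n U"
      unfolding defect_asymptotics_def
    proof (intro allI impI)
    fix w :: complex assume w: "cmod w \<le> 1"
    define F where "F = deriv (defect U) w - of_real (sqrt (real N)) * w ^ n"
    have wr: "cmod w < R - 1" using w R_gt by simp
    have "(\<lambda>i. of_nat i * taylor (defect U) i * w ^ i - (if i = N then of_real (sqrt (real N)) * w ^ i else 0)) sums
       (w * deriv (defect U) w - of_real (sqrt (real N)) * w ^ N)"
      by (intro sums_diff taylor_series(3)[OF defect_holomorphic wr] sums_single)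
    moreover have "of_nat i * taylor (defect U) i * w ^ i - (if i = N then of_real (sqrt (real N)) * w ^ i else 0) = d i * w ^ i" for i
      by (simp add: d_def algebra_simps)
    moreover have "w * deriv (defect U) w - of_real (sqrt (real N)) * w ^ N = w * F"
      by (simp add: F_def N_def algebra_simps)
    ultimately have sF: "(\<lambda>i. d i * w ^ i) sums (w * F)" by (simp only:)
    have le: "norm (d i * w ^ i) \<le> D i * (cmod w ^ N / real N ^ 2)" for i
    proof (cases "i < N")
      case True then show ?thesis using dle(2) K0 rho by (simp add: D_def)
    next
      case False
      then have "cmod w ^ i \<le> cmod w ^ N" using w by (intro power_decreasing) auto
      then have "norm (d i * w ^ i) \<le> norm (d i) * cmod w ^ N"
        by (simp add: norm_mult norm_power mult_left_mono)
      also have "\<dots> = (norm (d i) * real N ^ 2) * (cmod w ^ N / real N ^ 2)" using Npos by simp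
      also have "\<dots> \<le> D i * (cmod w ^ N / real N ^ 2)" using dle(1) by (intro mult_right_mono) auto
      finally show ?thesis .
    qed
    have "cmod (w * F) \<le> (\<Sum>i. D i * (cmod w ^ N / real N ^ 2))"
      using norm_suminf_le[OF le summable_mult2[OF sD]] sF by (simp add: sums_iff)
    also have "\<dots> = C * (cmod w ^ N / real N ^ 2)" unfolding C_def by (rule suminf_mult2[OF sD, symmetric])
    finally have wF: "cmod (w * F) \<le> C * (cmod w ^ N / real N ^ 2)" .
    show "cmod (deriv (defect U) w - of_real (sqrt (real (Suc n))) * w ^ n) \<le> C / (real (Suc n))\<^sup>2 * cmod w ^ n"
      unfolding N_def[symmetric] F_def[symmetric]
    proof (cases "w = 0")
      case True
      have "deriv (defect U) 0 = 0" using zero n by (auto simp: taylor_def dest: spec[of _ 1])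
      then show "cmod F \<le> C / (real N)\<^sup>2 * cmod w ^ n" using True n C0 by (simp add: F_def zero_power)
    next
      case False
      then have "cmod w * cmod F \<le> cmod w * (C / (real N)\<^sup>2 * cmod w ^ n)"
        using wF by (simp add: norm_mult N_def mult_ac)
      then show "cmod F \<le> C / (real N)\<^sup>2 * cmod w ^ n" by (rule mult_left_le_imp_le) (use False in simp)
    qed
    qed
  qed
qed

section \<open>The series for the derivative of the potential\<close>


abbreviation \<beta> :: real where "\<beta> \<equiv> \<mu> ^ 4"
text \<open>
Positive exactly on the disc \<open>|t - 1 / R| < 1 / R\<close>. A lower bound on it gives uniform exponential decay
along the segment from the origin to \<open>t\<close>.
\<close>

definition margin :: "complex \<Rightarrow> real" where "margin t = 2 * Re t - R * (cmod t)\<^sup>2"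

definition amplitude :: "nat \<Rightarrow> complex" where
  "amplitude n = (1 - m\<^sup>2) * of_real (sqrt (real n)) * m ^ n"

text \<open>
The logarithmic derivative of \<open>lam R\<close> at the origin, up to sign.
\<close>

definition decay :: real where "decay = 1 / \<mu> - \<mu>"

lemma beta_props: "0 < \<beta>" "\<beta> < 1"
  using mu_props by (auto simp: power_less_one_iff)

lemma summable_beta: "summable (\<lambda>k. \<beta> ^ k)"
  using beta_props by (intro summable_geometric) auto

lemma one_minus_mu2: "0 < 1 - \<mu>\<^sup>2" "cmod (1 - m\<^sup>2) = 1 - \<mu>\<^sup>2"
proof -
  show "0 < 1 - \<mu>\<^sup>2" using mu_props by (simp add: power_less_one_iff)
  then have "cmod (complex_of_real (1 - \<mu>\<^sup>2)) = 1 - \<mu>\<^sup>2" unfolding norm_of_real by simp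
  then show "cmod (1 - m\<^sup>2) = 1 - \<mu>\<^sup>2" by simp
qed

lemma norm_amplitude: "cmod (amplitude n) = (1 - \<mu>\<^sup>2) * (sqrt n * \<mu> ^ n)"
  unfolding amplitude_def norm_mult one_minus_mu2 using mu_props by (simp add: norm_power)

lemma margin_le_Re: "margin t \<le> 2 * Re t"
proof -
  have "0 \<le> R * (cmod t)\<^sup>2" using R_gt by simp
  then show ?thesis unfolding margin_def by linarith
qed

lemma decay_pos: "decay > 0"
proof -
  have "\<mu> < 1" by (rule mu_props)
  then show ?thesis unfolding decay_def using inv_mu_gt_1 by linarith
qed

text \<open>
The derivative of \<open>defect U \<circ> lam R\<close> at \<open>\<beta> ^ k * t\<close>, times \<open>\<beta> ^ k\<close>, is a difference of consecutive terms of the sequence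
\<open>\<beta> ^ k V'(\<beta> ^ k t)\<close>, which tends to zero; so the series telescopes.
\<close>

lemma vlam_deriv_series:
  assumes t: "cmod t \<le> 1"
  shows "(\<lambda>k. of_real (\<beta> ^ k) * (deriv (defect U) (lam R (of_real (\<beta> ^ k) * t)) *
              ((m\<^sup>2 - 1) / (m * (of_real (\<beta> ^ k) * t) - 1)\<^sup>2))) sums deriv (vlam U) t"
proof -
  define b :: complex where "b = of_real \<beta>"
  have b4: "b = m ^ 4" by (simp add: b_def)
  have nb: "cmod b < 1" "cmod b = \<beta>" using beta_props by (simp_all add: b_def norm_power)
  have step: "deriv (defect U) (lam R s) * ((m\<^sup>2 - 1) / (m * s - 1)\<^sup>2) = deriv (vlam U) s - b * deriv (vlam U) (b * s)"
    if s: "cmod s \<le> 1" for s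
  proof -
    have s1: "cmod s < 1 / \<mu>" using s inv_mu_gt_1 by linarith
    have ms: "m * s \<noteq> 1" using s1 by (rule m_mult_ne_1)
    have "cmod (b * s) \<le> 1" using mult_mono[of "cmod b" 1 "cmod s" 1] s nb by (simp add: norm_mult)
    then have s2: "cmod (b * s) < 1 / \<mu>" using inv_mu_gt_1 by linarith
    have "cmod (lam R s) < R - 1" using norm_lam_compare(2)[OF ms] s R_gt by simp
    then have "(defect U has_field_derivative deriv (defect U) (lam R s)) (at (lam R s))"
      by (intro holomorphic_derivI[OF defect_holomorphic]) auto
    from DERIV_chain2[OF this lam_deriv[OF ms]]
    have 1: "((\<lambda>t. defect U (lam R t)) has_field_derivative deriv (defect U) (lam R s) * ((m\<^sup>2 - 1) / (m * s - 1)\<^sup>2)) (at s)" .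
    have "((\<lambda>t. b * t) has_field_derivative b) (at s)" by (auto intro!: derivative_eq_intros)
    from DERIV_diff[OF vlam_has_derivative[OF s1] DERIV_chain2[OF vlam_has_derivative[OF s2] this]]
    have 2: "((\<lambda>t. vlam U t - vlam U (b * t)) has_field_derivative deriv (vlam U) s - deriv (vlam U) (b * s) * b) (at s)" .
    have "((\<lambda>t. defect U (lam R t)) has_field_derivative deriv (vlam U) s - deriv (vlam U) (b * s) * b) (at s)"
      by (rule has_field_derivative_transform_within_open[OF 2, of "ball 0 (1 / \<mu>)"])
         (use s1 ball_inv_mu_D defect_lam b4 in auto)
    from DERIV_unique[OF 1 this] show ?thesis by (simp add: mult.commute)
  qed
  define a where "a = (\<lambda>k. b ^ k * deriv (vlam U) (b ^ k * t))"
  have b0: "(\<lambda>k. b ^ k) \<longlonglongrightarrow> 0" by (rule LIMSEQ_power_zero[OF nb(1)])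
  have "isCont (deriv (vlam U)) 0"
    using holomorphic_deriv[OF vlam_holomorphic] mu_props
    by (auto intro!: continuous_on_interior[of "ball 0 (1/\<mu>)"] holomorphic_on_imp_continuous_on)
  moreover have "(\<lambda>k. b ^ k * t) \<longlonglongrightarrow> 0" using tendsto_mult_right[OF b0, of t] by simp
  ultimately have "(\<lambda>k. deriv (vlam U) (b ^ k * t)) \<longlonglongrightarrow> deriv (vlam U) 0"
    by (rule isCont_tendsto_compose)
  from tendsto_mult[OF b0 this] have "a \<longlonglongrightarrow> 0" by (simp add: a_def)
  from telescope_sums'[OF this] have tel: "(\<lambda>k. a k - a (Suc k)) sums deriv (vlam U) t" by (simp add: a_def)
  have "a k - a (Suc k) = b ^ k * (deriv (defect U) (lam R (b ^ k * t)) * ((m\<^sup>2 - 1) / (m * (b ^ k * t) - 1)\<^sup>2))" for k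
  proof -
    have "cmod (b ^ k * t) \<le> 1"
      using mult_mono[of "cmod (b ^ k)" 1 "cmod t" 1] t nb by (simp add: norm_mult norm_power power_le_one)
    then show ?thesis by (subst step) (simp_all add: a_def algebra_simps)
  qed
  with tel show ?thesis by (simp add: b_def)
qed

lemma lam_exp_expansion: "\<exists>C\<ge>0. \<forall>s. cmod s \<le> 1 \<longrightarrow> cmod (lam R s / m - exp (- of_real decay * s)) \<le> C * cmod s ^ 2"
proof (rule holomorphic_vanishing_order_bound[OF _ inv_mu_gt_1])
  let ?f = "\<lambda>s. lam R s / m - exp (- of_real decay * s)"
  show "?f holomorphic_on ball 0 (1 / \<mu>)"
    using m_nz by (intro holomorphic_intros holomorphic_on_subset[OF lam_holomorphic]) (use ball_inv_mu_D in auto)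
  have l0: "(lam R has_field_derivative m\<^sup>2 - 1) (at 0)" using lam_deriv[of 0] by simp
  have "(?f has_field_derivative (m\<^sup>2 - 1) / m - exp (- of_real decay * 0) * (- of_real decay)) (at 0)"
    by (intro DERIV_diff DERIV_cdivide l0) (auto intro!: derivative_eq_intros)
  moreover have "(m\<^sup>2 - 1) / m - exp (- of_real decay * 0) * (- of_real decay) = 0"
    using m_nz by (simp add: decay_def field_simps power2_eq_square)
  ultimately have "(?f has_field_derivative 0) (at 0)" by (simp only:)
  then have d: "deriv ?f 0 = 0" by (rule DERIV_imp_deriv)
  fix i :: nat assume "i < 2"
  then consider "i = 0" | "i = 1" by linarith
  then show "taylor ?f i = 0"
    using d m_nz by cases (auto simp: taylor_def lam_def)
qed

lemma lam_deriv_expansion: "\<exists>C\<ge>0. \<forall>s. cmod s \<le> 1 \<longrightarrow> cmod (1 / (m * s - 1)\<^sup>2 - 1) \<le> C * cmod s ^ 1"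
proof (rule holomorphic_vanishing_order_bound[OF _ inv_mu_gt_1])
  show "(\<lambda>s. 1 / (m * s - 1)\<^sup>2 - 1) holomorphic_on ball 0 (1 / \<mu>)"
    using ball_inv_mu_D by (intro holomorphic_intros) auto
qed (simp add: taylor_def)

text \<open>
The identity behind this is
\<open>\<mu>\<^sup>2 |m s - 1|\<^sup>2 - |s - m|\<^sup>2 = \<mu>\<^sup>2 decay (2 Re s - R |s|\<^sup>2)\<close>. Its right-hand side is at least linear in
\<open>\<alpha>\<close> for \<open>s = \<alpha> t\<close> and \<open>\<alpha> \<le> 1\<close>; the factor \<open>8\<close> comes from \<open>|m s - 1|\<^sup>2 \<le> 4\<close> and a square root.
\<close>

lemma lam_decay:
  assumes d0: "0 < d0" "d0 \<le> margin t" and a: "0 \<le> \<alpha>" "\<alpha> \<le> 1"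
  shows "cmod t \<le> 1" and "cmod (lam R (of_real \<alpha> * t)) \<le> \<mu> * exp (- (decay * d0 / 8) * \<alpha>)"
proof -
  have mu: "\<mu> > 0" "\<mu> < 1" using mu_props by auto
  have "R * (cmod t)\<^sup>2 \<le> 2 * cmod t" using d0 complex_Re_le_cmod[of t] unfolding margin_def by linarith
  then have "cmod t * (R * cmod t) \<le> cmod t * 2" by (simp add: power2_eq_square mult_ac)
  then have "R * cmod t \<le> 2 \<or> cmod t = 0" by (auto simp: mult_le_cancel_left)
  then show t1: "cmod t \<le> 1"
  proof
    assume "R * cmod t \<le> 2"
    moreover have "2 * cmod t \<le> R * cmod t" using R_gt by (intro mult_right_mono) auto
    ultimately show ?thesis by linarith
  qed simp
  define s where "s = of_real \<alpha> * t"
  have s1: "cmod s \<le> 1" using mult_mono[of \<alpha> 1 "cmod t" 1] a t1 by (simp add: s_def norm_mult)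
  then have "m * s \<noteq> 1" using inv_mu_gt_1 by (intro m_mult_ne_1) linarith
  then have d: "cmod (m * s - 1) > 0" by simp
  have d2: "(cmod (m * s - 1))\<^sup>2 \<le> 4"
  proof -
    have "cmod (m * s) \<le> 1" using mult_mono[of \<mu> 1 "cmod s" 1] s1 mu by (simp add: norm_mult)
    then have "cmod (m * s - 1) \<le> 2" using norm_triangle_ineq4[of "m * s" 1] by simp
    then show ?thesis using power_mono[of "cmod (m * s - 1)" 2 2] by simp
  qed
  define X where "X = margin s"
  have "X = 2 * \<alpha> * Re t - R * \<alpha>\<^sup>2 * (cmod t)\<^sup>2" by (simp add: X_def margin_def s_def norm_mult power_mult_distrib)
  moreover have "R * \<alpha>\<^sup>2 * (cmod t)\<^sup>2 \<le> R * \<alpha> * (cmod t)\<^sup>2"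
    using a R_gt by (intro mult_right_mono mult_left_mono) (auto simp: power2_eq_square mult_left_le)
  ultimately have "X \<ge> \<alpha> * margin t" by (simp add: margin_def algebra_simps)
  moreover have "\<alpha> * margin t \<ge> \<alpha> * d0" using d0 a by (intro mult_left_mono) auto
  ultimately have X: "X \<ge> \<alpha> * d0" by linarith
  have X0: "X \<ge> 0" using X a d0 by (meson mult_nonneg_nonneg order_trans less_imp_le)
  have dm: "\<mu>\<^sup>2 * decay = \<mu> * (1 - \<mu>\<^sup>2)" using mu by (simp add: decay_def field_simps power2_eq_square)
  have mu4: "1 - \<mu> ^ 4 = (1 - \<mu>\<^sup>2) * (R * \<mu>)" unfolding mu_props(3) by (simp add: algebra_simps eval_nat_numeral)
  have "\<mu>\<^sup>2 * (cmod (m * s - 1))\<^sup>2 - (cmod (s - m))\<^sup>2 = 2 * \<mu> * (1 - \<mu>\<^sup>2) * Re s - (1 - \<mu> ^ 4) * (cmod s)\<^sup>2"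
    unfolding cmod_power2 by (simp add: algebra_simps eval_nat_numeral)
  also have "\<dots> = \<mu>\<^sup>2 * decay * X" unfolding dm mu4 X_def margin_def by (simp add: algebra_simps)
  finally have key: "(cmod (s - m))\<^sup>2 = \<mu>\<^sup>2 * ((cmod (m * s - 1))\<^sup>2 - decay * X)" by (simp add: algebra_simps)
  have "(cmod (lam R s))\<^sup>2 = (cmod (s - m))\<^sup>2 / (cmod (m * s - 1))\<^sup>2"
    by (simp add: lam_def norm_divide power_divide)
  also have "\<dots> = \<mu>\<^sup>2 * (1 - decay * X / (cmod (m * s - 1))\<^sup>2)"
    unfolding key using d by (simp add: field_simps)
  also have "\<dots> \<le> \<mu>\<^sup>2 * (1 - decay * (\<alpha> * d0) / 4)"
  proof (intro mult_left_mono diff_left_mono)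
    show "decay * (\<alpha> * d0) / 4 \<le> decay * X / (cmod (m * s - 1))\<^sup>2"
      using decay_pos X X0 d d2 by (intro frac_le mult_left_mono mult_nonneg_nonneg) auto
  qed simp
  also have "\<dots> \<le> \<mu>\<^sup>2 * exp (- (decay * (\<alpha> * d0) / 4))"
    using exp_ge_add_one_self[of "- (decay * (\<alpha> * d0) / 4)"] by (intro mult_left_mono) auto
  also have "\<dots> = (\<mu> * exp (- (decay * d0 / 8) * \<alpha>))\<^sup>2"
  proof -
    have "- (decay * (\<alpha> * d0) / 4) = 2 * (- (decay * d0 / 8) * \<alpha>)" by (simp add: field_simps)
    then show ?thesis by (simp only: exp_double power_mult_distrib)
  qed
  finally have "(cmod (lam R s))\<^sup>2 \<le> (\<mu> * exp (- (decay * d0 / 8) * \<alpha>))\<^sup>2" .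
  then show "cmod (lam R (of_real \<alpha> * t)) \<le> \<mu> * exp (- (decay * d0 / 8) * \<alpha>)"
    unfolding s_def[symmetric] by (rule power2_le_imp_le) (use mu in simp)
qed

lemma exp_decay:
  assumes d0: "0 < d0" "d0 \<le> margin t" and a: "0 \<le> \<alpha>"
  shows "cmod (exp (- of_real decay * (of_real \<alpha> * t))) \<le> exp (- (decay * d0 / 8) * \<alpha>)"
proof -
  have "d0 / 8 \<le> Re t" using d0 margin_le_Re[of t] by linarith
  then have "decay * \<alpha> * (d0 / 8) \<le> decay * \<alpha> * Re t" using decay_pos a by (intro mult_left_mono) auto
  then show ?thesis by (simp add: mult_ac)
qed

text \<open>
A term of the series for \<open>V'\<close>, at scale \<open>\<alpha> = \<beta> ^ k\<close> and without its factor \<open>\<beta> ^ k\<close>, minus the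
corresponding term of \<open>- amplitude n * chi (n t) / (n t)\<close>.
\<close>

definition term_error :: "nat \<Rightarrow> complex poly \<Rightarrow> complex \<Rightarrow> real \<Rightarrow> complex" where
  "term_error n U t \<alpha> =
     deriv (defect U) (lam R (of_real \<alpha> * t)) * ((m\<^sup>2 - 1) / (m * (of_real \<alpha> * t) - 1)\<^sup>2)
      + amplitude n * exp (- of_real decay * (of_real (real n * \<alpha>) * t))"

definition term_bound :: "real \<Rightarrow> nat \<Rightarrow> real \<Rightarrow> real" where
  "term_bound d0 n \<alpha> = sqrt n * \<mu> ^ n *
     ((real n * \<alpha>\<^sup>2 + \<alpha> + 1 / real n) * exp (- (decay * d0 / 8) * real n * \<alpha>) + 1 / (real n)\<^sup>2)"

text \<open>
Three approximations are made: the derivative of the defect is replaced by its leading power, the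
resulting power of \<open>lam R s\<close> together with the derivative of \<open>lam R\<close> is replaced by an exponential,
and \<open>sqrt (n + 1)\<close> by \<open>sqrt n\<close>. They produce, in this order, the last summand of \<open>term_bound\<close>, the
first two of its exponential part, and the third.
\<close>

lemma vlam_deriv_term_estimate:
  fixes C0 d0 :: real
  assumes C0: "C0 \<ge> 0" and d0: "0 < d0"
  shows "\<exists>C\<ge>0. \<forall>n U t \<alpha>. n \<ge> 1 \<longrightarrow> d0 \<le> margin t \<longrightarrow> 0 \<le> \<alpha> \<longrightarrow> \<alpha> \<le> 1 \<longrightarrow>
    defect_asymptotics C0 n U \<longrightarrow>
    cmod (term_error n U t \<alpha>) \<le> C * term_bound d0 n \<alpha>"
proof -
  obtain C2 where C2: "C2 \<ge> 0" "\<And>s. cmod s \<le> 1 \<Longrightarrow> cmod (lam R s / m - exp (- of_real decay * s)) \<le> C2 * cmod s ^ 2"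
    using lam_exp_expansion by blast
  obtain C1 where C1: "C1 \<ge> 0" "\<And>s. cmod s \<le> 1 \<Longrightarrow> cmod (1 / (m * s - 1)\<^sup>2 - 1) \<le> C1 * cmod s ^ 1"
    using lam_deriv_expansion by blast
  define \<delta> where "\<delta> = decay * d0 / 8"
  have dl: "\<delta> > 0" using decay_pos d0 by (simp add: \<delta>_def)
  have mu: "\<mu> > 0" "\<mu> < 1" using mu_props by auto
  define C where "C = C0 * (C1 + 1) + 2 * C1 + 2 * C2 * exp \<delta> + 1"
  have C: "C \<ge> 0" unfolding C_def using C0 C1(1) C2(1) by (intro add_nonneg_nonneg mult_nonneg_nonneg) auto
  have m2: "cmod (1 - m\<^sup>2) \<le> 1" unfolding one_minus_mu2 by simp
  show ?thesis
  proof (intro exI[of _ C] conjI C allI impI)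
    fix n :: nat and U :: "complex poly" and t :: complex and \<alpha> :: real
    assume n: "n \<ge> 1" and t: "d0 \<le> margin t" and a: "0 \<le> \<alpha>" "\<alpha> \<le> 1"
      and as: "defect_asymptotics C0 n U"
    define s where "s = of_real \<alpha> * t"
    define l where "l = lam R s"
    define E where "E = exp (- of_real decay * s)"
    define e where "e = exp (- \<delta> * \<alpha>)"
    define y where "y = exp (- \<delta> * real n * \<alpha>)"
    define L where "L = 1 / (m * s - 1)\<^sup>2"
    have t1: "cmod t \<le> 1" and le: "cmod l \<le> \<mu> * e"
      using lam_decay[OF d0 t a] by (simp_all add: l_def s_def e_def \<delta>_def)
    have Ee: "cmod E \<le> e" using exp_decay[OF d0 t a(1)] by (simp add: E_def s_def e_def \<delta>_def)
    have e0: "0 < e" "e \<le> 1" using dl a by (auto simp: e_def)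
    have y: "e ^ n = y" by (simp add: e_def y_def mult_ac flip: exp_of_nat_mult)
    have y0: "y > 0" "y \<le> 1" using dl a by (auto simp: y_def)
    \<comment> \<open>The bound for a difference of \<open>n\<close>-th powers yields the exponent \<open>n - 1\<close>; the missing
      factor is at least \<open>exp (- \<delta>)\<close>.\<close>
    have y1: "e ^ (n - 1) \<le> exp \<delta> * y"
    proof -
      have "exp (- \<delta>) \<le> e" using dl a by (simp add: e_def)
      then have "1 \<le> exp \<delta> * e" by (simp add: exp_minus field_simps)
      then have "e ^ (n - 1) * 1 \<le> e ^ (n - 1) * (exp \<delta> * e)" using e0 by (intro mult_left_mono) auto
      also have "\<dots> = exp \<delta> * e ^ n" using n by (cases n) auto
      finally show ?thesis unfolding y by simp
    qed
    have sa: "cmod s \<le> \<alpha>" using a t1 by (simp add: s_def norm_mult mult_left_le)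
    then have s1: "cmod s \<le> 1" using a by linarith
    have l1: "cmod l \<le> 1" using le mult_mono[of \<mu> 1 e 1] mu e0 by simp
    have L1: "cmod (L - 1) \<le> C1 * \<alpha>"
      using C1(2)[OF s1] mult_left_mono[OF sa C1(1)] by (simp add: L_def)
    have L2: "cmod L \<le> C1 + 1"
    proof -
      have "cmod L \<le> cmod (L - 1) + 1" using norm_triangle_ineq[of "L - 1" 1] by simp
      also have "C1 * \<alpha> \<le> C1" using C1(1) a by (simp add: mult_left_le)
      then have "cmod (L - 1) + 1 \<le> C1 + 1" using L1 by simp
      finally show ?thesis .
    qed
    have lE: "cmod (l - m * E) \<le> \<mu> * (C2 * \<alpha>\<^sup>2)"
    proof -
      have "l - m * E = m * (l / m - E)" using m_nz by (simp add: algebra_simps)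
      then have "cmod (l - m * E) = \<mu> * cmod (l / m - E)" using mu by (simp add: norm_mult)
      also have "\<dots> \<le> \<mu> * (C2 * cmod s ^ 2)"
        using C2(2)[OF s1] mu by (intro mult_left_mono) (auto simp: l_def E_def)
      also have "\<dots> \<le> \<mu> * (C2 * \<alpha>\<^sup>2)"
        using mu C2(1) sa by (intro mult_left_mono power_mono) auto
      finally show ?thesis .
    qed
    have ln: "cmod (l ^ n) \<le> \<mu> ^ n * y"
      using power_mono[OF le, of n] y by (simp add: norm_power power_mult_distrib)
    have En: "cmod (E ^ n) \<le> y" using power_mono[OF Ee, of n] y by (simp add: norm_power)
    have lEn: "cmod (l ^ n - (m * E) ^ n) \<le> \<mu> ^ n * (real n * C2 * \<alpha>\<^sup>2 * exp \<delta> * y)"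
    proof -
      have "cmod (l ^ n - (m * E) ^ n) \<le> real n * cmod (l - m * E) * (\<mu> * e) ^ (n - 1)"
        using le Ee mu e0 by (intro norm_power_diff_le) (auto simp: norm_mult)
      also have "\<dots> \<le> real n * (\<mu> * (C2 * \<alpha>\<^sup>2)) * (\<mu> * e) ^ (n - 1)"
        using lE mu e0 by (intro mult_right_mono mult_left_mono) auto
      also have "\<dots> = \<mu> ^ n * (real n * C2 * \<alpha>\<^sup>2 * e ^ (n - 1))"
        using n by (cases n) (auto simp: power_mult_distrib algebra_simps)
      also have "\<dots> \<le> \<mu> ^ n * (real n * C2 * \<alpha>\<^sup>2 * (exp \<delta> * y))"
        using y1 mu C2(1) by (intro mult_left_mono) auto
      finally show ?thesis by (simp add: mult_ac)
    qed
    define sn where "sn = sqrt (real n)"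
    define sN where "sN = sqrt (real (Suc n))"
    have sn0: "sn \<ge> 1" using n by (simp add: sn_def)
    have sN: "sN \<le> 2 * sn" "0 \<le> sN - sn" "sN - sn \<le> sn / real n"
    proof -
      have sq: "sN\<^sup>2 = real n + 1" "sn\<^sup>2 = real n" by (simp_all add: sN_def sn_def)
      show "0 \<le> sN - sn" by (simp add: sN_def sn_def)
      show "sN \<le> 2 * sn"
      proof (rule power2_le_imp_le)
        show "sN\<^sup>2 \<le> (2 * sn)\<^sup>2" unfolding power_mult_distrib sq using n by simp
      qed (use sn0 in simp)
      have "(sN - sn) * (sN + sn) = 1" using sq by (simp add: algebra_simps power2_eq_square)
      moreover have "(sN - sn) * sn \<le> (sN - sn) * (sN + sn)" using \<open>0 \<le> sN - sn\<close> sn0 by (intro mult_left_mono) auto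
      ultimately have "(sN - sn) * sn \<le> 1" by linarith
      moreover have "sn / real n = 1 / sn" using sq(2) sn0 n by (simp add: field_simps power2_eq_square)
      ultimately show "sN - sn \<le> sn / real n" using sn0 by (simp add: pos_le_divide_eq)
    qed
    \<comment> \<open>The errors of the three approximations.\<close>
    define T1 where "T1 = (deriv (defect U) l - of_real sN * l ^ n) * ((m\<^sup>2 - 1) * L)"
    define T2 where "T2 = of_real sN * (- (1 - m\<^sup>2) * (l ^ n * (L - 1) + (l ^ n - (m * E) ^ n)))"
    define T3 where "T3 = - of_real (sN - sn) * (1 - m\<^sup>2) * m ^ n * E ^ n"
    have expE: "exp (- of_real decay * (of_real (real n * \<alpha>) * t)) = E ^ n"
      unfolding E_def s_def exp_of_nat_mult[symmetric] by (simp add: mult_ac)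
    have split: "deriv (defect U) l * ((m\<^sup>2 - 1) * L) + (1 - m\<^sup>2) * of_real sn * m ^ n * E ^ n = T1 + T2 + T3"
      by (simp add: T1_def T2_def T3_def algebra_simps power_mult_distrib)
    have "cmod T1 \<le> C0 / (real (Suc n))\<^sup>2 * (cmod l ^ n) * (1 * (C1 + 1))"
      unfolding T1_def norm_mult using as[unfolded defect_asymptotics_def, rule_format, OF l1] L2 m2 C0
      by (intro mult_mono) (auto simp: sN_def norm_minus_commute)
    also have "\<dots> \<le> C0 / (real n)\<^sup>2 * \<mu> ^ n * (1 * (C1 + 1))"
    proof (intro mult_right_mono mult_mono)
      show "C0 / (real (Suc n))\<^sup>2 \<le> C0 / (real n)\<^sup>2" using n C0 by (intro divide_left_mono power_mono) auto
      have "\<mu> ^ n * y \<le> \<mu> ^ n" using mu y0 by (simp add: mult_left_le)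
      then show "cmod l ^ n \<le> \<mu> ^ n" using ln by (simp add: norm_power)
    qed (use C0 C1 in auto)
    also have "\<dots> \<le> sn * (C0 / (real n)\<^sup>2 * \<mu> ^ n * (1 * (C1 + 1)))"
      using mult_right_mono[OF sn0, of "C0 / (real n)\<^sup>2 * \<mu> ^ n * (1 * (C1 + 1))"] C0 C1(1) mu by simp
    finally have b1: "cmod T1 \<le> sn * \<mu> ^ n * (C0 * (C1 + 1) * (1 / (real n)\<^sup>2))" by (simp add: mult_ac)
    have "cmod (l ^ n * (L - 1) + (l ^ n - (m * E) ^ n)) \<le> cmod (l ^ n) * cmod (L - 1) + cmod (l ^ n - (m * E) ^ n)"
      using norm_triangle_ineq[of "l ^ n * (L - 1)"] by (simp add: norm_mult)
    also have "\<dots> \<le> (\<mu> ^ n * y) * (C1 * \<alpha>) + \<mu> ^ n * (real n * C2 * \<alpha>\<^sup>2 * exp \<delta> * y)"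
      using ln L1 lEn mu y0 by (intro add_mono mult_mono) auto
    finally have b2': "cmod (l ^ n * (L - 1) + (l ^ n - (m * E) ^ n)) \<le> \<mu> ^ n * y * (C1 * \<alpha> + C2 * exp \<delta> * (real n * \<alpha>\<^sup>2))"
      by (simp add: algebra_simps)
    have "cmod T2 \<le> (2 * sn) * (1 * (\<mu> ^ n * y * (C1 * \<alpha> + C2 * exp \<delta> * (real n * \<alpha>\<^sup>2))))"
      unfolding T2_def norm_mult using sN(1) sN(2) sn0 b2' m2
      by (intro mult_mono) (auto simp: norm_minus_commute)
    then have b2: "cmod T2 \<le> sn * \<mu> ^ n * (2 * C1 * (\<alpha> * y) + 2 * C2 * exp \<delta> * (real n * \<alpha>\<^sup>2 * y))"
      by (simp add: algebra_simps)
    have "cmod T3 \<le> (sn / real n) * 1 * \<mu> ^ n * y"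
      unfolding T3_def norm_mult norm_minus_cancel norm_of_real using sN sn0 m2 En mu
      by (intro mult_mono) (auto simp: norm_power)
    then have b3: "cmod T3 \<le> sn * \<mu> ^ n * (1 / real n * y)" by (simp add: mult_ac)
    define p where "p = real n * \<alpha>\<^sup>2 * y"
    define q where "q = \<alpha> * y"
    define r where "r = 1 / real n * y"
    define z where "z = 1 / (real n)\<^sup>2"
    have pqr: "p \<ge> 0" "q \<ge> 0" "r \<ge> 0" "z \<ge> 0" using y0 a by (auto simp: p_def q_def r_def z_def)
    have "cmod (T1 + T2 + T3) \<le> cmod T1 + cmod T2 + cmod T3"
      using norm_triangle_ineq[of "T1 + T2" T3] norm_triangle_ineq[of T1 T2] by linarith
    also have "\<dots> \<le> sn * \<mu> ^ n * (C0 * (C1 + 1) * z) + sn * \<mu> ^ n * (2 * C1 * q + 2 * C2 * exp \<delta> * p) + sn * \<mu> ^ n * r"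
      using b1 b2 b3 unfolding p_def q_def r_def z_def by linarith
    also have "\<dots> = sn * \<mu> ^ n * (C0 * (C1 + 1) * z + 2 * C1 * q + 2 * C2 * exp \<delta> * p + 1 * r)"
      by (simp add: algebra_simps)
    also have "\<dots> \<le> sn * \<mu> ^ n * (C * z + C * q + C * p + C * r)"
    proof (intro mult_left_mono add_mono mult_right_mono pqr)
      have nn: "0 \<le> C0 * (C1 + 1)" "0 \<le> 2 * C1" "0 \<le> 2 * C2 * exp \<delta>" using C0 C1(1) C2(1) by auto
      show "C0 * (C1 + 1) \<le> C" "2 * C1 \<le> C" "2 * C2 * exp \<delta> \<le> C" "1 \<le> C"
        unfolding C_def using nn by linarith+
    qed (use sn0 mu in auto)
    also have "\<dots> = C * (sn * \<mu> ^ n * ((real n * \<alpha>\<^sup>2 + \<alpha> + 1 / real n) * y + 1 / (real n)\<^sup>2))"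
      by (simp add: p_def q_def r_def z_def algebra_simps)
    finally show "cmod (term_error n U t \<alpha>) \<le> C * term_bound d0 n \<alpha>"
      unfolding split[symmetric] term_error_def term_bound_def amplitude_def expE
      by (simp add: l_def s_def L_def sn_def y_def \<delta>_def)
  qed
qed

end

section \<open>The function chi\<close>

lemma exp_minus_le_inverse_square:
  fixes y :: real assumes "y > 0" shows "exp (- y) \<le> 4 / y\<^sup>2"
proof -
  have "y / 2 \<le> exp (y / 2)" using exp_ge_add_one_self[of "y / 2"] by linarith
  then have "(y / 2)\<^sup>2 \<le> (exp (y / 2))\<^sup>2"
    using assms by (intro power_mono) auto
  also have "\<dots> = exp (2 * (y / 2))" by (rule exp_double[symmetric])
  finally have "y\<^sup>2 / 4 \<le> exp y" by (simp add: power_divide)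
  then show ?thesis using assms by (simp add: exp_minus field_simps)
qed

context bergman_region
begin

text \<open>
The part of the two-sided series in \<open>chi\<close> with nonnegative index. In \<open>chi_tail\<close> the summand \<open>k\<close>
belongs to the index \<open>- (k + 1)\<close>.
\<close>

definition chi_head :: "complex \<Rightarrow> complex" where
  "chi_head z = (\<Sum>k. of_real (\<beta> ^ k) * exp (- of_real decay * (of_real (\<beta> ^ k) * z)))"

definition chi_tail :: "complex \<Rightarrow> complex" where
  "chi_tail z = (\<Sum>k. of_real ((1 / \<beta>) ^ Suc k) * exp (- of_real decay * (of_real ((1 / \<beta>) ^ Suc k) * z)))"

lemma chi_head_term_bound:
  assumes "Re z \<ge> 0"
  shows "cmod (of_real (\<beta> ^ k) * exp (- of_real decay * (of_real (\<beta> ^ k) * z))) \<le> \<beta> ^ k"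
proof -
  have "0 \<le> decay * (\<beta> ^ k * Re z)" using decay_pos beta_props assms by (intro mult_nonneg_nonneg) auto
  then have "cmod (exp (- of_real decay * (of_real (\<beta> ^ k) * z))) \<le> 1" by simp
  then have "\<beta> ^ k * cmod (exp (- of_real decay * (of_real (\<beta> ^ k) * z))) \<le> \<beta> ^ k * 1"
    using beta_props by (intro mult_left_mono) auto
  then show ?thesis using beta_props by (simp only: norm_mult norm_of_real) simp
qed

text \<open>
The exponential beats the growing factor: \<open>g exp (- x g) \<le> 4 / (x\<^sup>2 g)\<close>. With \<open>x\<close> proportional
to \<open>n\<close> this makes the terms with \<open>k < 0\<close> of order \<open>1 / n\<^sup>2\<close>.
\<close>

lemma inverse_beta_term_bound:
  assumes x: "x > 0"
  shows "(1 / \<beta>) ^ Suc k * exp (- (x * (1 / \<beta>) ^ Suc k)) \<le> 4 / x\<^sup>2 * \<beta> ^ k"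
proof -
  define g where "g = (1 / \<beta>) ^ Suc k"
  have g: "g > 0" "1 / g = \<beta> ^ Suc k" using beta_props by (simp_all add: g_def power_one_over field_simps)
  have "g * exp (- (x * g)) \<le> g * (4 / (x * g)\<^sup>2)"
    using exp_minus_le_inverse_square[of "x * g"] x g by (intro mult_left_mono) auto
  also have "\<dots> = 4 / x\<^sup>2 * (1 / g)" using x g(1) by (simp add: power2_eq_square field_simps)
  also have "\<dots> \<le> 4 / x\<^sup>2 * \<beta> ^ k" unfolding g
    using beta_props by (intro mult_left_mono) (auto simp: mult_left_le_one_le)
  finally show ?thesis by (simp add: g_def)
qed

lemma chi_tail_term_bound:
  assumes x: "x > 0" and e: "\<And>\<alpha>. \<alpha> \<ge> 0 \<Longrightarrow> cmod (exp (- of_real decay * (of_real \<alpha> * z))) \<le> exp (- (x * \<alpha>))"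
  shows "cmod (of_real ((1 / \<beta>) ^ Suc k) * exp (- of_real decay * (of_real ((1 / \<beta>) ^ Suc k) * z))) \<le> 4 / x\<^sup>2 * \<beta> ^ k"
proof -
  define g where "g = (1 / \<beta>) ^ Suc k"
  have g: "g \<ge> 0" using beta_props by (simp add: g_def)
  have "cmod (of_real g * exp (- of_real decay * (of_real g * z))) = g * cmod (exp (- of_real decay * (of_real g * z)))"
    using g by (simp only: norm_mult norm_of_real abs_of_nonneg)
  also have "\<dots> \<le> g * exp (- (x * g))" using e[OF g] g by (intro mult_left_mono) auto
  also have "\<dots> \<le> 4 / x\<^sup>2 * \<beta> ^ k" unfolding g_def by (rule inverse_beta_term_bound[OF x])
  finally show ?thesis unfolding g_def .
qed

lemma exp_half_plane: 
  assumes "\<alpha> \<ge> 0" "r \<le> Re z"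
  shows "cmod (exp (- of_real decay * (of_real \<alpha> * z))) \<le> exp (- (decay * r * \<alpha>))"
proof -
  have "decay * \<alpha> * r \<le> decay * \<alpha> * Re z" using decay_pos assms by (intro mult_left_mono) auto
  then show ?thesis by (simp add: mult_ac)
qed

lemma chi_eq_head_tail:
  assumes z: "Re z > 0" shows "chi R z = z * (chi_head z + chi_tail z)"
proof -
  define f where "f = (\<lambda>k::int. complex_of_real (mu R powi (4 * k)) *
     exp (complex_of_real ((mu R - inverse (mu R)) * mu R powi (4 * k)) * z))"
  have x: "decay * Re z > 0" using decay_pos z by simp
  have pw: "\<mu> powi (4 * int k) = \<beta> ^ k" "\<mu> powi (4 * (- int k)) = (1 / \<beta>) ^ k" for k
  proof -
    have "\<mu> powi (int (4 * k)) = \<mu> ^ (4 * k)" by (rule power_int_of_nat)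
    then show 1: "\<mu> powi (4 * int k) = \<beta> ^ k" by (simp add: power_mult)
    have "\<mu> powi (4 * (- int k)) = inverse (\<mu> powi (4 * int k))"
      by (simp add: power_int_minus)
    then show "\<mu> powi (4 * (- int k)) = (1 / \<beta>) ^ k" unfolding 1 by (simp add: power_one_over inverse_eq_divide)
  qed
  have fpos: "f (int k) = of_real (\<beta> ^ k) * exp (- of_real decay * (of_real (\<beta> ^ k) * z))" for k
    unfolding f_def pw by (simp add: decay_def inverse_eq_divide algebra_simps)
  have fneg: "f (- int k) = of_real ((1 / \<beta>) ^ k) * exp (- of_real decay * (of_real ((1 / \<beta>) ^ k) * z))" for k
    unfolding f_def pw by (simp only: decay_def inverse_eq_divide) (simp add: algebra_simps)
  have s1: "summable (\<lambda>k. norm (f (int k)))"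
    by (rule summable_comparison_test'[OF summable_beta]) (use chi_head_term_bound[of z] z fpos in auto)
  have tb: "norm (f (- int (Suc k))) \<le> 4 / (decay * Re z)\<^sup>2 * \<beta> ^ k" for k
    unfolding fneg by (rule chi_tail_term_bound[OF x]) (rule exp_half_plane, auto)
  have s2: "summable (\<lambda>k. norm (f (- int (Suc k))))"
    by (rule summable_comparison_test'[OF summable_mult[OF summable_beta, of "4 / (decay * Re z)\<^sup>2"]])
       (simp only: real_norm_def abs_norm_cancel tb)
  have h1: "(f has_sum chi_head z) (range int)"
  proof (subst has_sum_reindex)
    show "(f \<circ> int has_sum chi_head z) UNIV"
      unfolding o_def chi_head_def fpos[symmetric]
      by (rule norm_summable_imp_has_sum[OF s1]) (use summable_norm_cancel[OF s1] summable_sums in blast)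
  qed simp
  have h2: "(f has_sum chi_tail z) (range (\<lambda>k. - int (Suc k)))"
  proof (subst has_sum_reindex)
    show "(f \<circ> (\<lambda>k. - int (Suc k)) has_sum chi_tail z) UNIV"
      unfolding o_def chi_tail_def fneg[symmetric]
      by (rule norm_summable_imp_has_sum[OF s2]) (use summable_norm_cancel[OF s2] summable_sums in blast)
  qed (auto simp: inj_on_def)
  have "range int \<inter> range (\<lambda>k. - int (Suc k)) = {}" by auto
  from has_sum_Un_disjoint[OF h1 h2 this]
  have "(f has_sum (chi_head z + chi_tail z)) (range int \<union> range (\<lambda>k. - int (Suc k)))" .
  also have "range int \<union> range (\<lambda>k. - int (Suc k)) = UNIV"
  proof (intro equalityI subsetI UNIV_I)
    fix k :: int
    show "k \<in> range int \<union> range (\<lambda>k. - int (Suc k))"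
    proof (cases k)
      case (neg n)
      then show ?thesis by blast
    qed auto
  qed
  finally have "infsum f UNIV = chi_head z + chi_tail z" by (rule infsumI)
  then show ?thesis unfolding chi_def f_def by (simp only:)
qed

lemma chi_head_summable:
  assumes "Re z \<ge> 0"
  shows "summable (\<lambda>k. of_real (\<beta> ^ k) * exp (- of_real decay * (of_real (\<beta> ^ k) * z)))"
  by (rule summable_comparison_test'[OF summable_beta chi_head_term_bound[OF assms]])

lemma chi_tail_bound:
  assumes x: "x > 0" and e: "\<And>\<alpha>. \<alpha> \<ge> 0 \<Longrightarrow> cmod (exp (- of_real decay * (of_real \<alpha> * z))) \<le> exp (- (x * \<alpha>))"
  shows "cmod (chi_tail z) \<le> 4 / x\<^sup>2 * (1 / (1 - \<beta>))"
proof -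
  have "cmod (chi_tail z) \<le> (\<Sum>k. 4 / x\<^sup>2 * \<beta> ^ k)"
    unfolding chi_tail_def by (rule norm_suminf_le[OF chi_tail_term_bound[OF x e] summable_mult[OF summable_beta]])
  also have "\<dots> = 4 / x\<^sup>2 * (1 / (1 - \<beta>))"
    using beta_props by (subst suminf_mult[OF summable_beta]) (simp add: suminf_geometric)
  finally show ?thesis .
qed

lemma series_holomorphic_half_plane:
  assumes hol: "\<And>k. f k holomorphic_on UNIV"
    and bound: "\<And>r. r > 0 \<Longrightarrow> \<exists>M. summable M \<and> (\<forall>k z. r \<le> Re z \<longrightarrow> cmod (f k z) \<le> M k)"
  shows "(\<lambda>z. \<Sum>k. f k z) holomorphic_on {z. Re z > 0}"
proof (rule holomorphic_uniform_sequence)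
  show "open {z. Re z > 0}" by (intro open_Collect_less continuous_intros)
  show "(\<lambda>z. \<Sum>k<n. f k z) holomorphic_on {z. 0 < Re z}" for n
    by (intro holomorphic_intros holomorphic_on_subset[OF hol]) auto
  fix z :: complex assume "z \<in> {z. Re z > 0}"
  then have z: "Re z / 2 > 0" by simp
  have sub: "Re z / 2 \<le> Re w" if "w \<in> cball z (Re z / 2)" for w
    using that abs_Re_le_cmod[of "z - w"] by (simp add: dist_norm)
  obtain M where M: "summable M" "\<And>k w. Re z / 2 \<le> Re w \<Longrightarrow> cmod (f k w) \<le> M k" using bound[OF z] by blast
  have "uniform_limit (cball z (Re z / 2)) (\<lambda>n w. \<Sum>k<n. f k w) (\<lambda>w. \<Sum>k. f k w) sequentially"
    by (rule Weierstrass_m_test[OF _ M(1)]) (use M(2) sub in blast)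
  then show "\<exists>d>0. cball z d \<subseteq> {z. 0 < Re z} \<and> uniform_limit (cball z d) (\<lambda>n w. \<Sum>k<n. f k w) (\<lambda>w. \<Sum>k. f k w) sequentially"
    using z sub by (intro exI[of _ "Re z / 2"]) force
qed

lemma chi_holomorphic: "chi R holomorphic_on {z. Re z > 0}"
proof (rule holomorphic_transform)
  have 1: "chi_head holomorphic_on {z. Re z > 0}" unfolding chi_head_def[abs_def]
  proof (rule series_holomorphic_half_plane)
    fix r :: real assume "r > 0"
    then show "\<exists>M. summable M \<and> (\<forall>k z. r \<le> Re z \<longrightarrow> cmod (of_real (\<beta> ^ k) * exp (- of_real decay * (of_real (\<beta> ^ k) * z))) \<le> M k)"
      using chi_head_term_bound summable_beta by (intro exI[of _ "\<lambda>k. \<beta> ^ k"]) (meson less_imp_le order_trans)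
  qed (intro holomorphic_intros)
  have 2: "chi_tail holomorphic_on {z. Re z > 0}" unfolding chi_tail_def[abs_def]
  proof (rule series_holomorphic_half_plane)
    fix r :: real assume r: "r > 0"
    then have dr: "decay * r > 0" using decay_pos by simp
    show "\<exists>M. summable M \<and> (\<forall>k z. r \<le> Re z \<longrightarrow> cmod (of_real ((1 / \<beta>) ^ Suc k) * exp (- of_real decay * (of_real ((1 / \<beta>) ^ Suc k) * z))) \<le> M k)"
    proof (intro exI[of _ "\<lambda>k. 4 / (decay * r)\<^sup>2 * \<beta> ^ k"] conjI allI impI)
      show "summable (\<lambda>k. 4 / (decay * r)\<^sup>2 * \<beta> ^ k)" by (rule summable_mult[OF summable_beta])
      fix k z assume "r \<le> Re z"
      then show "cmod (of_real ((1 / \<beta>) ^ Suc k) * exp (- of_real decay * (of_real ((1 / \<beta>) ^ Suc k) * z))) \<le> 4 / (decay * r)\<^sup>2 * \<beta> ^ k"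
        by (intro chi_tail_term_bound[OF dr] exp_half_plane)
    qed
  qed (intro holomorphic_intros)
  show "(\<lambda>z. z * (chi_head z + chi_tail z)) holomorphic_on {z. Re z > 0}"
    by (intro holomorphic_intros 1 2)
qed (simp add: chi_eq_head_tail)

section \<open>Uniform asymptotics of the derivative of the potential\<close>

text \<open>
Summation of \<open>term_bound\<close> over the scales \<open>\<alpha> = \<beta> ^ k\<close> with weights \<open>\<beta> ^ k\<close>: the summands
\<open>n \<alpha>\<^sup>2\<close>, \<open>\<alpha>\<close>, \<open>1 / n\<close> and \<open>1 / n\<^sup>2\<close> all contribute the order \<open>1 / n\<^sup>2\<close>.
\<close>

lemma vlam_deriv_head_estimate:
  fixes C0 d0 :: real
  assumes C0: "C0 \<ge> 0" and d0: "0 < d0"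
  shows "\<exists>C\<ge>0. \<forall>n U t. n \<ge> 1 \<longrightarrow> d0 \<le> margin t \<longrightarrow>
    defect_asymptotics C0 n U \<longrightarrow>
    cmod (deriv (vlam U) t + amplitude n * chi_head (of_nat n * t))
    \<le> C * (sqrt n * \<mu> ^ n / (real n)\<^sup>2)"
proof -
  obtain C where C: "C \<ge> 0" and est: "\<And>n U t \<alpha>. n \<ge> 1 \<Longrightarrow> d0 \<le> margin t \<Longrightarrow> 0 \<le> \<alpha> \<Longrightarrow> \<alpha> \<le> 1 \<Longrightarrow>
    defect_asymptotics C0 n U \<Longrightarrow>
    cmod (term_error n U t \<alpha>) \<le> C * term_bound d0 n \<alpha>"
    using vlam_deriv_term_estimate[OF assms] by meson
  define \<delta> where "\<delta> = decay * d0 / 8"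
  have dl: "\<delta> > 0" using decay_pos d0 by (simp add: \<delta>_def)
  define C' where "C' = C * ((27 / \<delta> ^ 3 + 4 / \<delta> ^ 2 + 1 / \<delta> + 1) / (1 - \<beta>))"
  have C': "C' \<ge> 0" unfolding C'_def using C dl beta_props
    by (intro mult_nonneg_nonneg divide_nonneg_nonneg add_nonneg_nonneg) auto
  show ?thesis
  proof (intro exI[of _ C'] conjI C' allI impI)
    fix n :: nat and U t
    assume n: "n \<ge> 1" and t: "d0 \<le> margin t"
      and as: "defect_asymptotics C0 n U"
    have t1: "cmod t \<le> 1" using lam_decay(1)[OF d0 t, of 0] by simp
    have Ret: "Re t \<ge> 0" using t d0 margin_le_Re[of t] by linarith
    define X where "X k = deriv (defect U) (lam R (of_real (\<beta> ^ k) * t)) * ((m\<^sup>2 - 1) / (m * (of_real (\<beta> ^ k) * t) - 1)\<^sup>2)" for k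
    define Y where "Y k = exp (- of_real decay * (of_real (\<beta> ^ k) * (of_nat n * t)))" for k
    define c where "c = amplitude n"
    define P where "P = sqrt n * \<mu> ^ n"
    have P0: "P \<ge> 0" using mu_props by (simp add: P_def)
    have sX: "(\<lambda>k. of_real (\<beta> ^ k) * X k) sums deriv (vlam U) t"
      unfolding X_def by (rule vlam_deriv_series[OF t1])
    have sY: "(\<lambda>k. of_real (\<beta> ^ k) * Y k) sums chi_head (of_nat n * t)"
      unfolding chi_head_def Y_def using Ret by (intro summable_sums chi_head_summable) simp
    have sXY: "(\<lambda>k. of_real (\<beta> ^ k) * X k + c * (of_real (\<beta> ^ k) * Y k)) sums (deriv (vlam U) t + c * chi_head (of_nat n * t))"
      by (intro sums_add sums_mult sX sY)
    define e where "e k = exp (- (\<delta> * real n) * \<beta> ^ k)" for k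
    define S where "S p k = \<beta> ^ k * ((\<beta> ^ k) ^ p * e k)" for p k
    define M where "M k = C * P * (real n * S 2 k + S 1 k + 1 / real n * S 0 k + 1 / (real n)\<^sup>2 * \<beta> ^ k)" for k
    have a: "\<delta> * real n > 0" using dl n by simp
    have Ssum: "summable (S p)" "suminf (S p) \<le> real (Suc p) ^ Suc p / ((1 - \<beta>) * (\<delta> * real n) ^ Suc p)" for p
      unfolding S_def[abs_def] e_def by (rule suminf_geometric_power_exp[OF beta_props a])+
    have inner_summable: "summable (\<lambda>k. real n * S 2 k + S 1 k + 1 / real n * S 0 k + 1 / (real n)\<^sup>2 * \<beta> ^ k)"
      by (intro summable_add summable_mult Ssum(1) summable_beta)
    have bound: "cmod (of_real (\<beta> ^ k) * X k + c * (of_real (\<beta> ^ k) * Y k)) \<le> M k" for k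
    proof -
      have bk: "0 \<le> \<beta> ^ k" "\<beta> ^ k \<le> 1" using beta_props by (auto simp: power_le_one)
      have Yk: "Y k = exp (- of_real decay * (of_real (real n * \<beta> ^ k) * t))" by (simp add: Y_def mult_ac)
      have "cmod (of_real (\<beta> ^ k) * X k + c * (of_real (\<beta> ^ k) * Y k)) = cmod (of_real (\<beta> ^ k) * (X k + c * Y k))"
        by (simp add: algebra_simps)
      also have "\<dots> = \<beta> ^ k * cmod (X k + c * Y k)" using bk by (simp only: norm_mult norm_of_real abs_of_nonneg)
      also have "\<dots> \<le> \<beta> ^ k * (C * (P * ((real n * (\<beta> ^ k)\<^sup>2 + \<beta> ^ k + 1 / real n) * e k + 1 / (real n)\<^sup>2)))"
        using est[OF n t bk as] bk
        unfolding term_error_def term_bound_def X_def Yk c_def P_def e_def \<delta>_def[symmetric]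
        by (intro mult_left_mono) (simp_all add: mult.assoc)
      also have "\<dots> = M k" by (simp add: M_def S_def algebra_simps)
      finally show ?thesis .
    qed
    have "cmod (deriv (vlam U) t + c * chi_head (of_nat n * t)) \<le> (\<Sum>k. M k)"
    proof -
      have "summable M" unfolding M_def by (intro summable_mult inner_summable)
      from norm_suminf_le[OF bound this] show ?thesis using sXY by (simp add: sums_iff)
    qed
    also have "(\<Sum>k. M k) = C * P * (real n * (\<Sum>k. S 2 k) + (\<Sum>k. S 1 k) + 1 / real n * (\<Sum>k. S 0 k) + 1 / (real n)\<^sup>2 * (\<Sum>k. \<beta> ^ k))"
    proof -
      have "(\<lambda>k. real n * S 2 k + S 1 k + 1 / real n * S 0 k + 1 / (real n)\<^sup>2 * \<beta> ^ k) sums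
         (real n * (\<Sum>k. S 2 k) + (\<Sum>k. S 1 k) + 1 / real n * (\<Sum>k. S 0 k) + 1 / (real n)\<^sup>2 * (\<Sum>k. \<beta> ^ k))"
        by (intro sums_add sums_mult summable_sums Ssum(1) summable_beta)
      from sums_mult[OF this, of "C * P"] show ?thesis unfolding M_def by (simp add: sums_iff)
    qed
    also have "\<dots> \<le> C * P * (real n * (27 / ((1 - \<beta>) * (\<delta> * real n) ^ 3)) + 4 / ((1 - \<beta>) * (\<delta> * real n) ^ 2)
        + 1 / real n * (1 / ((1 - \<beta>) * (\<delta> * real n))) + 1 / (real n)\<^sup>2 * (1 / (1 - \<beta>)))"
    proof (intro mult_left_mono add_mono)
      show "(\<Sum>k. S 2 k) \<le> 27 / ((1 - \<beta>) * (\<delta> * real n) ^ 3)"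
        using Ssum(2)[of 2] by (simp add: numeral_3_eq_3)
      show "(\<Sum>k. S 1 k) \<le> 4 / ((1 - \<beta>) * (\<delta> * real n) ^ 2)"
        using Ssum(2)[of 1] by (simp add: numeral_2_eq_2)
      show "(\<Sum>k. S 0 k) \<le> 1 / ((1 - \<beta>) * (\<delta> * real n))"
        using Ssum(2)[of 0] by simp
      show "(\<Sum>k. \<beta> ^ k) \<le> 1 / (1 - \<beta>)" using beta_props by (simp add: suminf_geometric)
    qed (use C P0 in auto)
    also have "\<dots> = C' * (P / (real n)\<^sup>2)"
    proof -
      define q where "q = 1 - \<beta>"
      define D where "D = 1 / (q * (real n)\<^sup>2)"
      have nz: "q \<noteq> 0" "real n \<noteq> 0" "\<delta> \<noteq> 0" using dl n beta_props by (auto simp: q_def)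
      have e: "real n * (27 / (q * (\<delta> * real n) ^ 3)) = 27 / \<delta> ^ 3 * D"
        "4 / (q * (\<delta> * real n) ^ 2) = 4 / \<delta> ^ 2 * D"
        "1 / real n * (1 / (q * (\<delta> * real n))) = 1 / \<delta> * D"
        "1 / (real n)\<^sup>2 * (1 / q) = 1 * D"
        using nz by (simp_all add: D_def field_simps power2_eq_square power3_eq_cube)
      have "C * ((27 / \<delta> ^ 3 + 4 / \<delta> ^ 2 + 1 / \<delta> + 1) / q) * (P / (real n)\<^sup>2) =
          C * P * ((27 / \<delta> ^ 3 + 4 / \<delta> ^ 2 + 1 / \<delta> + 1) * D)"
        by (simp add: D_def)
      then show ?thesis unfolding C'_def q_def[symmetric] e by (simp only: distrib_right)
    qed
    finally show "cmod (deriv (vlam U) t + amplitude n * chi_head (of_nat n * t))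
    \<le> C' * (sqrt n * \<mu> ^ n / (real n)\<^sup>2)" unfolding c_def P_def .
  qed
qed

lemma vlam_deriv_chi_estimate:
  fixes C0 d0 :: real
  assumes C0: "C0 \<ge> 0" and d0: "0 < d0"
  shows "\<exists>C\<ge>0. \<forall>n U t. n \<ge> 1 \<longrightarrow> d0 \<le> margin t \<longrightarrow>
    defect_asymptotics C0 n U \<longrightarrow>
    cmod (deriv (vlam U) t + amplitude n * (chi R (of_nat n * t) / (of_nat n * t)))
    \<le> C * (sqrt n * \<mu> ^ n / (real n)\<^sup>2)"
proof -
  obtain C where C: "C \<ge> 0" and est: "\<And>n U t. n \<ge> 1 \<Longrightarrow> d0 \<le> margin t \<Longrightarrow>
    defect_asymptotics C0 n U \<Longrightarrow>
    cmod (deriv (vlam U) t + amplitude n * chi_head (of_nat n * t))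
    \<le> C * (sqrt n * \<mu> ^ n / (real n)\<^sup>2)"
    using vlam_deriv_head_estimate[OF assms] by meson
  define \<delta> where "\<delta> = decay * d0 / 8"
  have dl: "\<delta> > 0" using decay_pos d0 by (simp add: \<delta>_def)
  define B where "B = 4 / \<delta>\<^sup>2 * (1 / (1 - \<beta>))"
  have B: "B \<ge> 0" using beta_props by (simp add: B_def)
  show ?thesis
  proof (intro exI[of _ "C + B"] conjI allI impI)
    show "0 \<le> C + B" using C B by simp
    fix n :: nat and U t
    assume n: "n \<ge> 1" and t: "d0 \<le> margin t"
      and as: "defect_asymptotics C0 n U"
    define z where "z = of_nat n * t"
    define c where "c = amplitude n"
    have Ret: "Re t > 0" using t d0 margin_le_Re[of t] by linarith
    have zp: "Re z > 0" using Ret n by (simp add: z_def)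
    then have "z \<noteq> 0" by auto
    then have chi: "chi R z / z = chi_head z + chi_tail z" using chi_eq_head_tail[OF zp] by simp
    have x: "\<delta> * real n > 0" using dl n by simp
    have "cmod (chi_tail z) \<le> 4 / (\<delta> * real n)\<^sup>2 * (1 / (1 - \<beta>))"
    proof (rule chi_tail_bound[OF x])
      fix \<alpha> :: real assume "\<alpha> \<ge> 0"
      then have "0 \<le> real n * \<alpha>" by simp
      from exp_decay[OF d0 t this]
      show "cmod (exp (- of_real decay * (of_real \<alpha> * z))) \<le> exp (- (\<delta> * real n * \<alpha>))"
        by (simp add: z_def \<delta>_def mult_ac)
    qed
    also have "\<dots> = B / (real n)\<^sup>2" by (simp add: B_def power_mult_distrib)
    finally have tail: "cmod (chi_tail z) \<le> B / (real n)\<^sup>2" .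
    have cn: "cmod c \<le> sqrt n * \<mu> ^ n"
    proof -
      have "cmod c = (1 - \<mu>\<^sup>2) * (sqrt n * \<mu> ^ n)" unfolding c_def by (rule norm_amplitude)
      also have "\<dots> \<le> 1 * (sqrt n * \<mu> ^ n)" using mu_props by (intro mult_right_mono) auto
      finally show ?thesis by simp
    qed
    have "deriv (vlam U) t + c * (chi R z / z) = (deriv (vlam U) t + c * chi_head z) + c * chi_tail z"
      unfolding chi by (simp add: algebra_simps)
    also have "cmod \<dots> \<le> cmod (deriv (vlam U) t + c * chi_head z) + cmod c * cmod (chi_tail z)"
      using norm_triangle_ineq[of "deriv (vlam U) t + c * chi_head z" "c * chi_tail z"] by (simp add: norm_mult)
    also have "\<dots> \<le> C * (sqrt n * \<mu> ^ n / (real n)\<^sup>2) + (sqrt n * \<mu> ^ n) * (B / (real n)\<^sup>2)"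
      using est[OF n t as] cn tail mu_props unfolding c_def z_def
      by (intro add_mono mult_mono) auto
    also have "\<dots> = (C + B) * (sqrt n * \<mu> ^ n / (real n)\<^sup>2)" by (simp add: distrib_right add_divide_distrib mult_ac)
    finally show "cmod (deriv (vlam U) t + amplitude n * (chi R (of_nat n * t) / (of_nat n * t)))
      \<le> (C + B) * (sqrt n * \<mu> ^ n / (real n)\<^sup>2)" unfolding c_def z_def .
  qed
qed

section \<open>The domain and the asymptotic formula\<close>


lemma domain_D_iff:
  "t \<in> domain_D R \<longleftrightarrow> 0 < margin t \<and> R * \<mu>\<^sup>2 / 2 < Re t"
proof -
  have e: "(cmod (t - of_real (1 / R)))\<^sup>2 = (cmod t)\<^sup>2 - 2 * Re t / R + (1 / R)\<^sup>2"
    unfolding cmod_power2 by (simp add: power2_eq_square algebra_simps add_divide_distrib)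
  have "cmod (t - of_real (1 / R)) < 1 / R \<longleftrightarrow> (cmod (t - of_real (1 / R)))\<^sup>2 < (1 / R)\<^sup>2"
    using R_gt by (simp add: not_le[symmetric] abs_le_square_iff[symmetric])
  also have "\<dots> \<longleftrightarrow> (cmod t)\<^sup>2 < 2 * Re t / R" unfolding e by linarith
  also have "\<dots> \<longleftrightarrow> 0 < margin t"
    using R_gt by (simp add: margin_def field_simps)
  finally show ?thesis by (auto simp: domain_D_def)
qed

lemma open_domain_D: "open (domain_D R)"
  unfolding domain_D_def by (intro open_Collect_conj open_Collect_less continuous_intros)

lemma domain_D_props:
  assumes t: "t \<in> domain_D R"
  shows "Re t > 0" "t \<noteq> 0" "cmod t < 1" "\<mu> ^ 3 < cmod t" "t \<in> ann" "t \<noteq> - m" "1 - m * t \<noteq> 0" "1 - m ^ 3 / t \<noteq> 0"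
proof -
  have mu: "0 < \<mu>" "\<mu> < 1" using mu_props by auto
  have 1: "0 < margin t" "R * \<mu>\<^sup>2 / 2 < Re t" using t domain_D_iff by auto
  have "0 \<le> R * \<mu>\<^sup>2 / 2" using R_gt by simp
  then show re: "Re t > 0" using 1 by linarith
  then show t0: "t \<noteq> 0" by auto
  then have tp: "cmod t > 0" by simp
  have "R * (cmod t)\<^sup>2 < 2 * cmod t" using 1 complex_Re_le_cmod[of t] unfolding margin_def by linarith
  then have "cmod t * (R * cmod t) < cmod t * 2" by (simp add: power2_eq_square mult_ac)
  then have "R * cmod t < 2" using tp by (simp add: mult_less_cancel_left)
  moreover have "2 * cmod t < R * cmod t" using R_gt tp by simp
  ultimately show t1: "cmod t < 1" by linarith
  have "R * \<mu>\<^sup>2 = \<mu> * (\<mu>\<^sup>2 + 1)" unfolding mu_props(3)[symmetric] by (simp add: power2_eq_square mult_ac)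
  also have "\<dots> > 2 * \<mu> ^ 3"
  proof -
    have "\<mu>\<^sup>2 < 1" using mu by (simp add: power_less_one_iff)
    then have "\<mu> * (\<mu>\<^sup>2 + 1) > \<mu> * (2 * \<mu>\<^sup>2)" using mu by (intro mult_strict_left_mono) auto
    then show ?thesis by (simp add: power3_eq_cube power2_eq_square mult_ac)
  qed
  finally have "\<mu> ^ 3 < Re t" using 1 by linarith
  then show m3: "\<mu> ^ 3 < cmod t" using complex_Re_le_cmod[of t] by linarith
  show ann: "t \<in> ann" using m3 t1 inv_mu_gt_1 unfolding ann_def by simp
  show "t \<noteq> - m" using re mu by auto
  show "1 - m * t \<noteq> 0" "1 - m ^ 3 / t \<noteq> 0" using ann_D[OF ann] by (auto simp: field_simps)
qed

text \<open>
The two conditions that define the domain are exchanged by the involution: each of them says that \<open>t\<close>,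
respectively \<open>m\<^sup>2 / t\<close>, has positive margin.
\<close>

lemma involution_domain_D:
  assumes t: "t \<in> domain_D R" shows "m\<^sup>2 / t \<in> domain_D R"
proof -
  have mu: "0 < \<mu>" "\<mu> < 1" using mu_props by auto
  have t0: "cmod t > 0" using domain_D_props(2)[OF t] by simp
  have 1: "0 < margin t" "R * \<mu>\<^sup>2 / 2 < Re t" using t domain_D_iff by auto
  have re: "Re (m\<^sup>2 / t) = \<mu>\<^sup>2 * Re t / (cmod t)\<^sup>2"
    by (simp add: Re_divide cmod_power2 flip: of_real_power)
  have cm: "(cmod (m\<^sup>2 / t))\<^sup>2 = \<mu> ^ 4 / (cmod t)\<^sup>2"
    using mu by (simp add: norm_divide norm_power power_divide flip: power_mult)
  have "margin (m\<^sup>2 / t) = \<mu>\<^sup>2 * (2 * Re t - R * \<mu>\<^sup>2) / (cmod t)\<^sup>2"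
    unfolding margin_def re cm using t0 by (simp add: field_simps eval_nat_numeral)
  moreover have "\<dots> > 0" using 1 mu t0 by (intro divide_pos_pos mult_pos_pos) auto
  moreover have "Re (m\<^sup>2 / t) - R * \<mu>\<^sup>2 / 2 = \<mu>\<^sup>2 * margin t / (2 * (cmod t)\<^sup>2)"
    unfolding margin_def re using t0 by (simp add: field_simps)
  moreover have "\<dots> > 0" using 1 mu t0 by (intro divide_pos_pos mult_pos_pos) auto
  ultimately show ?thesis unfolding domain_D_iff by linarith
qed

lemma m_in_domain_D: "m \<in> domain_D R"
proof -
  have mu: "0 < \<mu>" "\<mu> < 1" using mu_props by auto
  have "R * \<mu>\<^sup>2 = \<mu> * (\<mu>\<^sup>2 + 1)" unfolding mu_props(3)[symmetric] by (simp add: power2_eq_square mult_ac)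
  moreover have "\<mu> * (\<mu>\<^sup>2 + 1) < \<mu> * 2" using mu by (intro mult_strict_left_mono) (auto simp: power_less_one_iff)
  ultimately show ?thesis unfolding domain_D_iff margin_def by simp
qed

text \<open>
This is where the explicit prefactor of the theorem comes from; \<open>h\<close> has its critical points at
\<open>m\<close> and \<open>- m\<close>, the fixed points of the involution.
\<close>

lemma deriv_h:
  assumes t: "t \<in> ann"
  shows "t * deriv h t * ((1 - m * t)\<^sup>2 * (1 - m ^ 3 / t)\<^sup>2) = - (of_real R * (1 - m\<^sup>2) * (1 - m ^ 4) * (t - m\<^sup>2 / t))"
proof -
  note nz = ann_D[OF t]
  define a b where "a = m * t - 1" and "b = t - m ^ 3"
  have ab: "a \<noteq> 0" "b \<noteq> 0" using nz by (auto simp: a_def b_def)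
  have u: "u t = b / (m * a)" by (simp add: u_def a_def b_def)
  have "(u has_field_derivative (1 * (m * (m * t - 1)) - (t - m ^ 3) * (m * m)) / (m * (m * t - 1)) ^ 2) (at t)"
    unfolding u_def[abs_def] using ab m_nz
    by (auto intro!: derivative_eq_intros simp: a_def power2_eq_square)
  moreover have "1 * (m * (m * t - 1)) - (t - m ^ 3) * (m * m) = - (m * (1 - m ^ 4))"
    by (simp add: algebra_simps eval_nat_numeral)
  ultimately have du: "(u has_field_derivative (- (m * (1 - m ^ 4)) / (m * a) ^ 2)) (at t)"
    by (simp add: a_def)
  have "(joukowski has_field_derivative (1 - 1 / (u t)\<^sup>2)) (at (u t))"
    unfolding joukowski_def[abs_def] using u_nz[OF t]
    by (auto intro!: derivative_eq_intros simp: power2_eq_square)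
  from DERIV_chain2[OF this du]
  have "((\<lambda>t. joukowski (u t)) has_field_derivative (1 - 1 / (u t)\<^sup>2) * (- (m * (1 - m ^ 4)) / (m * a) ^ 2)) (at t)" .
  then have "(h has_field_derivative (1 - 1 / (u t)\<^sup>2) * (- (m * (1 - m ^ 4)) / (m * a) ^ 2)) (at t)"
    by (rule has_field_derivative_transform_within_open[OF _ open_ann t]) (use ann_D in \<open>simp add: h_eq_joukowski\<close>)
  then have dh: "deriv h t = (1 - 1 / (u t)\<^sup>2) * (- (m * (1 - m ^ 4)) / (m * a) ^ 2)" by (rule DERIV_imp_deriv)
  also have "1 - 1 / (u t)\<^sup>2 = (b\<^sup>2 - (m * a)\<^sup>2) / b\<^sup>2"
    unfolding u using ab m_nz by (simp add: power_divide diff_divide_distrib)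
  also have "b\<^sup>2 - (m * a)\<^sup>2 = (1 - m ^ 4) * (t\<^sup>2 - m\<^sup>2)"
    by (simp add: a_def b_def algebra_simps eval_nat_numeral)
  finally have dh': "deriv h t = (1 - m ^ 4) * (t\<^sup>2 - m\<^sup>2) / b\<^sup>2 * (- (m * (1 - m ^ 4)) / (m * a)\<^sup>2)" .
  have Rm: "of_real R * m = m\<^sup>2 + 1" using mu_props(3) by (metis of_real_1 of_real_add of_real_mult of_real_power)
  have w: "(1 - m * t)\<^sup>2 * (1 - m ^ 3 / t)\<^sup>2 = a\<^sup>2 * b\<^sup>2 / t\<^sup>2"
  proof -
    have "1 - m ^ 3 / t = b / t" using nz by (simp add: b_def field_simps)
    moreover have "(1 - m * t)\<^sup>2 = a\<^sup>2" by (simp add: a_def power2_commute)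
    ultimately show ?thesis by (simp add: power_divide)
  qed
  have "t * deriv h t * ((1 - m * t)\<^sup>2 * (1 - m ^ 3 / t)\<^sup>2) = - ((1 - m ^ 4) * (1 - m ^ 4) * (t\<^sup>2 - m\<^sup>2)) / (m * t)"
    unfolding w dh' using ab m_nz nz by (simp add: field_simps power2_eq_square)
  also have "(1 - m ^ 4) * (1 - m ^ 4) = (1 - m ^ 4) * ((1 - m\<^sup>2) * (of_real R * m))"
    unfolding Rm by (simp add: algebra_simps eval_nat_numeral)
  also have "- ((1 - m ^ 4) * ((1 - m\<^sup>2) * (of_real R * m)) * (t\<^sup>2 - m\<^sup>2)) / (m * t) =
      - (of_real R * (1 - m\<^sup>2) * (1 - m ^ 4) * (t - m\<^sup>2 / t))"
    using m_nz nz by (simp add: field_simps power2_eq_square)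
  finally show ?thesis .
qed

end

theorem theorem1p3:
  fixes R :: real and p :: "nat \<Rightarrow> complex poly"
  assumes "R > 2"
    and "area_orthonormal_polys (region_G1 R) p"
  shows "let m = complex_of_real (mu R) in
    \<exists>E :: nat \<Rightarrow> complex \<Rightarrow> complex.
      bigo_locally_uniformly (domain_D R) E (\<lambda>n. 1 / real n) \<and>
      (\<forall>n\<ge>1. \<forall>t\<in>domain_D R.
         calP R p n t =
           m ^ n / complex_of_real (sqrt (real n)) *
           ((1 - m * t)\<^sup>2 * (1 - m ^ 3 / t)\<^sup>2 / ((1 - m ^ 4) * complex_of_real R)) *
           (chi_quot R n t + E n t))"
proof -
  interpret bergman_region R by unfold_locales (rule assms(1))
  let ?D = "domain_D R"
  define W where "W t = (1 - m * t)\<^sup>2 * (1 - m ^ 3 / t)\<^sup>2" for t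
  define pref where "pref n t = m ^ n / complex_of_real (sqrt (real n)) * (W t / ((1 - m ^ 4) * complex_of_real R))" for n t
  \<comment> \<open>\<open>E\<close> is defined by the asymptotic formula. \<open>L\<close> is the error after multiplication by the denominator
    \<open>t - m\<^sup>2 / t\<close>: it is holomorphic and vanishes at \<open>m\<close>. \<open>G\<close> is its difference quotient at \<open>m\<close>.\<close>
  define P where "P n t = calP R p n t / pref n t" for n t
  define X where "X n t = chi R (of_nat n * t) - chi R (of_nat n * m\<^sup>2 / t)" for n t
  define L where "L n t = P n t * (t - m\<^sup>2 / t) - X n t" for n t
  define E where "E n t = P n t - chi_quot R n t" for n t
  define G where "G n t = (if t = m then deriv (L n) m else (L n t - L n m) / (t - m))" for n t
  have mD: "m \<in> ?D" by (rule m_in_domain_D)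
  have m4: "1 - m ^ 4 \<noteq> 0"
  proof -
    have "1 - m ^ 4 = complex_of_real (1 - \<mu> ^ 4)" by simp
    then show ?thesis using beta_props by (metis diff_gt_0_iff_gt less_irrefl of_real_eq_0_iff)
  qed
  have m2: "1 - m\<^sup>2 \<noteq> 0" using m4 by (auto simp: power4_eq_xxxx power2_eq_square)
  have R0: "complex_of_real R \<noteq> 0" using assms(1) by simp
  have pref0: "pref n t \<noteq> 0" if "n \<ge> 1" "t \<in> ?D" for n t
    using domain_D_props[OF that(2)] that(1) m_nz m4 R0 by (simp add: pref_def W_def)
  have calP_h: "calP R p n t = poly (p n) (h t)" for n t by (simp add: calP_def h_def)
  have Dann: "?D \<subseteq> ann" using domain_D_props by blast
  have holP: "P n holomorphic_on ?D" if n: "n \<ge> 1" for n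
    unfolding P_def[abs_def] calP_h pref_def W_def
    using pref0[OF n] domain_D_props
    by (intro holomorphic_intros holomorphic_poly_compose holomorphic_on_subset[OF h_holomorphic Dann])
       (auto simp: pref_def W_def)
  have holX: "X n holomorphic_on ?D" if n: "n \<ge> 1" for n
  proof -
    have "(\<lambda>t. chi R (of_nat n * t)) holomorphic_on ?D"
      by (rule holomorphic_on_compose_gen[OF _ chi_holomorphic, unfolded o_def])
         (use n domain_D_props in \<open>auto intro!: holomorphic_intros\<close>)
    moreover have "(\<lambda>t. chi R (of_nat n * m\<^sup>2 / t)) holomorphic_on ?D"
    proof (rule holomorphic_on_compose_gen[OF _ chi_holomorphic, unfolded o_def])
      show "(\<lambda>t. of_nat n * m\<^sup>2 / t) holomorphic_on ?D"
        using domain_D_props by (intro holomorphic_intros) auto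
      show "(\<lambda>t. of_nat n * m\<^sup>2 / t) ` ?D \<subseteq> {z. 0 < Re z}"
      proof clarify
        fix t assume "t \<in> ?D"
        then have "Re (m\<^sup>2 / t) > 0" using involution_domain_D domain_D_props(1) by blast
        moreover have "Re (of_nat n * w) > 0" if "Re w > 0" for w using that n by simp
        ultimately have "Re (of_nat n * (m\<^sup>2 / t)) > 0" by blast
        then show "0 < Re (of_nat n * m\<^sup>2 / t)" by simp
      qed
    qed
    ultimately show ?thesis unfolding X_def[abs_def] by (intro holomorphic_intros)
  qed
  have holL: "L n holomorphic_on ?D" if n: "n \<ge> 1" for n
    unfolding L_def[abs_def] using domain_D_props by (intro holomorphic_intros holP holX n) auto
  have Lm: "L n m = 0" for n
    using m_nz by (simp add: L_def X_def power2_eq_square)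
  have fac: "t - m\<^sup>2 / t = (t - m) * ((t + m) / t)" if "t \<noteq> 0" for t
    using that by (simp add: field_simps power2_eq_square)
  have tm: "t + m \<noteq> 0" if "t \<in> ?D" for t
    using domain_D_props(6)[OF that] by (metis add_eq_0_iff2)
  have EG: "E n t = t / (t + m) * G n t" if n: "n \<ge> 1" and t: "t \<in> ?D" for n t
  proof (cases "t = m")
    case False
    have t0: "t \<noteq> 0" using domain_D_props t by blast
    have "chi_quot R n t = X n t / (t - m\<^sup>2 / t)" using False by (simp add: chi_quot_def X_def Let_def)
    moreover have "t - m\<^sup>2 / t \<noteq> 0" using fac[OF t0] False t0 tm[OF t] by simp
    ultimately have "E n t = L n t / (t - m\<^sup>2 / t)"
      unfolding E_def L_def diff_divide_distrib by (simp only: nonzero_mult_div_cancel_right not_False_eq_True)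
    then show ?thesis using False t0 tm[OF t] unfolding fac[OF t0] by (simp add: G_def Lm mult.commute)
  next
    case True
    have dX: "(X n has_field_derivative deriv (X n) m) (at m)"
      using holX[OF n] open_domain_D mD by (rule holomorphic_derivI)
    have dP: "(P n has_field_derivative deriv (P n) m) (at m)"
      using holP[OF n] open_domain_D mD by (rule holomorphic_derivI)
    have Xm: "X n m = 0" using m_nz by (simp add: X_def power2_eq_square)
    have "((\<lambda>s. (X n s - X n m) / (s - m)) \<longlongrightarrow> deriv (X n) m) (at m)"
      using dX by (simp add: has_field_derivative_iff)
    then have "((\<lambda>s. s / (s + m) * ((X n s - X n m) / (s - m))) \<longlongrightarrow> m / (m + m) * deriv (X n) m) (at m)"
      using m_nz by (intro tendsto_intros) auto
    moreover have "\<forall>\<^sub>F s in at m. s / (s + m) * ((X n s - X n m) / (s - m)) = X n s / (s - m\<^sup>2 / s)"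
    proof -
      have "\<forall>\<^sub>F s in at m. s \<in> ?D - {m}"
        using open_domain_D mD by (auto simp: eventually_at_topological)
      then show ?thesis
      proof eventually_elim
        case (elim s)
        then have "s \<noteq> 0" "s \<noteq> m" using domain_D_props by auto
        then show ?case unfolding fac[OF \<open>s \<noteq> 0\<close>] using elim tm[of s] by (simp add: Xm mult.commute)
      qed
    qed
    ultimately have "((\<lambda>s. X n s / (s - m\<^sup>2 / s)) \<longlongrightarrow> m / (m + m) * deriv (X n) m) (at m)"
      by (rule Lim_transform_eventually)
    then have "Lim (at m) (\<lambda>s. X n s / (s - m\<^sup>2 / s)) = m / (m + m) * deriv (X n) m"
      by (intro tendsto_Lim) auto
    then have q: "chi_quot R n m = 1 / 2 * deriv (X n) m"
      using m_nz by (simp add: chi_quot_def X_def Let_def)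
    have "((\<lambda>t. t - m\<^sup>2 / t) has_field_derivative 2) (at m)"
      using m_nz by (auto intro!: derivative_eq_intros simp: power2_eq_square)
    from DERIV_diff[OF DERIV_mult[OF dP this] dX]
    have "(L n has_field_derivative 2 * P n m - deriv (X n) m) (at m)"
      using m_nz unfolding L_def[abs_def] by (simp add: power2_eq_square mult.commute)
    then have "deriv (L n) m = 2 * P n m - deriv (X n) m" by (rule DERIV_imp_deriv)
    then show ?thesis using True m_nz by (simp add: E_def q G_def)
  qed
  obtain U where U: "\<And>n. bergman_potential n (p n) (U n)"
    using orthonormal_structure[OF assms(2)] by blast
  obtain C0 where C0: "C0 \<ge> 0" and as: "\<And>n. n \<ge> 1 \<Longrightarrow> defect_asymptotics C0 n (U n)"
    using defect_deriv_asymptotics U by blast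
  have c0: "amplitude n \<noteq> 0" if "n \<ge> 1" for n using that m2 m_nz by (simp add: amplitude_def)
  define \<epsilon> where "\<epsilon> n t = (deriv (vlam (U n)) t + amplitude n * (chi R (of_nat n * t) / (of_nat n * t))) / amplitude n" for n t
  \<comment> \<open>The two involution images of the relative error of the derivative of the potential combine to \<open>L\<close>.\<close>
  have L_eps: "L n t = - of_nat n * (t * \<epsilon> n t - m\<^sup>2 / t * \<epsilon> n (m\<^sup>2 / t))" if n: "n \<ge> 1" and t: "t \<in> ?D" for n t
  proof -
    have ta: "t \<in> ann" and t0: "t \<noteq> 0" using domain_D_props t by auto
    define V' where "V' = deriv (vlam (U n))"
    have "deriv (\<lambda>t. vlam (U n) t + vlam (U n) (m\<^sup>2 / t)) t = V' t + V' (m\<^sup>2 / t) * (- m\<^sup>2 / t\<^sup>2)"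
      unfolding V'_def by (rule DERIV_imp_deriv[OF vlam_symmetrised_derivative[OF ta]])
    then have "poly (p n) (h t) * (t * deriv h t) = t * V' t - m\<^sup>2 / t * V' (m\<^sup>2 / t)"
      using U[of n] ta t0 by (simp add: bergman_potential_def field_simps power2_eq_square)
    moreover have sV: "s * V' s = amplitude n * (s * \<epsilon> n s - chi R (of_nat n * s) / of_nat n)" if "s \<noteq> 0" for s
    proof -
      have "V' s = amplitude n * (\<epsilon> n s - chi R (of_nat n * s) / (of_nat n * s))"
        using c0[OF n] by (simp add: \<epsilon>_def V'_def field_simps)
      then show ?thesis using that n by (simp add: right_diff_distrib)
    qed
    moreover have "m\<^sup>2 / t \<noteq> 0" using t0 m_nz by simp
    ultimately have "poly (p n) (h t) * (t * deriv h t) =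
        amplitude n * (t * \<epsilon> n t - chi R (of_nat n * t) / of_nat n)
        - amplitude n * (m\<^sup>2 / t * \<epsilon> n (m\<^sup>2 / t) - chi R (of_nat n * (m\<^sup>2 / t)) / of_nat n)"
      using t0 by (simp only: sV not_False_eq_True)
    also have "\<dots> = amplitude n * (t * \<epsilon> n t - m\<^sup>2 / t * \<epsilon> n (m\<^sup>2 / t) - X n t / of_nat n)"
      by (simp add: X_def diff_divide_distrib right_diff_distrib)
    finally have "poly (p n) (h t) * (t * deriv h t) = amplitude n * (t * \<epsilon> n t - m\<^sup>2 / t * \<epsilon> n (m\<^sup>2 / t) - X n t / of_nat n)" .
    then have "poly (p n) (h t) * (t * deriv h t * W t) = W t * (amplitude n * (t * \<epsilon> n t - m\<^sup>2 / t * \<epsilon> n (m\<^sup>2 / t) - X n t / of_nat n))"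
      by (simp add: mult_ac)
    then have main: "poly (p n) (h t) * (of_real R * (1 - m\<^sup>2) * (1 - m ^ 4) * (t - m\<^sup>2 / t)) =
        - (W t * (amplitude n * (t * \<epsilon> n t - m\<^sup>2 / t * \<epsilon> n (m\<^sup>2 / t) - X n t / of_nat n)))"
      unfolding W_def deriv_h[OF ta] mult_minus_right by (rule equation_minus_iff[THEN iffD1, OF sym])
    define S where "S = complex_of_real (sqrt n)"
    have S: "S \<noteq> 0" "of_nat n = S * S" using n by (simp_all add: S_def flip: of_real_mult)
    have W0: "W t \<noteq> 0" using domain_D_props[OF t] by (simp add: W_def)
    define Y where "Y = t * \<epsilon> n t - m\<^sup>2 / t * \<epsilon> n (m\<^sup>2 / t)"
    define T where "T = t - m\<^sup>2 / t"
    have "P n t * T = poly (p n) (h t) * (of_real R * (1 - m\<^sup>2) * (1 - m ^ 4) * T) * (S / (m ^ n * W t * (1 - m\<^sup>2)))"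
      using m2 m4 R0 W0 S m_nz by (simp add: P_def calP_h pref_def S_def[symmetric] field_simps)
    also have "\<dots> = - (W t * (amplitude n * (Y - X n t / (S * S)))) * (S / (m ^ n * W t * (1 - m\<^sup>2)))"
      using main unfolding T_def Y_def S(2) by (simp only:)
    also have "\<dots> = X n t - S * S * Y"
      using m2 W0 S(1) m_nz by (simp add: amplitude_def S_def[symmetric] field_simps)
    finally show ?thesis unfolding L_def T_def[symmetric] Y_def[symmetric] S(2) by simp
  qed
  have bound: "bigo_locally_uniformly ?D E (\<lambda>n. 1 / real n)"
    unfolding bigo_locally_uniformly_def
  proof (intro allI impI)
    fix K assume K: "compact K \<and> K \<subseteq> ?D"
    obtain \<rho> where \<rho>: "\<rho> > 0" "cball m \<rho> \<subseteq> ?D"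
      using open_domain_D mD open_contains_cball by blast
    \<comment> \<open>Enlarged so that it contains a circle around \<open>m\<close>, where the error is under control, and then made
    invariant under the involution.\<close>
    define K1 where "K1 = K \<union> cball m \<rho>"
    have K1: "compact K1" "K1 \<subseteq> ?D" using K \<rho> by (auto simp: K1_def)
    define K2 where "K2 = K1 \<union> (\<lambda>t. m\<^sup>2 / t) ` K1"
    have "continuous_on K1 (\<lambda>t. m\<^sup>2 / t)"
      using K1 domain_D_props by (intro continuous_intros) auto
    then have K2: "compact K2" "K2 \<subseteq> ?D"
      unfolding K2_def using K1 involution_domain_D by (auto intro!: compact_Un compact_continuous_image)
    have "K2 \<noteq> {}" using \<rho>(1) by (auto simp: K2_def K1_def)
    moreover have "continuous_on K2 (\<lambda>t. margin t)"
      unfolding margin_def by (intro continuous_intros)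
    ultimately obtain t0 where t0: "t0 \<in> K2" "\<And>t. t \<in> K2 \<Longrightarrow> margin t0 \<le> margin t"
      using continuous_attains_inf[OF K2(1)] by blast
    define d0 where "d0 = margin t0"
    have d0: "d0 > 0" using t0(1) K2(2) domain_D_iff by (auto simp: d0_def)
    obtain C where C: "C \<ge> 0" and est: "\<And>n t. n \<ge> 1 \<Longrightarrow> d0 \<le> margin t \<Longrightarrow>
      cmod (deriv (vlam (U n)) t + amplitude n * (chi R (of_nat n * t) / (of_nat n * t)))
        \<le> C * (sqrt n * \<mu> ^ n / (real n)\<^sup>2)"
      using vlam_deriv_chi_estimate[OF C0 d0] as by meson
    note mu2 = one_minus_mu2(1)
    define C1 where "C1 = C / (1 - \<mu>\<^sup>2)"
    have C1: "C1 \<ge> 0" using C mu2 by (simp add: C1_def)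
    have eps: "cmod (\<epsilon> n t) \<le> C1 / (real n)\<^sup>2" if n: "n \<ge> 1" and t: "t \<in> K2" for n t
    proof -
      have pos: "sqrt n * \<mu> ^ n > 0" using n mu_props by simp
      have "cmod (\<epsilon> n t) \<le> C * (sqrt n * \<mu> ^ n / (real n)\<^sup>2) / ((1 - \<mu>\<^sup>2) * (sqrt n * \<mu> ^ n))"
        unfolding \<epsilon>_def norm_divide norm_amplitude using est[OF n, of t] t0(2)[OF t] mu2 pos
        by (intro divide_right_mono) (auto simp: d0_def)
      also have "\<dots> = C1 / (real n)\<^sup>2"
      proof -
        define x where "x = sqrt n * \<mu> ^ n"
        have "x \<noteq> 0" using pos unfolding x_def[symmetric] by simp
        then show ?thesis unfolding C1_def x_def[symmetric] by simp
      qed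
      finally show ?thesis .
    qed
    have Lb: "cmod (L n t) \<le> 2 * C1 / real n" if n: "n \<ge> 1" and t: "t \<in> K1" for n t
    proof -
      have tD: "t \<in> ?D" and t2: "t \<in> K2" "m\<^sup>2 / t \<in> K2" using t K1 by (auto simp: K2_def)
      have le1: "cmod t \<le> 1" "cmod (m\<^sup>2 / t) \<le> 1"
        using domain_D_props(3)[OF tD] domain_D_props(3)[OF involution_domain_D[OF tD]] by auto
      have "cmod (L n t) = real n * cmod (t * \<epsilon> n t - m\<^sup>2 / t * \<epsilon> n (m\<^sup>2 / t))"
        unfolding L_eps[OF n tD] norm_mult norm_minus_cancel by simp
      also have "\<dots> \<le> real n * (cmod t * cmod (\<epsilon> n t) + cmod (m\<^sup>2 / t) * cmod (\<epsilon> n (m\<^sup>2 / t)))"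
        using norm_triangle_ineq4[of "t * \<epsilon> n t" "m\<^sup>2 / t * \<epsilon> n (m\<^sup>2 / t)"] unfolding norm_mult
        by (intro mult_left_mono) auto
      also have "\<dots> \<le> real n * (1 * (C1 / (real n)\<^sup>2) + 1 * (C1 / (real n)\<^sup>2))"
        using le1 eps[OF n t2(1)] eps[OF n t2(2)] by (intro mult_left_mono add_mono mult_mono) auto
      also have "\<dots> = 2 * C1 / real n" using n by (simp add: power2_eq_square)
      finally show ?thesis .
    qed
    have far: "cmod (G n t) \<le> 2 * C1 / \<rho> / real n" if n: "n \<ge> 1" and t: "t \<in> K1" and d: "\<rho> \<le> cmod (t - m)" for n t
    proof -
      have "t \<noteq> m" using d \<rho> by auto
      then have "cmod (G n t) = cmod (L n t) / cmod (t - m)" by (simp add: G_def Lm norm_divide)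
      also have "\<dots> \<le> (2 * C1 / real n) / \<rho>"
        using Lb[OF n t] d \<rho>(1) C1 by (intro frac_le) auto
      finally show ?thesis by (simp add: mult.commute)
    qed
    have Gb: "cmod (G n t) \<le> 2 * C1 / \<rho> / real n" if n: "n \<ge> 1" and t: "t \<in> K" for n t
    proof (cases "\<rho> \<le> cmod (t - m)")
      case True
      then show ?thesis using far n t by (auto simp: K1_def)
    next
      case False
      have hG: "G n holomorphic_on ?D"
        unfolding G_def[abs_def] by (rule pole_lemma_open[OF holL[OF n] open_domain_D])
      show ?thesis
      proof (rule maximum_modulus_frontier[of "G n" "cball m \<rho>"])
        show "G n holomorphic_on interior (cball m \<rho>)"
          using hG \<rho>(2) interior_subset holomorphic_on_subset by blast
        show "continuous_on (closure (cball m \<rho>)) (G n)"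
          using holomorphic_on_imp_continuous_on[OF hG] \<rho>(2) by (auto intro: continuous_on_subset)
        show "t \<in> cball m \<rho>" using False by (simp add: dist_norm norm_minus_commute)
        fix z assume "z \<in> frontier (cball m \<rho>)"
        then have "cmod (z - m) = \<rho>" using \<rho>(1) by (simp add: dist_norm norm_minus_commute)
        moreover from this have "z \<in> K1" by (simp add: K1_def dist_norm norm_minus_commute)
        ultimately show "cmod (G n z) \<le> 2 * C1 / \<rho> / real n" using far[OF n] by simp
      qed simp
    qed
    have "cmod (E n t) \<le> 2 * C1 / \<rho> * (1 / real n)" if n: "n \<ge> 1" and t: "t \<in> K" for n t
    proof -
      have tD: "t \<in> ?D" using t K by auto
      have "(cmod t)\<^sup>2 \<le> (cmod (t + m))\<^sup>2"
        unfolding cmod_power2 using domain_D_props(1)[OF tD] mu_props by (simp add: power2_sum)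
      then have "cmod t \<le> cmod (t + m)" by (rule power2_le_imp_le) simp
      then have "cmod (t / (t + m)) \<le> 1" using tm[OF tD] by (simp add: norm_divide)
      then have "cmod (t / (t + m)) * cmod (G n t) \<le> 1 * cmod (G n t)" by (rule mult_right_mono) simp
      also have "\<dots> \<le> 2 * C1 / \<rho> / real n" using Gb[OF n t] by simp
      finally show ?thesis unfolding EG[OF n tD] norm_mult by simp
    qed
    then show "\<exists>C. \<forall>\<^sub>F n in sequentially. \<forall>t\<in>K. cmod (E n t) \<le> C * (1 / real n)"
      by (intro exI[of _ "2 * C1 / \<rho>"] eventually_sequentiallyI[of 1]) auto
  qed
  have eq: "calP R p n t = pref n t * (chi_quot R n t + E n t)" if "n \<ge> 1" "t \<in> ?D" for n t
    using pref0[OF that] by (simp add: E_def P_def)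
  show ?thesis unfolding Let_def
    by (rule exI[of _ E]) (use bound eq in \<open>simp add: pref_def W_def\<close>)
qed

end
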